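(* Let $\Sigma$ be a closed orientable surface whose genus $g$ is larger than one and $\omega$ a symplectic form on $\Sigma$. There are no smooth vector fields $X_1,\ldots,X_{2g}$ on $\Sigma$ satisfying all of the following conditions: (1) $\mathcal{L}_{X_i}\omega=0$ for every $i$; (2) $\{[\iota_{X_1}\omega],\ldots,[\iota_{X_{2g}}\omega]\}$ is a basis of $H^1(\Sigma;\mathbb{R})$; (3) $[X_i,X_j]=0$ for any $i,j$.
   Context: $\mathcal{L}_X$ and $\iota_X$ denote the Lie derivative and interior product with respect to a vector field $X$, and $[X_i,X_j]$ is the Lie bracket of vector fields. Under (1) each $\iota_{X_i}\omega$ is a closed 1-form and $[\iota_{X_i}\omega]$ is its de Rham class. *)

theory Defs
  imports "HOL-Analysis.Analysis" "HOL-Library.Extended_Nat" "HOL-Algebra.Module"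
begin

section \<open>Smooth maps between open subsets of Euclidean spaces\<close>

text \<open>Only meant for open \<open>U\<close>: the derivatives are full derivatives, not derivatives within \<open>U\<close>.\<close>

primrec Ck_on ::
  "nat \<Rightarrow> 'a::real_normed_vector set \<Rightarrow> ('a \<Rightarrow> 'b::real_normed_vector) \<Rightarrow> bool" where
  "Ck_on 0 U f \<longleftrightarrow> continuous_on U f"
| "Ck_on (Suc k) U f \<longleftrightarrow>
     (\<forall>x\<in>U. f differentiable (at x)) \<and>
     (\<forall>v. Ck_on k U (\<lambda>x. frechet_derivative f (at x) v))"

definition smooth_on ::
  "'a::real_normed_vector set \<Rightarrow> ('a \<Rightarrow> 'b::real_normed_vector) \<Rightarrow> bool" where
  "smooth_on U f \<longleftrightarrow> (\<forall>k. Ck_on k U f)"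

section \<open>Smooth manifolds\<close>

text \<open>A chart is a pair of its domain and its coordinate map.\<close>

type_synonym ('a, 'n) chart = "'a set \<times> ('a \<Rightarrow> real ^ 'n)"

definition chart_image :: "('a, 'n::finite) chart \<Rightarrow> (real ^ 'n) set" where
  "chart_image c = snd c ` fst c"

definition chart_inv :: "('a, 'n::finite) chart \<Rightarrow> real ^ 'n \<Rightarrow> 'a" where
  "chart_inv c = inv_into (fst c) (snd c)"

definition overlap :: "('a, 'n::finite) chart \<Rightarrow> ('a, 'n) chart \<Rightarrow> (real ^ 'n) set" where
  "overlap c d = snd c ` (fst c \<inter> fst d)"

definition transition ::
  "('a, 'n::finite) chart \<Rightarrow> ('a, 'n) chart \<Rightarrow> real ^ 'n \<Rightarrow> real ^ 'n" where
  "transition c d = snd d \<circ> chart_inv c"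

definition chart_on :: "'a topology \<Rightarrow> ('a, 'n::finite) chart \<Rightarrow> bool" where
  "chart_on M c \<longleftrightarrow>
     openin M (fst c) \<and> open (chart_image c) \<and>
     homeomorphic_map (subtopology M (fst c)) (top_of_set (chart_image c)) (snd c)"

definition smooth_atlas :: "'a topology \<Rightarrow> ('a, 'n::finite) chart set \<Rightarrow> bool" where
  "smooth_atlas M A \<longleftrightarrow>
     (\<forall>c\<in>A. chart_on M c) \<and> (\<Union>c\<in>A. fst c) = topspace M \<and>
     (\<forall>c\<in>A. \<forall>d\<in>A. smooth_on (overlap c d) (transition c d))"

definition smooth_manifold :: "'a topology \<Rightarrow> ('a, 'n::finite) chart set \<Rightarrow> bool" where
  "smooth_manifold M A \<longleftrightarrow>
     Hausdorff_space M \<and> second_countable M \<and> smooth_atlas M A"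

text \<open>Orientability: the smooth structure of \<open>A\<close> contains an oriented atlas.\<close>

definition orientable :: "'a topology \<Rightarrow> ('a, 'n::finite) chart set \<Rightarrow> bool" where
  "orientable M A \<longleftrightarrow>
     (\<exists>B. smooth_atlas M B \<and> smooth_atlas M (A \<union> B) \<and>
          (\<forall>c\<in>B. \<forall>d\<in>B. \<forall>x\<in>overlap c d.
             det (matrix (frechet_derivative (transition c d) (at x))) > 0))"

definition closed_orientable_surface :: "'a topology \<Rightarrow> ('a, 2) chart set \<Rightarrow> bool" where
  "closed_orientable_surface M A \<longleftrightarrow>
     smooth_manifold M A \<and> compact_space M \<and> connected_space M \<and> orientable M A"

section \<open>Genus\<close>

definition simple_closed_curve :: "'a topology \<Rightarrow> 'a set \<Rightarrow> bool" where
  "simple_closed_curve M C \<longleftrightarrow>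
     (\<exists>\<gamma>. continuous_map (top_of_set (sphere (0::complex) 1)) M \<gamma> \<and>
          inj_on \<gamma> (sphere 0 1) \<and> C = \<gamma> ` sphere 0 1)"

text \<open>The genus is the largest number of pairwise disjoint simple closed curves along which the
  surface can be cut without becoming disconnected.\<close>

definition nonseparating_curves :: "'a topology \<Rightarrow> 'a set set \<Rightarrow> bool" where
  "nonseparating_curves M \<C> \<longleftrightarrow>
     finite \<C> \<and> (\<forall>C\<in>\<C>. simple_closed_curve M C) \<and> pairwise disjnt \<C> \<and>
     connected_space (subtopology M (topspace M - \<Union>\<C>))"

definition genus :: "'a topology \<Rightarrow> enat" where
  "genus M = Sup {enat (card \<C>) |\<C>. nonseparating_curves M \<C>}"

section \<open>Vector fields and differential forms\<close>

text \<open>Tensor fields are given by their local representations in the charts of an atlas, which have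
  to be smooth and to transform into each other by the derivatives of the transition maps. Values at
  charts outside the atlas or at points outside the image of a chart carry no meaning, so equality
  of tensor fields is always expressed on the charts and their images. A 2-form in a chart is a
  function of a point and two vectors.\<close>

type_synonym ('a, 'n) vfield = "('a, 'n) chart \<Rightarrow> real ^ 'n \<Rightarrow> real ^ 'n"
type_synonym ('a, 'n) form1 = "('a, 'n) chart \<Rightarrow> real ^ 'n \<Rightarrow> real ^ 'n \<Rightarrow> real"
type_synonym ('a, 'n) form2 = "('a, 'n) chart \<Rightarrow> real ^ 'n \<Rightarrow> real ^ 'n \<Rightarrow> real ^ 'n \<Rightarrow> real"

definition smooth_function :: "('a, 'n::finite) chart set \<Rightarrow> ('a \<Rightarrow> real) \<Rightarrow> bool" where
  "smooth_function A f \<longleftrightarrow> (\<forall>c\<in>A. smooth_on (chart_image c) (f \<circ> chart_inv c))"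

definition smooth_vector_field :: "('a, 'n::finite) chart set \<Rightarrow> ('a, 'n) vfield \<Rightarrow> bool" where
  "smooth_vector_field A X \<longleftrightarrow>
     (\<forall>c\<in>A. smooth_on (chart_image c) (X c)) \<and>
     (\<forall>c\<in>A. \<forall>d\<in>A. \<forall>x\<in>overlap c d.
        X d (transition c d x) = frechet_derivative (transition c d) (at x) (X c x))"

definition smooth_form1 :: "('a, 'n::finite) chart set \<Rightarrow> ('a, 'n) form1 \<Rightarrow> bool" where
  "smooth_form1 A \<alpha> \<longleftrightarrow>
     (\<forall>c\<in>A. \<forall>x\<in>chart_image c. linear (\<alpha> c x)) \<and>
     (\<forall>c\<in>A. \<forall>u. smooth_on (chart_image c) (\<lambda>x. \<alpha> c x u)) \<and>
     (\<forall>c\<in>A. \<forall>d\<in>A. \<forall>x\<in>overlap c d. \<forall>u.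
        \<alpha> c x u = \<alpha> d (transition c d x) (frechet_derivative (transition c d) (at x) u))"

definition smooth_form2 :: "('a, 'n::finite) chart set \<Rightarrow> ('a, 'n) form2 \<Rightarrow> bool" where
  "smooth_form2 A \<omega> \<longleftrightarrow>
     (\<forall>c\<in>A. \<forall>x\<in>chart_image c. bilinear (\<omega> c x) \<and> (\<forall>u. \<omega> c x u u = 0)) \<and>
     (\<forall>c\<in>A. \<forall>u v. smooth_on (chart_image c) (\<lambda>x. \<omega> c x u v)) \<and>
     (\<forall>c\<in>A. \<forall>d\<in>A. \<forall>x\<in>overlap c d. \<forall>u v.
        \<omega> c x u v = \<omega> d (transition c d x)
          (frechet_derivative (transition c d) (at x) u)
          (frechet_derivative (transition c d) (at x) v))"

definition d0 :: "('a \<Rightarrow> real) \<Rightarrow> ('a, 'n::finite) form1" where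
  "d0 f c x u = frechet_derivative (f \<circ> chart_inv c) (at x) u"

definition d1 :: "('a, 'n::finite) form1 \<Rightarrow> ('a, 'n) form2" where
  "d1 \<alpha> c x u v =
     frechet_derivative (\<lambda>y. \<alpha> c y v) (at x) u - frechet_derivative (\<lambda>y. \<alpha> c y u) (at x) v"

definition d2 ::
  "('a, 'n::finite) form2 \<Rightarrow>
   ('a, 'n) chart \<Rightarrow> real ^ 'n \<Rightarrow> real ^ 'n \<Rightarrow> real ^ 'n \<Rightarrow> real ^ 'n \<Rightarrow> real" where
  "d2 \<omega> c x u v w =
     frechet_derivative (\<lambda>y. \<omega> c y v w) (at x) u
     - frechet_derivative (\<lambda>y. \<omega> c y u w) (at x) v
     + frechet_derivative (\<lambda>y. \<omega> c y u v) (at x) w"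

definition symplectic_form :: "('a, 'n::finite) chart set \<Rightarrow> ('a, 'n) form2 \<Rightarrow> bool" where
  "symplectic_form A \<omega> \<longleftrightarrow>
     smooth_form2 A \<omega> \<and>
     (\<forall>c\<in>A. \<forall>x\<in>chart_image c. \<forall>u v w. d2 \<omega> c x u v w = 0) \<and>
     (\<forall>c\<in>A. \<forall>x\<in>chart_image c. \<forall>u. (\<forall>v. \<omega> c x u v = 0) \<longrightarrow> u = 0)"

definition interior_product ::
  "('a, 'n::finite) vfield \<Rightarrow> ('a, 'n) form2 \<Rightarrow> ('a, 'n) form1" where
  "interior_product X \<omega> c x v = \<omega> c x (X c x) v"

definition lie_bracket ::
  "('a, 'n::finite) vfield \<Rightarrow> ('a, 'n) vfield \<Rightarrow> ('a, 'n) vfield" where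
  "lie_bracket X Y c x =
     frechet_derivative (Y c) (at x) (X c x) - frechet_derivative (X c) (at x) (Y c x)"

text \<open>This is
  \<open>(L\<^sub>X \<omega>)(U,V) = X(\<omega>(U,V)) - \<omega>([X,U],V) - \<omega>(U,[X,V])\<close>
  for the constant coordinate fields \<open>U = u\<close>, \<open>V = v\<close>, where \<open>[X,U] = - DX u\<close>.\<close>

definition lie_derivative ::
  "('a, 'n::finite) vfield \<Rightarrow> ('a, 'n) form2 \<Rightarrow> ('a, 'n) form2" where
  "lie_derivative X \<omega> c x u v =
     frechet_derivative (\<lambda>y. \<omega> c y u v) (at x) (X c x)
     + \<omega> c x (frechet_derivative (X c) (at x) u) v
     + \<omega> c x u (frechet_derivative (X c) (at x) v)"

definition vfield_zero :: "('a, 'n::finite) chart set \<Rightarrow> ('a, 'n) vfield \<Rightarrow> bool" where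
  "vfield_zero A X \<longleftrightarrow> (\<forall>c\<in>A. \<forall>x\<in>chart_image c. X c x = 0)"

definition form2_zero :: "('a, 'n::finite) chart set \<Rightarrow> ('a, 'n) form2 \<Rightarrow> bool" where
  "form2_zero A \<omega> \<longleftrightarrow> (\<forall>c\<in>A. \<forall>x\<in>chart_image c. \<forall>u v. \<omega> c x u v = 0)"

section \<open>First de Rham cohomology\<close>

definition closed_form1 :: "('a, 'n::finite) chart set \<Rightarrow> ('a, 'n) form1 \<Rightarrow> bool" where
  "closed_form1 A \<alpha> \<longleftrightarrow> smooth_form1 A \<alpha> \<and> form2_zero A (d1 \<alpha>)"

definition exact_form1 :: "('a, 'n::finite) chart set \<Rightarrow> ('a, 'n) form1 \<Rightarrow> bool" where
  "exact_form1 A \<alpha> \<longleftrightarrow>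
     (\<exists>f. smooth_function A f \<and> (\<forall>c\<in>A. \<forall>x\<in>chart_image c. \<forall>u. \<alpha> c x u = d0 f c x u))"

definition form1_add :: "('a, 'n::finite) form1 \<Rightarrow> ('a, 'n) form1 \<Rightarrow> ('a, 'n) form1" where
  "form1_add \<alpha> \<beta> c x u = \<alpha> c x u + \<beta> c x u"

definition form1_scale :: "real \<Rightarrow> ('a, 'n::finite) form1 \<Rightarrow> ('a, 'n) form1" where
  "form1_scale r \<alpha> c x u = r * \<alpha> c x u"

definition cohomologous ::
  "('a, 'n::finite) chart set \<Rightarrow> (('a, 'n) form1 \<times> ('a, 'n) form1) set" where
  "cohomologous A =
     {(\<alpha>, \<beta>). closed_form1 A \<alpha> \<and> closed_form1 A \<beta> \<and>
              exact_form1 A (form1_add \<beta> (form1_scale (-1) \<alpha>))}"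

definition de_rham_class ::
  "('a, 'n::finite) chart set \<Rightarrow> ('a, 'n) form1 \<Rightarrow> ('a, 'n) form1 set" where
  "de_rham_class A \<alpha> = cohomologous A `` {\<alpha>}"

text \<open>\<open>H\<^sup>1\<close> as a real vector space; the multiplication fields of the record are not used.\<close>

definition de_rham_H1 ::
  "('a, 'n::finite) chart set \<Rightarrow> (real, ('a, 'n) form1 set) module" where
  "de_rham_H1 A =
     \<lparr>carrier = {\<alpha>. closed_form1 A \<alpha>} // cohomologous A,
      monoid.mult = undefined, one = undefined,
      zero = de_rham_class A (\<lambda>c x u. 0),
      add = (\<lambda>K L. \<Union>\<alpha>\<in>K. \<Union>\<beta>\<in>L. de_rham_class A (form1_add \<alpha> \<beta>)),
      smult = (\<lambda>r K. \<Union>\<alpha>\<in>K. de_rham_class A (form1_scale r \<alpha>))\<rparr>"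

definition real_ring :: "real ring" where
  "real_ring = \<lparr>carrier = UNIV, monoid.mult = (*), one = 1, zero = 0, add = (+)\<rparr>"

definition is_basis :: "(real, 'v) module \<Rightarrow> 'i set \<Rightarrow> ('i \<Rightarrow> 'v) \<Rightarrow> bool" where
  "is_basis V I b \<longleftrightarrow>
     finite I \<and> b \<in> I \<rightarrow> carrier V \<and>
     (\<forall>r::'i \<Rightarrow> real. (\<Oplus>\<^bsub>V\<^esub>i\<in>I. r i \<odot>\<^bsub>V\<^esub> b i) = \<zero>\<^bsub>V\<^esub> \<longrightarrow> (\<forall>i\<in>I. r i = 0)) \<and>
     (\<forall>v\<in>carrier V. \<exists>r::'i \<Rightarrow> real. v = (\<Oplus>\<^bsub>V\<^esub>i\<in>I. r i \<odot>\<^bsub>V\<^esub> b i))"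

subsection \<open>The vector space laws\<close>

lemma frechet_derivative_cong_open:
  assumes "open U" "x \<in> U" "\<And>y. y \<in> U \<Longrightarrow> f y = g y"
  shows "frechet_derivative f (at x) = frechet_derivative g (at x)"
proof -
  have "(f has_derivative D) (at x) \<longleftrightarrow> (g has_derivative D) (at x)" for D
    using has_derivative_transform_within_open[of f D x UNIV U g, OF _ assms]
      has_derivative_transform_within_open[of g D x UNIV U f, OF _ assms(1,2) assms(3)[symmetric]]
    by blast
  then show ?thesis
    by (simp add: frechet_derivative_def)
qed

lemma Ck_on_cong:
  assumes "open U" "\<And>x. x \<in> U \<Longrightarrow> f x = g x" "Ck_on k U f"
  shows "Ck_on k U g"
  using assms(2,3)
proof (induction k arbitrary: f g)
  case 0
  have "continuous_on U f \<longleftrightarrow> continuous_on U g"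
    by (rule continuous_on_cong[OF refl 0(1)])
  then show ?case using 0(2) unfolding Ck_on.simps by blast
next
  case (Suc k)
  have "g differentiable (at x)" if x: "x \<in> U" for x
  proof -
    have "f differentiable (at x)"
      using Suc.prems(2) x by simp
    then obtain D where "(f has_derivative D) (at x)"
      unfolding differentiable_def by blast
    then have "(g has_derivative D) (at x)"
      by (rule has_derivative_transform_within_open[OF _ assms(1) x Suc.prems(1)])
    then show ?thesis unfolding differentiable_def by blast
  qed
  moreover have "Ck_on k U (\<lambda>x. frechet_derivative g (at x) v)" for v
  proof (rule Suc.IH)
    show "Ck_on k U (\<lambda>x. frechet_derivative f (at x) v)"
      by (rule Suc.prems(2)[unfolded Ck_on.simps, THEN conjunct2, rule_format])
    show "frechet_derivative f (at x) v = frechet_derivative g (at x) v" if "x \<in> U" for x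
      by (rule fun_cong[OF frechet_derivative_cong_open[OF assms(1) that Suc.prems(1)]])
  qed
  ultimately show ?case unfolding Ck_on.simps by blast
qed

lemma frechet_derivative_lincomb:
  fixes f g :: "'a::real_normed_vector \<Rightarrow> real"
  assumes "f differentiable (at x)" "g differentiable (at x)"
  shows "(\<lambda>y. a * f y + b * g y) differentiable (at x)"
    and "frechet_derivative (\<lambda>y. a * f y + b * g y) (at x) v =
      a * frechet_derivative f (at x) v + b * frechet_derivative g (at x) v"
proof -
  let ?D = "\<lambda>v. a * frechet_derivative f (at x) v + b * frechet_derivative g (at x) v"
  have *: "((\<lambda>y. a * f y + b * g y) has_derivative ?D) (at x)"
    by (rule has_derivative_add[OF has_derivative_mult_right has_derivative_mult_right,
          OF assms[THEN iffD1[OF frechet_derivative_works]]])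
  show "(\<lambda>y. a * f y + b * g y) differentiable (at x)"
    using * unfolding differentiable_def by blast
  show "frechet_derivative (\<lambda>y. a * f y + b * g y) (at x) v = ?D v"
    using fun_cong[OF frechet_derivative_at[OF *], of v] by (rule sym)
qed

lemma Ck_on_lincomb:
  fixes f g :: "'a::real_normed_vector \<Rightarrow> real"
  assumes "open U" "Ck_on k U f" "Ck_on k U g"
  shows "Ck_on k U (\<lambda>x. a * f x + b * g x)"
  using assms(2,3)
proof (induction k arbitrary: f g)
  case 0
  then show ?case by (auto intro!: continuous_intros)
next
  case (Suc k)
  have "Ck_on k U (\<lambda>x. frechet_derivative (\<lambda>y. a * f y + b * g y) (at x) v)" for v
    by (rule Ck_on_cong[OF assms(1) _ Suc.IH[of "\<lambda>x. frechet_derivative f (at x) v"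
            "\<lambda>x. frechet_derivative g (at x) v"]])
      (use Suc.prems in \<open>auto simp: frechet_derivative_lincomb\<close>)
  then show ?case
    using Suc.prems by (auto simp: frechet_derivative_lincomb)
qed

lemma smooth_on_lincomb:
  fixes f g :: "'a::real_normed_vector \<Rightarrow> real"
  assumes "open U" "smooth_on U f" "smooth_on U g"
  shows "smooth_on U (\<lambda>x. a * f x + b * g x)"
  using Ck_on_lincomb[OF assms(1), of _ f g a b] assms(2,3) by (simp add: smooth_on_def)

lemma smooth_on_differentiable:
  assumes "smooth_on U f" "x \<in> U"
  shows "f differentiable (at x)"
proof -
  have "Ck_on (Suc 0) U f"
    using assms(1) unfolding smooth_on_def by blast
  then show ?thesis using assms(2) by simp
qed

lemma smooth_on_zero: "smooth_on U (\<lambda>x. 0 :: real)"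
proof -
  have "Ck_on k U (\<lambda>x::'a. 0 :: real)" for k
    by (induction k) auto
  then show ?thesis by (simp add: smooth_on_def)
qed

abbreviation form1_lincomb ::
  "real \<Rightarrow> ('a, 'n::finite) form1 \<Rightarrow> real \<Rightarrow> ('a, 'n) form1 \<Rightarrow> ('a, 'n) form1" where
  "form1_lincomb a \<alpha> b \<beta> \<equiv> form1_add (form1_scale a \<alpha>) (form1_scale b \<beta>)"

lemma smooth_form1D:
  assumes "smooth_form1 A \<alpha>" "c \<in> A"
  shows "x \<in> chart_image c \<Longrightarrow> linear (\<alpha> c x)"
    and "smooth_on (chart_image c) (\<lambda>x. \<alpha> c x u)"
    and "d \<in> A \<Longrightarrow> x \<in> overlap c d \<Longrightarrow>
      \<alpha> c x u = \<alpha> d (transition c d x) (frechet_derivative (transition c d) (at x) u)"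
  using assms unfolding smooth_form1_def by blast+

locale open_charts =
  fixes A :: "('a, 'n::finite) chart set"
  assumes open_image: "c \<in> A \<Longrightarrow> open (chart_image c)"
begin

lemma smooth_form1_lincomb:
  assumes "smooth_form1 A \<alpha>" "smooth_form1 A \<beta>"
  shows "smooth_form1 A (form1_lincomb a \<alpha> b \<beta>)"
  unfolding smooth_form1_def
proof (intro conjI ballI allI)
  note \<alpha> = smooth_form1D[OF assms(1)] and \<beta> = smooth_form1D[OF assms(2)]
  show "linear (form1_lincomb a \<alpha> b \<beta> c x)" if "c \<in> A" "x \<in> chart_image c" for c x
    using \<alpha>(1)[OF that] \<beta>(1)[OF that]
    by (intro linearI)
      (auto simp: form1_add_def form1_scale_def linear_add linear_scale algebra_simps)
  show "smooth_on (chart_image c) (\<lambda>x. form1_lincomb a \<alpha> b \<beta> c x u)" if "c \<in> A" for c u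
    unfolding form1_add_def form1_scale_def
    by (rule smooth_on_lincomb[OF open_image[OF that] \<alpha>(2)[OF that] \<beta>(2)[OF that]])
  fix c d x u assume *: "c \<in> A" "d \<in> A" "x \<in> overlap c d"
  show "form1_lincomb a \<alpha> b \<beta> c x u = form1_lincomb a \<alpha> b \<beta> d (transition c d x)
      (frechet_derivative (transition c d) (at x) u)"
    unfolding form1_add_def form1_scale_def \<alpha>(3)[OF *, of u] \<beta>(3)[OF *, of u] ..
qed

lemma closed_form1_lincomb:
  assumes "closed_form1 A \<alpha>" "closed_form1 A \<beta>"
  shows "closed_form1 A (form1_lincomb a \<alpha> b \<beta>)"
proof -
  have sm: "smooth_form1 A \<alpha>" "smooth_form1 A \<beta>"
    using assms by (auto simp only: closed_form1_def)
  have "d1 (form1_lincomb a \<alpha> b \<beta>) c x u v = 0" if "c \<in> A" "x \<in> chart_image c" for c x u v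
  proof -
    have "(\<lambda>y. \<alpha> c y w) differentiable (at x)" "(\<lambda>y. \<beta> c y w) differentiable (at x)" for w
      using smooth_form1D(2)[OF sm(1) that(1)] smooth_form1D(2)[OF sm(2) that(1)]
        smooth_on_differentiable that(2) by blast+
    then have "d1 (form1_lincomb a \<alpha> b \<beta>) c x u v = a * d1 \<alpha> c x u v + b * d1 \<beta> c x u v"
      by (simp add: d1_def form1_add_def form1_scale_def frechet_derivative_lincomb algebra_simps)
    then show ?thesis
      using assms that by (simp add: closed_form1_def form2_zero_def)
  qed
  then show ?thesis
    using smooth_form1_lincomb[OF sm] by (auto simp: closed_form1_def form2_zero_def)
qed

lemma closed_form1_zero: "closed_form1 A (\<lambda>c x u. 0)"
  by (auto simp: closed_form1_def smooth_form1_def form2_zero_def d1_def smooth_on_zero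
      intro: linearI)

lemma exact_form1_lincomb:
  assumes "exact_form1 A \<alpha>" "exact_form1 A \<beta>"
  shows "exact_form1 A (form1_lincomb a \<alpha> b \<beta>)"
proof -
  obtain f g where f: "smooth_function A f" "\<And>c x u. c \<in> A \<Longrightarrow> x \<in> chart_image c \<Longrightarrow> \<alpha> c x u = d0 f c x u"
    and g: "smooth_function A g" "\<And>c x u. c \<in> A \<Longrightarrow> x \<in> chart_image c \<Longrightarrow> \<beta> c x u = d0 g c x u"
    using assms by (auto simp: exact_form1_def)
  have sm: "smooth_on (chart_image c) (\<lambda>x. f (chart_inv c x))"
    "smooth_on (chart_image c) (\<lambda>x. g (chart_inv c x))" if "c \<in> A" for c
    using f(1) g(1) that by (auto simp: smooth_function_def comp_def)
  have "smooth_function A (\<lambda>p. a * f p + b * g p)"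
    using smooth_on_lincomb[OF open_image sm] by (simp add: smooth_function_def comp_def)
  moreover have "form1_lincomb a \<alpha> b \<beta> c x u = d0 (\<lambda>p. a * f p + b * g p) c x u"
    if "c \<in> A" "x \<in> chart_image c" for c x u
    using f(2)[OF that] g(2)[OF that] smooth_on_differentiable[OF sm(1)] smooth_on_differentiable[OF sm(2)] that
    by (simp add: form1_add_def form1_scale_def d0_def comp_def frechet_derivative_lincomb)
  ultimately show ?thesis
    unfolding exact_form1_def by blast
qed

lemma exact_form1_zero: "exact_form1 A (\<lambda>c x u. 0)"
  unfolding exact_form1_def
  by (rule exI[of _ "\<lambda>_. 0"]) (auto simp: smooth_function_def d0_def comp_def smooth_on_zero)

lemma equiv_cohomologous: "equiv {\<alpha>. closed_form1 A \<alpha>} (cohomologous A)"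
proof (rule equivI)
  show "cohomologous A \<subseteq> {\<alpha>. closed_form1 A \<alpha>} \<times> {\<alpha>. closed_form1 A \<alpha>}"
    by (auto simp: cohomologous_def)
  show "refl_on {\<alpha>. closed_form1 A \<alpha>} (cohomologous A)"
    using exact_form1_zero
    by (auto simp: refl_on_def cohomologous_def form1_add_def[abs_def] form1_scale_def)
  show "sym (cohomologous A)"
  proof (rule symI)
    fix \<alpha> \<beta> assume *: "(\<alpha>, \<beta>) \<in> cohomologous A"
    let ?\<eta> = "form1_add \<beta> (form1_scale (-1) \<alpha>)"
    have "form1_lincomb (-1) ?\<eta> 0 ?\<eta> = form1_add \<alpha> (form1_scale (-1) \<beta>)"
      by (auto simp: form1_add_def form1_scale_def fun_eq_iff)
    then show "(\<beta>, \<alpha>) \<in> cohomologous A"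
      using * exact_form1_lincomb[of ?\<eta> ?\<eta> "-1" 0] by (auto simp: cohomologous_def)
  qed
  show "trans (cohomologous A)"
  proof (rule transI)
    fix \<alpha> \<beta> \<gamma> assume *: "(\<alpha>, \<beta>) \<in> cohomologous A" "(\<beta>, \<gamma>) \<in> cohomologous A"
    let ?\<eta> = "form1_add \<beta> (form1_scale (-1) \<alpha>)"
    let ?\<theta> = "form1_add \<gamma> (form1_scale (-1) \<beta>)"
    have "form1_lincomb 1 ?\<eta> 1 ?\<theta> = form1_add \<gamma> (form1_scale (-1) \<alpha>)"
      by (auto simp: form1_add_def form1_scale_def fun_eq_iff)
    then show "(\<alpha>, \<gamma>) \<in> cohomologous A"
      using * exact_form1_lincomb[of ?\<eta> ?\<theta> 1 1] by (auto simp: cohomologous_def)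
  qed
qed

lemma cohomologous_lincomb:
  assumes "(\<alpha>, \<alpha>') \<in> cohomologous A" "(\<beta>, \<beta>') \<in> cohomologous A"
  shows "(form1_lincomb a \<alpha> b \<beta>, form1_lincomb a \<alpha>' b \<beta>') \<in> cohomologous A"
proof -
  let ?\<eta> = "form1_add \<alpha>' (form1_scale (-1) \<alpha>)"
  let ?\<theta> = "form1_add \<beta>' (form1_scale (-1) \<beta>)"
  have "form1_lincomb a ?\<eta> b ?\<theta> =
      form1_add (form1_lincomb a \<alpha>' b \<beta>') (form1_scale (-1) (form1_lincomb a \<alpha> b \<beta>))"
    by (auto simp: form1_add_def form1_scale_def fun_eq_iff algebra_simps)
  then show ?thesis
    using assms exact_form1_lincomb[of ?\<eta> ?\<theta> a b]
    by (auto simp: cohomologous_def closed_form1_lincomb)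
qed

lemma form1_add_eq: "form1_lincomb 1 \<alpha> 1 \<beta> = form1_add \<alpha> \<beta>"
  by (auto simp: form1_add_def form1_scale_def fun_eq_iff)

lemma form1_scale_eq: "form1_lincomb r \<alpha> 0 \<alpha> = form1_scale r \<alpha>"
  by (auto simp: form1_add_def form1_scale_def fun_eq_iff)

lemma closed_form1_add: "closed_form1 A \<alpha> \<Longrightarrow> closed_form1 A \<beta> \<Longrightarrow> closed_form1 A (form1_add \<alpha> \<beta>)"
  using closed_form1_lincomb[of \<alpha> \<beta> 1 1] form1_add_eq[of \<alpha> \<beta>] by simp

lemma closed_form1_scale: "closed_form1 A \<alpha> \<Longrightarrow> closed_form1 A (form1_scale r \<alpha>)"
  using closed_form1_lincomb[of \<alpha> \<alpha> r 0] form1_scale_eq[of r \<alpha>] by simp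

lemma carrier_H1: "carrier (de_rham_H1 A) = de_rham_class A ` {\<alpha>. closed_form1 A \<alpha>}"
  by (auto simp: de_rham_H1_def quotient_def de_rham_class_def)

lemma zero_H1: "\<zero>\<^bsub>de_rham_H1 A\<^esub> = de_rham_class A (\<lambda>c x u. 0)"
  by (simp add: de_rham_H1_def)

lemma add_H1:
  assumes "closed_form1 A \<alpha>" "closed_form1 A \<beta>"
  shows "de_rham_class A \<alpha> \<oplus>\<^bsub>de_rham_H1 A\<^esub> de_rham_class A \<beta> = de_rham_class A (form1_add \<alpha> \<beta>)"
proof -
  have "(\<lambda>\<alpha> \<beta>. de_rham_class A (form1_add \<alpha> \<beta>)) respects2 cohomologous A"
  proof (rule congruent2I'[of "cohomologous A" "cohomologous A"])
    fix \<alpha> \<alpha>' \<beta> \<beta>' assume *: "(\<alpha>, \<alpha>') \<in> cohomologous A" "(\<beta>, \<beta>') \<in> cohomologous A"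
    show "de_rham_class A (form1_add \<alpha> \<beta>) = de_rham_class A (form1_add \<alpha>' \<beta>')"
      unfolding de_rham_class_def
      using equiv_class_eq[OF equiv_cohomologous cohomologous_lincomb[OF *, of 1 1]]
        form1_add_eq[of \<alpha> \<beta>] form1_add_eq[of \<alpha>' \<beta>'] by simp
  qed
  from UN_equiv_class2[OF equiv_cohomologous equiv_cohomologous this, of \<alpha> \<beta>] assms
  show ?thesis by (simp add: de_rham_H1_def de_rham_class_def)
qed

lemma smult_H1:
  assumes "closed_form1 A \<alpha>"
  shows "r \<odot>\<^bsub>de_rham_H1 A\<^esub> de_rham_class A \<alpha> = de_rham_class A (form1_scale r \<alpha>)"
proof -
  have "(\<lambda>\<alpha>. de_rham_class A (form1_scale r \<alpha>)) respects cohomologous A"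
  proof (rule congruentI)
    fix \<alpha> \<alpha>' assume *: "(\<alpha>, \<alpha>') \<in> cohomologous A"
    show "de_rham_class A (form1_scale r \<alpha>) = de_rham_class A (form1_scale r \<alpha>')"
      unfolding de_rham_class_def
      using equiv_class_eq[OF equiv_cohomologous cohomologous_lincomb[OF * *, of r 0]]
        form1_scale_eq[of r \<alpha>] form1_scale_eq[of r \<alpha>'] by simp
  qed
  from UN_equiv_class[OF equiv_cohomologous this, of \<alpha>] assms
  show ?thesis by (simp add: de_rham_H1_def de_rham_class_def)
qed

lemmas H1_simps = carrier_H1 zero_H1 add_H1 smult_H1
  closed_form1_add closed_form1_scale closed_form1_zero

lemma abelian_group_H1: "abelian_group (de_rham_H1 A)"
proof (rule abelian_groupI)
  fix K assume "K \<in> carrier (de_rham_H1 A)"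
  then obtain \<alpha> where \<alpha>: "closed_form1 A \<alpha>" "K = de_rham_class A \<alpha>"
    by (auto simp: carrier_H1)
  have "form1_add (form1_scale (-1) \<alpha>) \<alpha> = (\<lambda>c x u. 0)"
    by (auto simp: form1_add_def form1_scale_def fun_eq_iff)
  then show "\<exists>L\<in>carrier (de_rham_H1 A). L \<oplus>\<^bsub>de_rham_H1 A\<^esub> K = \<zero>\<^bsub>de_rham_H1 A\<^esub>"
    using \<alpha> by (intro bexI[of _ "de_rham_class A (form1_scale (-1) \<alpha>)"]) (auto simp: H1_simps)
  have "form1_add (\<lambda>c x u. 0) \<alpha> = \<alpha>"
    by (auto simp: form1_add_def fun_eq_iff)
  then show "\<zero>\<^bsub>de_rham_H1 A\<^esub> \<oplus>\<^bsub>de_rham_H1 A\<^esub> K = K"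
    using \<alpha> by (simp add: H1_simps)
next
  fix K L J
  assume "K \<in> carrier (de_rham_H1 A)" "L \<in> carrier (de_rham_H1 A)" "J \<in> carrier (de_rham_H1 A)"
  then obtain \<alpha> \<beta> \<gamma> where *: "closed_form1 A \<alpha>" "K = de_rham_class A \<alpha>"
    "closed_form1 A \<beta>" "L = de_rham_class A \<beta>" "closed_form1 A \<gamma>" "J = de_rham_class A \<gamma>"
    by (auto simp: carrier_H1)
  have "form1_add (form1_add \<alpha> \<beta>) \<gamma> = form1_add \<alpha> (form1_add \<beta> \<gamma>)"
    by (auto simp: form1_add_def fun_eq_iff)
  then show "K \<oplus>\<^bsub>de_rham_H1 A\<^esub> L \<oplus>\<^bsub>de_rham_H1 A\<^esub> J = K \<oplus>\<^bsub>de_rham_H1 A\<^esub> (L \<oplus>\<^bsub>de_rham_H1 A\<^esub> J)"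
    using * by (simp add: H1_simps)
next
  fix K L assume "K \<in> carrier (de_rham_H1 A)" "L \<in> carrier (de_rham_H1 A)"
  then obtain \<alpha> \<beta> where *: "closed_form1 A \<alpha>" "K = de_rham_class A \<alpha>"
    "closed_form1 A \<beta>" "L = de_rham_class A \<beta>"
    by (auto simp: carrier_H1)
  have "form1_add \<alpha> \<beta> = form1_add \<beta> \<alpha>"
    by (auto simp: form1_add_def fun_eq_iff)
  then show "K \<oplus>\<^bsub>de_rham_H1 A\<^esub> L = L \<oplus>\<^bsub>de_rham_H1 A\<^esub> K"
    using * by (simp add: H1_simps)
  show "K \<oplus>\<^bsub>de_rham_H1 A\<^esub> L \<in> carrier (de_rham_H1 A)"
    using * by (simp add: H1_simps)
qed (simp add: H1_simps)

lemma module_H1: "module real_ring (de_rham_H1 A)"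
proof (rule moduleI)
  show "cring real_ring"
    by (rule cringI; (rule abelian_groupI comm_monoidI)?)
      (auto simp: real_ring_def algebra_simps intro: exI[of _ "- _"])
  show "abelian_group (de_rham_H1 A)"
    by (rule abelian_group_H1)
next
  fix a b K L
  assume K: "K \<in> carrier (de_rham_H1 A)"
  then obtain \<alpha> where \<alpha>: "closed_form1 A \<alpha>" "K = de_rham_class A \<alpha>"
    by (auto simp: carrier_H1)
  show "a \<odot>\<^bsub>de_rham_H1 A\<^esub> K \<in> carrier (de_rham_H1 A)"
    using \<alpha> by (simp add: H1_simps)
  have "form1_scale (a + b) \<alpha> = form1_add (form1_scale a \<alpha>) (form1_scale b \<alpha>)"
    by (auto simp: form1_add_def form1_scale_def fun_eq_iff algebra_simps)
  then show "(a \<oplus>\<^bsub>real_ring\<^esub> b) \<odot>\<^bsub>de_rham_H1 A\<^esub> K =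
      a \<odot>\<^bsub>de_rham_H1 A\<^esub> K \<oplus>\<^bsub>de_rham_H1 A\<^esub> b \<odot>\<^bsub>de_rham_H1 A\<^esub> K"
    using \<alpha> by (simp add: H1_simps real_ring_def)
  have "form1_scale (a * b) \<alpha> = form1_scale a (form1_scale b \<alpha>)"
    by (auto simp: form1_scale_def fun_eq_iff)
  then show "(a \<otimes>\<^bsub>real_ring\<^esub> b) \<odot>\<^bsub>de_rham_H1 A\<^esub> K =
      a \<odot>\<^bsub>de_rham_H1 A\<^esub> (b \<odot>\<^bsub>de_rham_H1 A\<^esub> K)"
    using \<alpha> by (simp add: H1_simps real_ring_def)
  have "form1_scale 1 \<alpha> = \<alpha>"
    by (auto simp: form1_scale_def fun_eq_iff)
  then show "\<one>\<^bsub>real_ring\<^esub> \<odot>\<^bsub>de_rham_H1 A\<^esub> K = K"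
    using \<alpha> by (simp add: H1_simps real_ring_def)
  assume "L \<in> carrier (de_rham_H1 A)"
  then obtain \<beta> where \<beta>: "closed_form1 A \<beta>" "L = de_rham_class A \<beta>"
    by (auto simp: carrier_H1)
  have "form1_scale a (form1_add \<alpha> \<beta>) = form1_add (form1_scale a \<alpha>) (form1_scale a \<beta>)"
    by (auto simp: form1_add_def form1_scale_def fun_eq_iff algebra_simps)
  then show "a \<odot>\<^bsub>de_rham_H1 A\<^esub> (K \<oplus>\<^bsub>de_rham_H1 A\<^esub> L) =
      a \<odot>\<^bsub>de_rham_H1 A\<^esub> K \<oplus>\<^bsub>de_rham_H1 A\<^esub> a \<odot>\<^bsub>de_rham_H1 A\<^esub> L"
    using \<alpha> \<beta> by (simp add: H1_simps)
qed

end

theorem module_de_rham_H1: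
  assumes "smooth_atlas M A"
  shows "module real_ring (de_rham_H1 A)"
proof -
  interpret open_charts A
    using assms by unfold_locales (auto simp: smooth_atlas_def chart_on_def)
  show ?thesis by (rule module_H1)
qed

end

theory Submission
  imports Defs
begin

text \<open>For commuting symplectic fields the functions \<open>c\<^sub>i\<^sub>j = \<omega>(X\<^sub>i, X\<^sub>j)\<close> are constant. Write \<open>\<alpha>\<^sub>i\<close> for the
  contraction of \<open>\<omega>\<close> with \<open>X\<^sub>i\<close>. If some \<open>c\<^sub>i\<^sub>j\<close> is not zero, then the Pluecker identity
  \<open>c\<^sub>i\<^sub>j \<alpha>\<^sub>l = c\<^sub>l\<^sub>j \<alpha>\<^sub>i - c\<^sub>l\<^sub>i \<alpha>\<^sub>j\<close> for a third field \<open>X\<^sub>l\<close> contradicts the linear independence of the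
  classes. If all \<open>c\<^sub>i\<^sub>j\<close> vanish, then, since the classes span, every closed 1-form \<open>\<beta>\<close> satisfies
  \<open>\<beta>(X\<^sub>1) = df(X\<^sub>1)\<close> for some function \<open>f\<close>, so the integral of \<open>\<beta>(X\<^sub>1) \<omega>\<close> is zero by Stokes. By
  Poincare duality \<open>\<alpha>\<^sub>1\<close> is exact, which again contradicts linear independence.

  The duality is proved without paths or triangulations. If \<open>u\<close> and \<open>h\<close> are bump functions with the
  same integral, then \<open>(u - h) \<omega> = d\<eta>\<close> for some 1-form \<open>\<eta>\<close>, and the integral of \<open>\<eta>(X\<^sub>1) \<omega>\<close> depends
  on \<open>u\<close> and \<open>h\<close> only, because two choices of \<open>\<eta>\<close> differ by a closed form. As a function of \<open>u\<close> it is,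
  up to a constant, the average with weight \<open>u\<close> of a primitive of \<open>\<alpha>\<^sub>1\<close>.\<close>

section \<open>Calculus of smooth maps\<close>

text \<open>For symplectic fields d(\<omega>(X, Y)) = - \<omega>([X, Y], .), so the pairings of
  commuting fields are locally constant. Since g > 1 there are at least four indices, hence a third
  field; the Pluecker identity holds because three vectors in a plane are dependent.

  A field that preserves \<omega> is divergence free for the measure |\<omega>|, so df(X) integrates
  like a divergence.

  The obstacle is duality: a primitive of \<alpha> = \<omega>(X, .) is usually an integral along
  paths, and its periods would have to be matched with integrals over the surface. Here the bump u
  replaces the endpoint of a path, h its fixed start, and \<eta> with d\<eta> = (u - h) \<omega> the
  path itself. As \<eta>(X) \<omega> is the wedge product of \<eta> and \<alpha>, its integral is an
  averaged path integral of \<alpha>, and the vanishing of the integral of \<beta>(X) for every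
  closed \<beta> says that the path does not matter. Connectedness provides an \<eta> for every
  u.\<close>

lemma Ck_on_SucI:
  assumes "open U" "\<And>x. x \<in> U \<Longrightarrow> (f has_derivative D x) (at x)" "\<And>v. Ck_on k U (\<lambda>x. D x v)"
  shows "Ck_on (Suc k) U f"
proof -
  have "Ck_on k U (\<lambda>x. frechet_derivative f (at x) v)" for v
    by (rule Ck_on_cong[OF assms(1) _ assms(3)]) (simp add: frechet_derivative_at[OF assms(2), symmetric])
  then show ?thesis
    using assms(2) by (auto simp: differentiable_def)
qed

lemma Ck_on_SucD:
  assumes "Ck_on (Suc k) U f"
  shows "x \<in> U \<Longrightarrow> (f has_derivative frechet_derivative f (at x)) (at x)"
    and "Ck_on k U (\<lambda>x. frechet_derivative f (at x) v)"
  using assms by (auto simp: frechet_derivative_works)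

text \<open>The recursion of \<open>Ck_on\<close> asks for continuity only at the last order; below
  that it comes from differentiability, which is the base of the induction.\<close>

lemma Ck_on_pred: "Ck_on (Suc k) U f \<Longrightarrow> Ck_on k U f"
proof (induction k arbitrary: f)
  case 0
  then show ?case
    by (auto intro!: continuous_at_imp_continuous_on differentiable_imp_continuous_within)
next
  case (Suc k)
  then show ?case unfolding Ck_on.simps(2) by blast
qed

lemma Ck_on_subset: "Ck_on k U f \<Longrightarrow> V \<subseteq> U \<Longrightarrow> Ck_on k V f"
  by (induction k arbitrary: f) (auto intro: continuous_on_subset)

text \<open>Gluing works since \<open>Ck_on\<close> uses full derivatives, which do not depend on
  the set.\<close>

lemma Ck_on_local:
  assumes "\<And>x. x \<in> U \<Longrightarrow> \<exists>V. open V \<and> x \<in> V \<and> Ck_on k V f"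
  shows "Ck_on k U f"
  using assms
proof (induction k arbitrary: f)
  case 0
  have "isCont f x" if "x \<in> U" for x
    using 0[OF that] by (auto simp: continuous_on_eq_continuous_at)
  then show ?case by (simp add: continuous_at_imp_continuous_on)
next
  case (Suc k)
  have "f differentiable (at x)" if "x \<in> U" for x
    using Suc.prems[OF that] by auto
  moreover have "Ck_on k U (\<lambda>x. frechet_derivative f (at x) v)" for v
  proof (rule Suc.IH)
    fix x assume "x \<in> U"
    then obtain V where "open V" "x \<in> V" "Ck_on (Suc k) V f"
      using Suc.prems by blast
    then show "\<exists>V. open V \<and> x \<in> V \<and> Ck_on k V (\<lambda>x. frechet_derivative f (at x) v)"
      using Ck_on_SucD(2) by blast
  qed
  ultimately show ?case unfolding Ck_on.simps by blast
qed

lemma Ck_on_const: "Ck_on k U (\<lambda>x. c)"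
  by (induction k arbitrary: c) auto

lemma Ck_on_linear_comp:
  assumes "open U" "bounded_linear L" "Ck_on k U f"
  shows "Ck_on k U (\<lambda>x. L (f x))"
  using assms(3)
proof (induction k arbitrary: f)
  case 0
  then show ?case
    using assms(2) by (auto intro: bounded_linear.continuous_on)
next
  case (Suc k)
  note D = Ck_on_SucD[OF Suc.prems]
  show ?case
    by (rule Ck_on_SucI[OF assms(1) bounded_linear.has_derivative[OF assms(2) D(1)] Suc.IH[OF D(2)]])
qed

lemma Ck_on_id: "open U \<Longrightarrow> Ck_on k U (\<lambda>x. x)"
proof (cases k)
  case (Suc n)
  then show "open U \<Longrightarrow> ?thesis"
    using Ck_on_SucI[of U "\<lambda>x. x" "\<lambda>x v. v" n] by (auto simp: Ck_on_const)
qed auto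

lemma Ck_on_linear: "open U \<Longrightarrow> bounded_linear L \<Longrightarrow> Ck_on k U L"
  using Ck_on_linear_comp[OF _ _ Ck_on_id] .

lemma Ck_on_add:
  assumes "open U" "Ck_on k U f" "Ck_on k U g"
  shows "Ck_on k U (\<lambda>x. f x + g x)"
  using assms(2,3)
proof (induction k arbitrary: f g)
  case (Suc k)
  note D = Ck_on_SucD[OF Suc.prems(1)] Ck_on_SucD[OF Suc.prems(2)]
  show ?case
    by (rule Ck_on_SucI[OF assms(1) has_derivative_add[OF D(1) D(3)] Suc.IH[OF D(2) D(4)]])
qed (simp add: continuous_on_add continuous_on_scaleR)

lemma Ck_on_sum:
  assumes "open U" "\<And>i. i \<in> I \<Longrightarrow> Ck_on k U (f i)"
  shows "Ck_on k U (\<lambda>x. \<Sum>i\<in>I. f i x)"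
  using assms(2)
proof (induction I rule: infinite_finite_induct)
  case (insert i I)
  then show ?case
    using Ck_on_add[OF assms(1), of k "f i" "\<lambda>x. \<Sum>i\<in>I. f i x"] by simp
qed (simp_all add: Ck_on_const)

lemma Ck_on_scaleR:
  fixes f :: "'a::real_normed_vector \<Rightarrow> real" and g :: "'a \<Rightarrow> 'b::real_normed_vector"
  assumes "open U" "Ck_on k U f" "Ck_on k U g"
  shows "Ck_on k U (\<lambda>x. f x *\<^sub>R g x)"
  using assms(2,3)
proof (induction k arbitrary: f g)
  case (Suc k)
  note D = Ck_on_SucD[OF Suc.prems(1)] Ck_on_SucD[OF Suc.prems(2)]
  show ?case
    by (rule Ck_on_SucI[OF assms(1) has_derivative_scaleR[OF D(1) D(3)]]; 
        (assumption | intro Ck_on_add assms Suc.IH D(2) D(4) Suc.prems[THEN Ck_on_pred]))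
qed (simp add: continuous_on_add continuous_on_scaleR)

lemma Ck_on_mult:
  fixes f g :: "'a::real_normed_vector \<Rightarrow> real"
  assumes "open U" "Ck_on k U f" "Ck_on k U g"
  shows "Ck_on k U (\<lambda>x. f x * g x)"
  using Ck_on_scaleR[OF assms] by simp

text \<open>Expanding the inner derivative in \<open>Basis\<close> turns the chain rule into a
  finite sum of products of real functions. Each factor is one order lower, and the induction
  hypothesis is applied to the partial derivatives of \<open>f\<close> with \<open>g\<close> kept
  fixed.\<close>

lemma Ck_on_compose:
  fixes f :: "'b::euclidean_space \<Rightarrow> real" and g :: "'a::real_normed_vector \<Rightarrow> 'b"
  assumes "open U" "open V" "Ck_on k V f" "Ck_on k U g" "\<And>x. x \<in> U \<Longrightarrow> g x \<in> V"
  shows "Ck_on k U (\<lambda>x. f (g x))"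
  using assms(3,4)
proof (induction k arbitrary: f)
  case 0
  have "g ` U \<subseteq> V"
    using assms(5) by blast
  with 0 show ?case
    unfolding Ck_on.simps by (rule continuous_on_compose2)
next
  case (Suc k)
  note F = Ck_on_SucD[OF Suc.prems(1)] and G = Ck_on_SucD[OF Suc.prems(2)]
  have "((\<lambda>x. f (g x)) has_derivative
      (\<lambda>v. \<Sum>e\<in>Basis. (frechet_derivative g (at x) v \<bullet> e) * frechet_derivative f (at (g x)) e)) (at x)"
    if x: "x \<in> U" for x
  proof -
    have "linear (frechet_derivative f (at (g x)))"
      using F(1)[OF assms(5)[OF x]] by (simp add: has_derivative_linear)
    then have eq: "frechet_derivative f (at (g x)) w =
        (\<Sum>e\<in>Basis. (w \<bullet> e) * frechet_derivative f (at (g x)) e)" for w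
      using linear_sum[of "frechet_derivative f (at (g x))" "\<lambda>e. (w \<bullet> e) *\<^sub>R e" Basis]
      by (simp only: euclidean_representation linear_scale real_scaleR_def)
    show ?thesis
      by (rule has_derivative_eq_rhs[OF has_derivative_compose[OF G(1)[OF x] F(1)[OF assms(5)[OF x]]]])
        (rule ext, rule eq)
  qed
  moreover have "Ck_on k U (\<lambda>x. \<Sum>e\<in>Basis.
      (frechet_derivative g (at x) v \<bullet> e) * frechet_derivative f (at (g x)) e)" for v
    by (rule Ck_on_sum[OF assms(1) Ck_on_mult[OF assms(1)
          Ck_on_linear_comp[OF assms(1) bounded_linear_inner_left G(2)]
          Suc.IH[OF F(2) Ck_on_pred[OF Suc.prems(2)]]]])
  ultimately show ?case
    by (rule Ck_on_SucI[OF assms(1)])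
qed

lemma smooth_onI: "(\<And>k. Ck_on k U f) \<Longrightarrow> smooth_on U f"
  by (simp add: smooth_on_def)

lemma smooth_onD: "smooth_on U f \<Longrightarrow> Ck_on k U f"
  by (simp add: smooth_on_def)

lemma smooth_on_cong:
  "open U \<Longrightarrow> (\<And>x. x \<in> U \<Longrightarrow> f x = g x) \<Longrightarrow> smooth_on U f \<Longrightarrow> smooth_on U g"
  unfolding smooth_on_def using Ck_on_cong by blast

lemma smooth_on_subset: "smooth_on U f \<Longrightarrow> V \<subseteq> U \<Longrightarrow> smooth_on V f"
  unfolding smooth_on_def using Ck_on_subset by blast

lemma smooth_on_local:
  "(\<And>x. x \<in> U \<Longrightarrow> \<exists>V. open V \<and> x \<in> V \<and> smooth_on V f) \<Longrightarrow> smooth_on U f"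
  unfolding smooth_on_def by (metis Ck_on_local)

lemma smooth_on_const: "smooth_on U (\<lambda>x. c)"
  by (simp add: smooth_on_def Ck_on_const)

lemma smooth_on_linear: "open U \<Longrightarrow> bounded_linear L \<Longrightarrow> smooth_on U L"
  by (simp add: smooth_on_def Ck_on_linear)

lemma smooth_on_id: "open U \<Longrightarrow> smooth_on U (\<lambda>x. x)"
  by (simp add: smooth_on_def Ck_on_id)

lemma smooth_on_linear_comp:
  "open U \<Longrightarrow> bounded_linear L \<Longrightarrow> smooth_on U f \<Longrightarrow> smooth_on U (\<lambda>x. L (f x))"
  by (simp add: smooth_on_def Ck_on_linear_comp)

lemma smooth_on_add:
  "open U \<Longrightarrow> smooth_on U f \<Longrightarrow> smooth_on U g \<Longrightarrow> smooth_on U (\<lambda>x. f x + g x)"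
  by (simp add: smooth_on_def Ck_on_add)

lemma smooth_on_sum:
  "open U \<Longrightarrow> (\<And>i. i \<in> I \<Longrightarrow> smooth_on U (f i)) \<Longrightarrow> smooth_on U (\<lambda>x. \<Sum>i\<in>I. f i x)"
  by (simp add: smooth_on_def Ck_on_sum)

lemma smooth_on_mult:
  fixes f g :: "'a::real_normed_vector \<Rightarrow> real"
  shows "open U \<Longrightarrow> smooth_on U f \<Longrightarrow> smooth_on U g \<Longrightarrow> smooth_on U (\<lambda>x. f x * g x)"
  by (simp add: smooth_on_def Ck_on_mult)

lemma smooth_on_scaleR:
  fixes f :: "'a::real_normed_vector \<Rightarrow> real" and g :: "'a \<Rightarrow> 'b::real_normed_vector"
  shows "open U \<Longrightarrow> smooth_on U f \<Longrightarrow> smooth_on U g \<Longrightarrow> smooth_on U (\<lambda>x. f x *\<^sub>R g x)"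
  by (simp add: smooth_on_def Ck_on_scaleR)

lemma smooth_on_uminus:
  fixes f :: "'a::real_normed_vector \<Rightarrow> real"
  shows "open U \<Longrightarrow> smooth_on U f \<Longrightarrow> smooth_on U (\<lambda>x. - f x)"
  using smooth_on_mult[OF _ smooth_on_const[of U "-1"]] by simp

lemma smooth_on_diff:
  fixes f g :: "'a::real_normed_vector \<Rightarrow> real"
  shows "open U \<Longrightarrow> smooth_on U f \<Longrightarrow> smooth_on U g \<Longrightarrow> smooth_on U (\<lambda>x. f x - g x)"
  using smooth_on_add[OF _ _ smooth_on_uminus, of U f g] by simp

lemma smooth_on_compose:
  fixes f :: "'b::euclidean_space \<Rightarrow> real" and g :: "'a::real_normed_vector \<Rightarrow> 'b"
  shows "open U \<Longrightarrow> open V \<Longrightarrow> smooth_on V f \<Longrightarrow> smooth_on U g \<Longrightarrow> (\<And>x. x \<in> U \<Longrightarrow> g x \<in> V) \<Longrightarrow>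
    smooth_on U (\<lambda>x. f (g x))"
  unfolding smooth_on_def by (blast intro: Ck_on_compose)

lemma smooth_on_frechet_derivative:
  "smooth_on U f \<Longrightarrow> smooth_on U (\<lambda>x. frechet_derivative f (at x) v)"
  unfolding smooth_on_def by (metis Ck_on_SucD(2))

lemma smooth_on_has_derivative:
  "smooth_on U f \<Longrightarrow> x \<in> U \<Longrightarrow> (f has_derivative frechet_derivative f (at x)) (at x)"
  by (metis smooth_onD Ck_on_SucD(1))

lemma smooth_on_continuous_on: "smooth_on U f \<Longrightarrow> continuous_on U f"
  using smooth_onD[of U f 0] by simp

text \<open>If all components of the derivative are of order k, the function is of order k + 1, for
  every k.\<close>

lemma smooth_on_primitive:
  assumes "open U" "\<And>x. x \<in> U \<Longrightarrow> (f has_derivative D x) (at x)" "\<And>v. smooth_on U (\<lambda>x. D x v)"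
  shows "smooth_on U f"
  using Ck_on_pred[OF Ck_on_SucI[OF assms(1,2) smooth_onD[OF assms(3)]]] by (rule smooth_onI)

text \<open>Composition reduces this to the one-variable \<open>inverse\<close>. Its derivative is
  minus its own square, so the induction on the order closes.\<close>

lemma smooth_on_inverse:
  fixes f :: "'a::real_normed_vector \<Rightarrow> real"
  assumes "open U" "smooth_on U f" "\<And>x. x \<in> U \<Longrightarrow> f x \<noteq> 0"
  shows "smooth_on U (\<lambda>x. inverse (f x))"
proof -
  have op: "open (- {0::real})"
    by (rule open_Compl[OF closed_singleton])
  have "Ck_on k (- {0::real}) inverse" for k
  proof (induction k)
    case 0
    show ?case by (simp add: continuous_on_inverse)
  next
    case (Suc k)
    show ?case
      by (rule Ck_on_SucI[OF op, of _ "\<lambda>x v. v * (- 1 * (inverse x * inverse x))"];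
          (intro Ck_on_mult[OF op] Ck_on_const Suc)?)
        (rule derivative_eq_intros refl | simp add: mult_ac)+
  qed
  then have "smooth_on (- {0::real}) inverse"
    by (rule smooth_onI)
  moreover have "f x \<in> - {0}" if "x \<in> U" for x
    using assms(3)[OF that] by simp
  ultimately show ?thesis
    by (rule smooth_on_compose[OF assms(1) op _ assms(2)])
qed

lemma smooth_on_vec_nth: "open U \<Longrightarrow> smooth_on U f \<Longrightarrow> smooth_on U (\<lambda>x. f x $ i)"
  for f :: "'a::real_normed_vector \<Rightarrow> real ^ 'n::finite"
  by (rule smooth_on_linear_comp[OF _ bounded_linear_vec_nth])

lemmas smooth_on_intros = smooth_on_mult smooth_on_diff smooth_on_id smooth_on_const
  smooth_on_linear bounded_linear_vec_nth open_UNIV UNIV_I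

section \<open>Symmetry of second derivatives\<close>

lemma has_real_derivative_along_line:
  assumes "(f has_derivative D) (at (x + t *\<^sub>R u))"
  shows "((\<lambda>t. f (x + t *\<^sub>R u)) has_real_derivative D u) (at t)"
proof -
  have "((\<lambda>t. x + t *\<^sub>R u) has_derivative (\<lambda>h. h *\<^sub>R u)) (at t)"
    by (auto intro!: derivative_eq_intros)
  from has_derivative_compose[OF this assms] show ?thesis
    using linear_scale[OF has_derivative_linear[OF assms]]
    by (simp add: has_field_derivative_def mult_commute_abs)
qed

text \<open>The mean value theorem is applied twice: to the increment in direction \<open>v\<close>
  as a function of the \<open>u\<close> coordinate, then to the resulting first derivative along
  \<open>v\<close>. The left side is symmetric in \<open>u\<close> and \<open>v\<close>, the right
  side is not obviously so.\<close>

lemma mixed_difference: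
  fixes f :: "'a::real_normed_vector \<Rightarrow> real"
  assumes f: "Ck_on 2 U f" and s: "s > 0"
    and U: "\<And>a b. a \<in> {0..s} \<Longrightarrow> b \<in> {0..s} \<Longrightarrow> x + a *\<^sub>R u + b *\<^sub>R v \<in> U"
  obtains a b where "a \<in> {0..s}" "b \<in> {0..s}"
    "f (x + s *\<^sub>R u + s *\<^sub>R v) - f (x + s *\<^sub>R u) - f (x + s *\<^sub>R v) + f x =
      s * s * frechet_derivative (\<lambda>y. frechet_derivative f (at y) u) (at (x + a *\<^sub>R u + b *\<^sub>R v)) v"
proof -
  have f1: "Ck_on (Suc (Suc 0)) U f" using f by (simp add: numeral_2_eq_2)
  note D1 = Ck_on_SucD(1)[OF f1] and D2 = Ck_on_SucD(1)[OF Ck_on_SucD(2)[OF f1]]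
  let ?\<phi> = "\<lambda>t. f ((x + s *\<^sub>R v) + t *\<^sub>R u) - f (x + t *\<^sub>R u)"
  let ?f' = "\<lambda>y. frechet_derivative f (at y)"
  have "DERIV ?\<phi> t :> ?f' (x + s *\<^sub>R v + t *\<^sub>R u) u - ?f' (x + t *\<^sub>R u) u" if "0 \<le> t" "t \<le> s" for t
    using U[of t s] U[of t 0] that s
    by (intro DERIV_diff has_real_derivative_along_line D1) (auto simp: add_ac)
  from MVT2[OF s this] obtain a where a: "0 < a" "a < s"
    and eq1: "?\<phi> s - ?\<phi> 0 = s * (?f' (x + s *\<^sub>R v + a *\<^sub>R u) u - ?f' (x + a *\<^sub>R u) u)"
    by auto
  have "DERIV (\<lambda>t. ?f' (x + a *\<^sub>R u + t *\<^sub>R v) u) t :>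
      frechet_derivative (\<lambda>y. ?f' y u) (at (x + a *\<^sub>R u + t *\<^sub>R v)) v" if "0 \<le> t" "t \<le> s" for t
    using U[of a t] that a by (intro has_real_derivative_along_line D2) auto
  from MVT2[OF s this] obtain b where b: "0 < b" "b < s"
    and eq2: "?f' (x + a *\<^sub>R u + s *\<^sub>R v) u - ?f' (x + a *\<^sub>R u) u =
      s * frechet_derivative (\<lambda>y. ?f' y u) (at (x + a *\<^sub>R u + b *\<^sub>R v)) v"
    by auto
  show ?thesis
  proof (rule that[of a b])
    have "x + s *\<^sub>R v + a *\<^sub>R u = x + a *\<^sub>R u + s *\<^sub>R v" "x + s *\<^sub>R v + s *\<^sub>R u = x + s *\<^sub>R u + s *\<^sub>R v"
      by (simp_all add: add_ac)
    with eq1 eq2 show "f (x + s *\<^sub>R u + s *\<^sub>R v) - f (x + s *\<^sub>R u) - f (x + s *\<^sub>R v) + f x =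
      s * s * frechet_derivative (\<lambda>y. ?f' y u) (at (x + a *\<^sub>R u + b *\<^sub>R v)) v"
      by (simp add: algebra_simps)
  qed (use a b in auto)
qed

text \<open>If the inequality failed, some \<open>m\<close> would strictly separate the two mixed
  derivatives at \<open>x\<close> and, by continuity, on a whole neighbourhood. The second
  difference over a small parallelogram forces both to take a common value there.\<close>

lemma second_derivative_le:
  fixes f :: "'a::real_normed_vector \<Rightarrow> real"
  assumes U: "open U" and x: "x \<in> U" and f: "Ck_on 2 U f"
  shows "frechet_derivative (\<lambda>y. frechet_derivative f (at y) u) (at x) v \<le>
    frechet_derivative (\<lambda>y. frechet_derivative f (at y) v) (at x) u"
proof (rule ccontr)
  let ?D = "\<lambda>u v y. frechet_derivative (\<lambda>y. frechet_derivative f (at y) u) (at y) v"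
  assume "\<not> ?thesis"
  then obtain m where m: "?D v u x < m" "m < ?D u v x"
    by (meson dense not_le)
  have "Ck_on (Suc (Suc 0)) U f" using f by (simp add: numeral_2_eq_2)
  then have cont: "continuous_on U (?D u v)" for u v
    using Ck_on_SucD(2)[OF Ck_on_SucD(2)] by (metis Ck_on.simps(1))
  then have "(?D u v \<longlongrightarrow> ?D u v x) (nhds x)" for u v
    using U x by (metis continuous_on_eq_continuous_at isCont_def tendsto_at_iff_tendsto_nhds)
  then have "\<forall>\<^sub>F y in nhds x. y \<in> U \<and> ?D v u y < m \<and> m < ?D u v y"
    using eventually_nhds_in_open[OF U x] m
    by (intro eventually_conj order_tendstoD(1)[where a = m] order_tendstoD(2)[where a = m])
  then obtain e where e: "e > 0" "\<And>y. dist y x < e \<Longrightarrow> y \<in> U \<and> ?D v u y < m \<and> m < ?D u v y"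
    unfolding eventually_nhds_metric by blast
  \<comment> \<open>The parallelogram of side \<open>s\<close> has diameter bounded by
    \<open>s * N = e / 2\<close>; the summand 1 keeps \<open>N\<close> positive when both vectors
    vanish.\<close>
  define N where "N = norm u + norm v + 1"
  define s where "s = e / 2 / N"
  have n: "N > 0" unfolding N_def by (simp add: add_nonneg_pos)
  then have s: "s > 0" using e(1) by (simp add: s_def)
  have near: "dist (x + a *\<^sub>R u + b *\<^sub>R v) x < e" if "a \<in> {0..s}" "b \<in> {0..s}" for a b
  proof -
    have "dist (x + a *\<^sub>R u + b *\<^sub>R v) x = norm (a *\<^sub>R u + b *\<^sub>R v)"
      by (simp add: dist_norm)
    also have "\<dots> \<le> a * norm u + b * norm v"
      using that norm_triangle_ineq[of "a *\<^sub>R u" "b *\<^sub>R v"] by auto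
    also have "\<dots> \<le> s * norm u + s * norm v"
      using that by (intro add_mono mult_right_mono) auto
    also have "\<dots> \<le> s * N"
      using s by (simp add: N_def algebra_simps)
    also have "\<dots> = e / 2" using n by (simp add: s_def)
    finally show ?thesis using e(1) by simp
  qed
  have near': "dist (x + a *\<^sub>R v + b *\<^sub>R u) x < e" if "a \<in> {0..s}" "b \<in> {0..s}" for a b
    using near[OF that(2,1)] by (simp add: add_ac)
  obtain a b where ab: "a \<in> {0..s}" "b \<in> {0..s}"
    "f (x + s *\<^sub>R u + s *\<^sub>R v) - f (x + s *\<^sub>R u) - f (x + s *\<^sub>R v) + f x =
      s * s * ?D u v (x + a *\<^sub>R u + b *\<^sub>R v)"
    by (rule mixed_difference[OF f s, of x u v]) (use near e(2) in blast)+
  obtain a' b' where ab': "a' \<in> {0..s}" "b' \<in> {0..s}"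
    "f (x + s *\<^sub>R v + s *\<^sub>R u) - f (x + s *\<^sub>R v) - f (x + s *\<^sub>R u) + f x =
      s * s * ?D v u (x + a' *\<^sub>R v + b' *\<^sub>R u)"
    by (rule mixed_difference[OF f s, of x v u]) (use near' e(2) in blast)+
  have "x + s *\<^sub>R v + s *\<^sub>R u = x + s *\<^sub>R u + s *\<^sub>R v" by (simp add: add_ac)
  from ab(3) ab'(3)[unfolded this]
  \<comment> \<open>Both sides are the same second difference, read in the two orders of the
    directions.\<close>
  have "s * s * ?D u v (x + a *\<^sub>R u + b *\<^sub>R v) = s * s * ?D v u (x + a' *\<^sub>R v + b' *\<^sub>R u)"
    by linarith
  then have "?D u v (x + a *\<^sub>R u + b *\<^sub>R v) = ?D v u (x + a' *\<^sub>R v + b' *\<^sub>R u)"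
    using s by simp
  with e(2)[OF near[OF ab(1,2)]] e(2)[OF near'[OF ab'(1,2)]] show False by linarith
qed

lemma second_derivative_symmetric:
  fixes f :: "'a::real_normed_vector \<Rightarrow> real"
  assumes "open U" "x \<in> U" "smooth_on U f"
  shows "frechet_derivative (\<lambda>y. frechet_derivative f (at y) u) (at x) v =
    frechet_derivative (\<lambda>y. frechet_derivative f (at y) v) (at x) u"
  using second_derivative_le[OF assms(1,2) smooth_onD[OF assms(3)]] by (intro antisym)

subsection \<open>Bump functions\<close>

text \<open>The standard flat function exp(-1/t), multiplied by powers of 1/t so that derivatives
  are combinations of members of the same family.\<close>

definition flat :: "nat \<Rightarrow> real \<Rightarrow> real" where
  "flat n t = (if t \<le> 0 then 0 else inverse t ^ n * exp (- inverse t))"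

lemma flat_tendsto_0: "(flat n \<longlongrightarrow> 0) (at 0)"
proof -
  have "((\<lambda>t::real. inverse t ^ n / exp (inverse t)) \<longlongrightarrow> 0) (at_right 0)"
    by (rule filterlim_compose[OF tendsto_power_div_exp_0 filterlim_inverse_at_top_right])
  then have "(flat n \<longlongrightarrow> 0) (at_right 0)"
    by (rule tendsto_cong[THEN iffD1, rotated])
      (auto simp: flat_def exp_minus field_simps eventually_at_right_less intro!: eventually_at_rightI[of 0 1])
  moreover have "(flat n \<longlongrightarrow> 0) (at_left 0)"
    by (rule tendsto_eventually) (auto simp: flat_def eventually_at_left_field intro!: exI[of _ "-1"])
  ultimately show ?thesis
    by (simp add: filterlim_split_at_real)
qed

lemma flat_deriv: "(flat n has_real_derivative flat (n + 2) t - real n * flat (n + 1) t) (at t)"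
proof -
  consider "t < 0" | "t = 0" | "t > 0" by linarith
  then show ?thesis
  proof cases
    case 1
    have "(flat n has_real_derivative 0) (at t)"
      by (rule has_field_derivative_transform_within_open[where S = "{..<0}", OF DERIV_const[of 0]])
        (use 1 in \<open>auto simp: flat_def\<close>)
    then show ?thesis using 1 by (simp add: flat_def)
  next
    case 2
    \<comment> \<open>The difference quotient of \<open>flat n\<close> at 0 is
      \<open>flat (Suc n)\<close>, whose limit at 0 is already known.\<close>
    have "((\<lambda>h. (flat n (0 + h) - flat n 0) / h) \<longlongrightarrow> 0) (at 0)"
      by (rule tendsto_cong[THEN iffD1, OF _ flat_tendsto_0[of "Suc n"]])
        (auto simp: flat_def field_simps intro!: always_eventually)
    then show ?thesis using 2 by (simp add: DERIV_def flat_def)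
  next
    case 3
    have "((\<lambda>t. inverse t ^ n * exp (- inverse t)) has_real_derivative
        flat (n + 2) t - real n * flat (n + 1) t) (at t)"
    proof -
      have inv: "(inverse has_real_derivative - (inverse t * inverse t)) (at t)"
        using 3 by (auto intro!: derivative_eq_intros)
      have "((\<lambda>t. inverse t ^ n) has_real_derivative - real n * inverse t ^ (n + 1)) (at t)"
        using DERIV_power[OF inv, of n] by (cases n) (simp_all add: algebra_simps)
      from DERIV_mult[OF this DERIV_chain2[OF DERIV_exp DERIV_minus[OF inv]]] show ?thesis
        using 3 by (simp add: flat_def algebra_simps)
    qed
    then show ?thesis
      by (rule has_field_derivative_transform_within_open[where S = "{0<..}"])
        (use 3 in \<open>auto simp: flat_def\<close>)
  qed
qed

lemma smooth_on_flat: "smooth_on UNIV (flat n)"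
proof (rule smooth_onI)
  show "Ck_on k UNIV (flat n)" for k
  proof (induction k arbitrary: n)
    case 0
    show ?case using flat_deriv
      by (auto intro!: continuous_at_imp_continuous_on DERIV_isCont)
  next
    case (Suc k)
    have eq: "(\<lambda>x. (flat (n + 2) x - real n * flat (n + 1) x) * v) =
        (\<lambda>x. v * flat (n + 2) x + (- v * real n) * flat (n + 1) x)" for v
      by (auto simp: algebra_simps)
    show ?case
      by (rule Ck_on_SucI[OF open_UNIV flat_deriv[unfolded has_field_derivative_def]], unfold eq)
        (rule Ck_on_lincomb[OF open_UNIV Suc Suc])
  qed
qed

definition bump :: "real \<Rightarrow> real \<Rightarrow> real" where
  "bump r t = flat 0 (r\<^sup>2 - t\<^sup>2)"

lemma bump_nonneg: "bump r t \<ge> 0"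
  and bump_pos: "\<bar>t\<bar> < r \<Longrightarrow> bump r t > 0"
  and bump_zero: "r \<ge> 0 \<Longrightarrow> \<bar>t\<bar> \<ge> r \<Longrightarrow> bump r t = 0"
proof -
  show "\<bar>t\<bar> < r \<Longrightarrow> bump r t > 0"
    using abs_square_less_1 power_strict_mono[of "\<bar>t\<bar>" r 2] by (simp add: bump_def flat_def)
  show "r \<ge> 0 \<Longrightarrow> \<bar>t\<bar> \<ge> r \<Longrightarrow> bump r t = 0"
    using power_mono[of r "\<bar>t\<bar>" 2] by (simp add: bump_def flat_def)
qed (simp add: bump_def flat_def)

lemma smooth_on_bump: "smooth_on UNIV (bump r)"
  unfolding bump_def power2_eq_square
  by (rule smooth_on_compose[OF open_UNIV open_UNIV smooth_on_flat]
    smooth_on_intros)+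

text \<open>The second summand of the denominator vanishes for |t| <= r, which makes the quotient 1
  there; for 0 <= r < R the two summands never vanish together.\<close>

definition plateau :: "real \<Rightarrow> real \<Rightarrow> real \<Rightarrow> real" where
  "plateau r R t = bump R t * inverse (bump R t + flat 0 (t\<^sup>2 - r\<^sup>2))"

lemma plateau_zero: "R \<ge> 0 \<Longrightarrow> \<bar>t\<bar> \<ge> R \<Longrightarrow> plateau r R t = 0"
  by (simp add: plateau_def bump_zero)

lemma plateau_one:
  assumes "\<bar>t\<bar> \<le> r" "r < R"
  shows "plateau r R t = 1"
proof -
  have "t\<^sup>2 \<le> r\<^sup>2" using power_mono[of "\<bar>t\<bar>" r 2] assms by simp
  moreover have "bump R t > 0" using assms by (simp add: bump_pos)
  ultimately show ?thesis by (simp add: plateau_def flat_def)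
qed

lemma smooth_on_plateau:
  assumes "0 \<le> r" "r < R"
  shows "smooth_on UNIV (plateau r R)"
proof -
  have "bump R t + flat 0 (t\<^sup>2 - r\<^sup>2) \<noteq> 0" for t
  proof (cases "\<bar>t\<bar> < R")
    case True
    moreover have "flat 0 (t\<^sup>2 - r\<^sup>2) \<ge> 0" by (simp add: flat_def)
    ultimately show ?thesis using bump_pos[of t R] by linarith
  next
    case False
    then have "r\<^sup>2 < t\<^sup>2" using power_strict_mono[of r "\<bar>t\<bar>" 2] assms by simp
    then have "flat 0 (t\<^sup>2 - r\<^sup>2) > 0" by (simp add: flat_def)
    then show ?thesis using bump_nonneg[of R t] by linarith
  qed
  moreover have "smooth_on UNIV (\<lambda>t. flat 0 (t\<^sup>2 - r\<^sup>2))"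
    unfolding power2_eq_square
    by (rule smooth_on_compose[OF open_UNIV open_UNIV smooth_on_flat]
      smooth_on_intros)+
  ultimately show ?thesis
    unfolding plateau_def
    by (intro smooth_on_mult smooth_on_inverse smooth_on_add smooth_on_bump open_UNIV)
qed

subsection \<open>Integrals depending on a parameter\<close>

text \<open>The derivatives are packaged as \<open>blinfun\<close> for the Leibniz rule. Continuity
  of this operator-valued map may be checked on basis vectors, and application to a vector commutes
  with the integral.\<close>

lemma has_derivative_integral_param:
  fixes \<psi> :: "'a::euclidean_space \<Rightarrow> real \<Rightarrow> real"
  assumes U: "open U" "convex U" and x0: "x0 \<in> U"
    and der: "\<And>x t. x \<in> U \<Longrightarrow> t \<in> {0..1} \<Longrightarrow> ((\<lambda>x. \<psi> x t) has_derivative D x t) (at x)"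
    and contD: "\<And>v. continuous_on (U \<times> {0..1}) (\<lambda>(x, t). D x t v)"
    and cont: "\<And>x. x \<in> U \<Longrightarrow> continuous_on {0..1} (\<psi> x)"
  shows "((\<lambda>x. integral {0..1} (\<psi> x)) has_derivative (\<lambda>v. integral {0..1} (\<lambda>t. D x0 t v))) (at x0)"
proof -
  define fx where "fx x t = Blinfun (D x t)" for x t
  have fx: "blinfun_apply (fx x t) = D x t" if "x \<in> U" "t \<in> {0..1}" for x t
    using der[OF that] by (simp add: fx_def has_derivative_bounded_linear bounded_linear_Blinfun_apply)
  have cfx: "continuous_on (U \<times> {0..1}) (\<lambda>(x, t). fx x t)"
  proof (rule continuous_on_blinfun_componentwise)
    fix i :: 'a
    show "continuous_on (U \<times> {0..1}) (\<lambda>x. blinfun_apply (case x of (x, t) \<Rightarrow> fx x t) i)"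
      by (rule continuous_on_eq[OF contD[of i]]) (auto simp: fx)
  qed
  have "((\<lambda>x. integral (cbox 0 1) (\<psi> x)) has_derivative integral (cbox 0 1) (fx x0)) (at x0 within U)"
  proof (rule leibniz_rule)
    show "((\<lambda>x. \<psi> x t) has_derivative blinfun_apply (fx x t)) (at x within U)"
      if "x \<in> U" "t \<in> cbox 0 1" for x t
      using der[of x t] fx[of x t] that by (simp add: has_derivative_at_withinI)
    show "\<psi> x integrable_on cbox 0 1" if "x \<in> U" for x
      using integrable_continuous[of 0 1 "\<psi> x"] cont[OF that] by simp
  qed (use x0 U cfx in simp_all)
  then have *: "((\<lambda>x. integral {0..1} (\<psi> x)) has_derivative integral {0..1} (fx x0)) (at x0)"
    using at_within_open[OF x0 U(1)] by simp
  have "continuous_on {0..1} (\<lambda>t. (\<lambda>(x, t). fx x t) (x0, t))"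
    by (rule continuous_on_compose2[OF cfx]) (use x0 in \<open>auto intro!: continuous_intros\<close>)
  then have "fx x0 integrable_on {0..1}"
    by (intro integrable_continuous_real) simp
  then have "blinfun_apply (integral {0..1} (fx x0)) = (\<lambda>v. integral {0..1} (\<lambda>t. D x0 t v))"
    using fx[OF x0] by (auto simp: blinfun_apply_integral intro!: integral_cong ext)
  then show ?thesis using * by simp
qed

text \<open>Differentiating under the integral in direction \<open>v\<close> gives an integral of
  the same kind, with the smooth integrand differentiated along \<open>(v, 0)\<close>; the induction
  therefore runs over all integrands.\<close>

lemma smooth_on_integral_param:
  fixes \<psi> :: "'a::euclidean_space \<times> real \<Rightarrow> real"
  assumes "smooth_on UNIV \<psi>"
  shows "smooth_on UNIV (\<lambda>x. integral {0..1} (\<lambda>t. \<psi> (x, t)))"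
proof -
  have der: "((\<lambda>x. integral {0..1} (\<lambda>t. \<psi> (x, t))) has_derivative
      (\<lambda>v. integral {0..1} (\<lambda>t. frechet_derivative \<psi> (at (x, t)) (v, 0)))) (at x)"
    if \<psi>: "smooth_on UNIV \<psi>" for \<psi> :: "'a \<times> real \<Rightarrow> real" and x
  proof (rule has_derivative_integral_param)
    show "((\<lambda>x. \<psi> (x, t)) has_derivative (\<lambda>v. frechet_derivative \<psi> (at (x, t)) (v, 0))) (at x)" for x t
    proof -
      have "((\<lambda>x. (x, t)) has_derivative (\<lambda>h. (h, 0))) (at x)"
        by (auto intro!: derivative_eq_intros)
      from has_derivative_compose[OF this smooth_on_has_derivative[OF \<psi> UNIV_I]] show ?thesis .
    qed
    show "continuous_on (UNIV \<times> {0..1}) (\<lambda>(x, t). frechet_derivative \<psi> (at (x, t)) (v, 0))" for v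
      using continuous_on_subset[OF smooth_on_continuous_on[OF smooth_on_frechet_derivative[OF \<psi>]]]
      by (auto simp: case_prod_unfold)
    show "continuous_on {0..1} (\<lambda>t. \<psi> (x, t))" for x
      by (rule continuous_on_compose2[OF smooth_on_continuous_on[OF \<psi>]]) (auto intro!: continuous_intros)
  qed auto
  have "Ck_on k UNIV (\<lambda>x. integral {0..1} (\<lambda>t. \<psi> (x, t)))" for k
    using assms
  proof (induction k arbitrary: \<psi>)
    case 0
    show ?case
      using has_derivative_continuous[OF der[OF 0]] by (simp add: continuous_at_imp_continuous_on)
  next
    case (Suc k)
    show ?case
      by (rule Ck_on_SucI[OF open_UNIV der[OF Suc.prems] Suc.IH[OF smooth_on_frechet_derivative[OF Suc.prems]]])
  qed
  then show ?thesis by (rule smooth_onI)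
qed

subsection \<open>Primitives of closed and of compactly supported forms\<close>

text \<open>The Poincare lemma on a convex set: the integral of the form along the segment from a
  base point \<open>p\<close> to \<open>x\<close> is a primitive. Closedness exchanges the direction
  of differentiation with the argument of the form, which makes the differentiated integrand a total
  derivative in \<open>s\<close>.\<close>

lemma closed_form_has_primitive:
  fixes a :: "'a::euclidean_space \<Rightarrow> 'a \<Rightarrow> real"
  assumes U: "open U" "convex U" and lin: "\<And>x. x \<in> U \<Longrightarrow> linear (a x)"
    and sm: "\<And>u. smooth_on U (\<lambda>x. a x u)"
    and closed: "\<And>x u v. x \<in> U \<Longrightarrow>
      frechet_derivative (\<lambda>y. a y v) (at x) u = frechet_derivative (\<lambda>y. a y u) (at x) v"
  obtains F where "\<And>x. x \<in> U \<Longrightarrow> (F has_derivative a x) (at x)"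
proof (cases "U = {}")
  case False
  then obtain p where p: "p \<in> U" by blast
  let ?q = "\<lambda>x s. p + s *\<^sub>R (x - p)"
  let ?A = "\<lambda>e x. frechet_derivative (\<lambda>y. a y e) (at x)"
  have q: "?q x s \<in> U" if "x \<in> U" "s \<in> {0..1}" for x s
  proof -
    have "?q x s = (1 - s) *\<^sub>R p + s *\<^sub>R x" by (simp add: algebra_simps)
    then show ?thesis using convexD_alt[OF U(2) p that(1), of s] that(2) by simp
  qed
  have A: "((\<lambda>y. a y e) has_derivative ?A e x) (at x)" if "x \<in> U" for x e
    by (rule smooth_on_has_derivative[OF sm that])
  have repr: "L w = (\<Sum>e\<in>Basis. (w \<bullet> e) * L e)" if "linear L" for L :: "'a \<Rightarrow> real" and w
    using linear_sum[OF that, of "\<lambda>e. (w \<bullet> e) *\<^sub>R e" Basis]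
    by (simp only: euclidean_representation linear_scale[OF that] real_scaleR_def)
  \<comment> \<open>The derivative of \<open>a (?q x s) (x - p)\<close> in direction
    \<open>v\<close>. Since \<open>x\<close> occurs both in the point and in the argument,
    \<open>x - p\<close> is expanded in \<open>Basis\<close>; the factor \<open>s\<close> comes from
    the inner map \<open>?q\<close>.\<close>
  define D where "D x s v = a (?q x s) v + s * (\<Sum>e\<in>Basis. ((x - p) \<bullet> e) * ?A e (?q x s) v)" for x s v
  have der: "((\<lambda>x. integral {0..1} (\<lambda>s. a (?q x s) (x - p))) has_derivative
      (\<lambda>v. integral {0..1} (\<lambda>s. D x s v))) (at x)" if x: "x \<in> U" for x
  proof (rule has_derivative_integral_param[OF U x])
    have cq: "continuous_on (U \<times> {0..1}) (\<lambda>(x, s). ?q x s)"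
      by (auto simp: case_prod_unfold intro!: continuous_intros)
    have cA: "continuous_on (U \<times> {0..1}) (\<lambda>(x, s). f (?q x s))" if "smooth_on U f" for f :: "'a \<Rightarrow> real"
      using continuous_on_compose2[OF smooth_on_continuous_on[OF that] cq] q
      by (auto simp: case_prod_unfold image_subset_iff)
    show "continuous_on (U \<times> {0..1}) (\<lambda>(x, s). D x s v)" for v
      unfolding D_def case_prod_unfold
      using cA[OF sm] cA[OF smooth_on_frechet_derivative[OF sm]]
      by (auto simp: case_prod_unfold intro!: continuous_intros)
    show "continuous_on {0..1} (\<lambda>s. a (?q x s) (x - p))" if "x \<in> U" for x
    proof -
      have "continuous_on {0..1} (?q x)" by (intro continuous_intros)
      with smooth_on_continuous_on[OF sm] show ?thesis
        by (rule continuous_on_compose2) (use q that in auto)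
    qed
    show "((\<lambda>x. a (?q x s) (x - p)) has_derivative D x s) (at x)" if x: "x \<in> U" and s: "s \<in> {0..1}" for x s
    proof -
      have dq: "((\<lambda>x. ?q x s) has_derivative (\<lambda>v. s *\<^sub>R v)) (at x)"
        by (auto intro!: derivative_eq_intros)
      have "((\<lambda>x. \<Sum>e\<in>Basis. ((x - p) \<bullet> e) * a (?q x s) e) has_derivative
          (\<lambda>v. \<Sum>e\<in>Basis. ((x - p) \<bullet> e) * ?A e (?q x s) (s *\<^sub>R v) + (v \<bullet> e) * a (?q x s) e)) (at x)"
        by (intro has_derivative_sum has_derivative_mult has_derivative_compose[OF dq A[OF q[OF x s]]])
          (auto intro!: derivative_eq_intros)
      moreover have "(\<lambda>v. \<Sum>e\<in>Basis. ((x - p) \<bullet> e) * ?A e (?q x s) (s *\<^sub>R v) + (v \<bullet> e) * a (?q x s) e) = D x s"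
        unfolding D_def
        by (rule ext, subst (2) repr[OF lin[OF q[OF x s]]]) (simp add: sum.distrib sum_distrib_left linear_scale[OF has_derivative_linear[OF A[OF q[OF x s]]]] mult_ac)
      ultimately have "((\<lambda>x. \<Sum>e\<in>Basis. ((x - p) \<bullet> e) * a (?q x s) e) has_derivative D x s) (at x)"
        by simp
      then show ?thesis
        by (rule has_derivative_transform_within_open[OF _ U(1) x])
          (rule repr[OF lin[OF q[OF _ s]], symmetric])
    qed
  qed
  have "integral {0..1} (\<lambda>s. D x s v) = a x v" if x: "x \<in> U" for x v
  proof -
    \<comment> \<open>\<open>s * a (?q x s) v\<close> runs from 0 to \<open>a x v\<close>, which
      gives the value of the integral.\<close>
    have "((\<lambda>s. s * a (?q x s) v) has_vector_derivative D x s v) (at s within {0..1})" if s: "s \<in> {0..1}" for s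
    proof -
      have "((\<lambda>s. a (?q x s) v) has_real_derivative ?A v (?q x s) (x - p)) (at s)"
        by (rule has_real_derivative_along_line[OF A[OF q[OF x s]]])
      from DERIV_mult[OF DERIV_ident this]
      have "((\<lambda>s. s * a (?q x s) v) has_real_derivative a (?q x s) v + s * ?A v (?q x s) (x - p)) (at s)"
        by (simp add: mult.commute add.commute)
      moreover have "?A v (?q x s) (x - p) = (\<Sum>e\<in>Basis. ((x - p) \<bullet> e) * ?A e (?q x s) v)"
        unfolding repr[OF has_derivative_linear[OF A[OF q[OF x s], of v]], of "x - p"]
        by (simp only: closed[OF q[OF x s], of v])
      ultimately show ?thesis
        by (simp add: D_def has_real_derivative_iff_has_vector_derivative has_vector_derivative_at_within)
    qed
    from fundamental_theorem_of_calculus[OF _ this] have "((\<lambda>s. D x s v) has_integral a x v) {0..1}"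
      by simp
    then show ?thesis by (rule integral_unique)
  qed
  with der that show ?thesis by auto
qed auto

text \<open>A primitive along \<open>e\<close> that starts to the left of the support of \<open>k\<close> is compactly supported
  along \<open>e\<close> once a multiple \<open>G\<close> of a bump, constant along \<open>e\<close>, is subtracted from \<open>k\<close>.\<close>

lemma compact_primitive_along:
  fixes k :: "'a::euclidean_space \<Rightarrow> real" and e :: 'a
  assumes l: "bounded_linear l" "l e = 1" and r: "r > 0" and k: "smooth_on UNIV k"
    and supp: "\<And>x. \<bar>l x - c\<bar> > r \<Longrightarrow> k x = 0"
  obtains A G where "smooth_on UNIV A" "smooth_on UNIV G" "\<And>x t. G (x + t *\<^sub>R e) = G x"
    "\<And>x. \<bar>l x - c\<bar> > r \<Longrightarrow> A x = 0"
    "\<And>x. (\<And>t. k (x + t *\<^sub>R e) = 0) \<Longrightarrow> A x = 0" "\<And>x. (\<And>t. k (x + t *\<^sub>R e) = 0) \<Longrightarrow> G x = 0"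
    "\<And>x. k x = frechet_derivative A (at x) e + G x * bump r (l x - c)"
proof -
  \<comment> \<open>The starting height lies one unit to the left of the slab that carries
    \<open>k\<close>. The point \<open>L x s\<close> runs along the line of \<open>x\<close> from
    height \<open>a\<close> at s = 0 to \<open>x\<close> itself at s = 1.\<close>
  define a where "a = c - r - 1"
  define L where "L x s = x + ((s - 1) * (l x - a)) *\<^sub>R e" for x s
  \<comment> \<open>The integral of \<open>k\<close> along this line from height \<open>a\<close> up
    to \<open>x\<close>, rescaled to the fixed interval from 0 to 1 so that it is smooth in
    \<open>x\<close>.\<close>
  define K where "K k x = (l x - a) * integral {0..1} (\<lambda>s. k (L x s))" for k :: "'a \<Rightarrow> real" and x
  \<comment> \<open>The point of the same line one unit to the right of the slab;
    \<open>K k (E x)\<close> is the total integral of \<open>k\<close> over the line.\<close>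
  define E where "E x = x + (c + r + 1 - l x) *\<^sub>R e" for x
  have l_simps: "l (x + t *\<^sub>R e) = l x + t" for x t
    using l by (simp add: linear_simps)
  have sL: "smooth_on UNIV (\<lambda>(x, s). L x s)"
    unfolding L_def case_prod_unfold
    by (intro smooth_on_add smooth_on_scaleR smooth_on_mult smooth_on_diff smooth_on_const open_UNIV
        smooth_on_linear bounded_linear_fst bounded_linear_snd bounded_linear_compose[OF l(1) bounded_linear_fst])
  have sl: "smooth_on UNIV l" by (rule smooth_on_linear[OF open_UNIV l(1)])
  have sK: "smooth_on UNIV (K k)" if "smooth_on UNIV k" for k
    unfolding K_def
    using smooth_on_integral_param[of "\<lambda>(x, s). k (L x s)"] smooth_on_compose[OF open_UNIV open_UNIV that sL UNIV_I]
    by (intro smooth_on_mult smooth_on_diff smooth_on_const sl open_UNIV) (auto simp: case_prod_unfold)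
  have dK: "frechet_derivative (K k) (at x) e = k x" if k: "smooth_on UNIV k" for k x
  proof -
    let ?k' = "\<lambda>x. frechet_derivative k (at x) e"
    have k': "(k has_derivative frechet_derivative k (at y)) (at y)" for y
      by (rule smooth_on_has_derivative[OF k UNIV_I])
    have cL: "continuous_on {0..1} (\<lambda>s. L x s)" for x
      unfolding L_def by (intro continuous_intros)
    \<comment> \<open>The left end of the segment stays at height \<open>a\<close>, so a shift of
      \<open>x\<close> by \<open>t\<close> moves the intermediate points by \<open>s * t\<close>
      only.\<close>
    have shift: "L (x + t *\<^sub>R e) s = L x s + (s * t) *\<^sub>R e" for x t s
      by (simp add: L_def l_simps algebra_simps flip: scaleR_add_left)
    have "((\<lambda>t. integral {0..1} (\<lambda>s. k (L x s + (s * t) *\<^sub>R e))) has_derivative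
        (\<lambda>v. integral {0..1} (\<lambda>s. (s * ?k' (L x s + (s * 0) *\<^sub>R e)) * v))) (at 0)"
    proof (rule has_derivative_integral_param[where U = UNIV and D = "\<lambda>t s v. (s * ?k' (L x s + (s * t) *\<^sub>R e)) * v"])
      show "((\<lambda>t. k (L x s + (s * t) *\<^sub>R e)) has_derivative (\<lambda>v. (s * ?k' (L x s + (s * t) *\<^sub>R e)) * v)) (at t)" for t s
        using DERIV_chain2[OF has_real_derivative_along_line[where x = "L x s" and t = "s * t" and u = e, OF k'] DERIV_cmult_Id[of s]]
        unfolding has_field_derivative_def by (rule has_derivative_eq_rhs) (simp add: fun_eq_iff mult_ac)
      have cL2: "continuous_on (UNIV \<times> {0..1}) (\<lambda>(t, s). L x s + (s * t) *\<^sub>R e)"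
        unfolding L_def case_prod_unfold by (intro continuous_intros)
      then show "continuous_on (UNIV \<times> {0..1}) (\<lambda>(t, s). (s * ?k' (L x s + (s * t) *\<^sub>R e)) * v)" for v
        using continuous_on_compose2[OF smooth_on_continuous_on[OF smooth_on_frechet_derivative[OF k]] cL2]
        by (auto simp: case_prod_unfold intro!: continuous_intros)
      show "continuous_on {0..1} (\<lambda>s. k (L x s + (s * t) *\<^sub>R e))" for t
        by (rule continuous_on_compose2[OF smooth_on_continuous_on[OF k]])
          (auto intro!: continuous_intros cL)
    qed auto
    then have "((\<lambda>t. integral {0..1} (\<lambda>s. k (L (x + t *\<^sub>R e) s))) has_real_derivative
        integral {0..1} (\<lambda>s. s * ?k' (L x s))) (at 0)"
      by (simp add: has_field_derivative_def shift)
    moreover have "((\<lambda>t. l (x + t *\<^sub>R e) - a) has_real_derivative 1) (at 0)"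
      unfolding l_simps by (auto intro!: derivative_eq_intros)
    ultimately have d1: "((\<lambda>t. K k (x + t *\<^sub>R e)) has_real_derivative
        integral {0..1} (\<lambda>s. k (L x s)) + integral {0..1} (\<lambda>s. s * ?k' (L x s)) * (l x - a)) (at 0)"
      unfolding K_def using DERIV_mult by fastforce
    have "((\<lambda>t. K k (x + t *\<^sub>R e)) has_real_derivative frechet_derivative (K k) (at x) e) (at 0)"
      by (rule has_real_derivative_along_line) (use smooth_on_has_derivative[OF sK[OF k], of x] in simp)
    with d1 have eq: "frechet_derivative (K k) (at x) e =
        integral {0..1} (\<lambda>s. k (L x s)) + integral {0..1} (\<lambda>s. s * ?k' (L x s)) * (l x - a)"
      using DERIV_unique by blast
    \<comment> \<open>The derivative of \<open>K k\<close> along \<open>e\<close> is the integral of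
      the derivative of \<open>s * k (L x s)\<close>, that is, the end value
      \<open>k x\<close>.\<close>
    have "((\<lambda>s. s * k (L x s)) has_vector_derivative k (L x s) + s * ?k' (L x s) * (l x - a)) (at s within {0..1})" for s
    proof -
      have "L x s = (x - (l x - a) *\<^sub>R e) + (s * (l x - a)) *\<^sub>R e" for s
        by (simp add: L_def algebra_simps flip: scaleR_add_left)
      then have "((\<lambda>s. k (L x s)) has_real_derivative ?k' (L x s) * (l x - a)) (at s)"
        using DERIV_chain2[OF has_real_derivative_along_line[where x = "x - (l x - a) *\<^sub>R e" and t = "s * (l x - a)" and u = e, OF k']
            DERIV_cmult_right[OF DERIV_ident, of "l x - a"]] by simp
      from DERIV_mult[OF DERIV_ident this] show ?thesis
        by (simp add: has_real_derivative_iff_has_vector_derivative has_vector_derivative_at_within algebra_simps)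
    qed
    from fundamental_theorem_of_calculus[OF _ this]
    have "((\<lambda>s. k (L x s) + s * ?k' (L x s) * (l x - a)) has_integral k (L x 1)) {0..1}"
      by simp
    moreover have "((\<lambda>s. k (L x s) + s * ?k' (L x s) * (l x - a)) has_integral
        integral {0..1} (\<lambda>s. k (L x s)) + integral {0..1} (\<lambda>s. s * ?k' (L x s)) * (l x - a)) {0..1}"
      by (intro has_integral_add has_integral_mult_left integrable_integral integrable_continuous_real
          continuous_intros continuous_on_compose2[OF smooth_on_continuous_on[OF k] cL]
          continuous_on_compose2[OF smooth_on_continuous_on[OF smooth_on_frechet_derivative[OF k]] cL]) auto
    ultimately have "k (L x 1) = frechet_derivative (K k) (at x) e"
      unfolding eq by (rule has_integral_unique)
    then show ?thesis by (simp add: L_def)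
  qed
  have K_line: "K k x = 0" if "\<And>t. k (x + t *\<^sub>R e) = 0" for k x
    using that by (simp add: K_def L_def)
  have lL: "l (L x s) = a + s * (l x - a)" for x s
    unfolding L_def l_simps by (simp add: algebra_simps)
  \<comment> \<open>Both ends of the segment of integration lie to the left of the slab, hence so
    does the segment.\<close>
  have K_left: "K k x = 0" if supp: "\<And>x. \<bar>l x - c\<bar> > r \<Longrightarrow> k x = 0" and left: "l x < c - r" for k x
  proof -
    have "k (L x s) = 0" if s: "s \<in> {0..1}" for s
    proof -
      have "l (L x s) = (1 - s) * a + s * l x" by (simp add: lL algebra_simps)
      also have "\<dots> \<le> max a (l x)"
        using s by (intro convex_bound_le) auto
      also have "\<dots> < c - r" using left by (simp add: a_def)
      finally show ?thesis using r by (intro supp) linarith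
    qed
    then have "integral {0..1} (\<lambda>s. k (L x s)) = integral {0..1} (\<lambda>s::real. 0)"
      by (rule integral_cong)
    then show ?thesis by (simp add: K_def)
  qed
  \<comment> \<open>To the right of the slab \<open>K k\<close> has derivative 0 along
    \<open>e\<close>, so it keeps the value of the total integral.\<close>
  have K_right: "K k x = K k (E x)" if k: "smooth_on UNIV k" "\<And>x. \<bar>l x - c\<bar> > r \<Longrightarrow> k x = 0" "l x > c + r" for k x
  proof -
    have "\<exists>m. \<forall>t\<in>{c + r - l x<..}. K k (x + t *\<^sub>R e) = m"
    proof (rule has_field_derivative_zero_constant)
      fix t assume "t \<in> {c + r - l x<..}"
      then have "k (x + t *\<^sub>R e) = 0"
        using that(2)[of "x + t *\<^sub>R e"] by (simp add: l_simps)
      with has_real_derivative_along_line[where x = x and t = t and u = e, OF smooth_on_has_derivative[OF sK[OF k(1)] UNIV_I]]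
      show "((\<lambda>t. K k (x + t *\<^sub>R e)) has_real_derivative 0) (at t within {c + r - l x<..})"
        by (simp add: dK[OF k(1)] has_field_derivative_at_within)
    qed simp
    then obtain m where m: "\<And>t. t > c + r - l x \<Longrightarrow> K k (x + t *\<^sub>R e) = m" by auto
    from m[of 0] m[of "c + r + 1 - l x"] that(3) show ?thesis
      by (simp add: E_def)
  qed
  define b where "b x = bump r (l x - c)" for x
  have sb: "smooth_on UNIV b"
    unfolding b_def by (intro smooth_on_compose[OF open_UNIV open_UNIV smooth_on_bump] smooth_on_diff sl smooth_on_const) auto
  \<comment> \<open>The total integral of the bump over a line: heights run from c - r - 1 to c + r
    + 1, a range of length 2 r + 2.\<close>
  define \<beta> where "\<beta> = (2 * r + 2) * integral {0..1} (\<lambda>s. bump r (s * (2 * r + 2) - r - 1))"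
  have cb: "continuous_on {0..1} (\<lambda>s. bump r (s * (2 * r + 2) - r - 1))"
    by (intro continuous_on_compose2[OF smooth_on_continuous_on[OF smooth_on_bump]] continuous_intros) auto
  have "integral {0..1} (\<lambda>s. bump r (s * (2 * r + 2) - r - 1)) \<noteq> 0"
  proof
    assume "integral {0..1} (\<lambda>s. bump r (s * (2 * r + 2) - r - 1)) = 0"
    then have "\<forall>s\<in>{0..1}. bump r (s * (2 * r + 2) - r - 1) = 0"
      using integral_eq_0_iff[OF cb] by (simp add: bump_nonneg)
    \<comment> \<open>At s = 1/2 the argument of the bump is 0, its centre.\<close>
    from bspec[OF this, of "1/2"] have "bump r 0 = 0" by (simp add: algebra_simps)
    then show False using bump_pos[of 0 r] r by simp
  qed
  then have \<beta>: "\<beta> \<noteq> 0" using r by (simp add: \<beta>_def)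
  have lE: "l (E x) = c + r + 1" for x by (simp add: E_def l_simps)
  have Kb: "K b (E x) = \<beta>" for x
    by (simp add: K_def b_def lL lE a_def \<beta>_def algebra_simps)
  define G where "G x = K k (E x) / \<beta>" for x
  have sE: "smooth_on UNIV E"
    unfolding E_def by (intro smooth_on_add smooth_on_scaleR smooth_on_diff smooth_on_id smooth_on_const sl open_UNIV)
  have sG: "smooth_on UNIV G"
    unfolding G_def divide_inverse
    by (intro smooth_on_mult smooth_on_const smooth_on_compose[OF open_UNIV open_UNIV sK[OF k] sE] open_UNIV) simp
  have inv: "G (x + t *\<^sub>R e) = G x" for x t
  proof -
    have "E (x + t *\<^sub>R e) = E x"
      unfolding E_def l_simps by (simp add: algebra_simps)
    then show ?thesis by (simp add: G_def)
  qed
  \<comment> \<open>By the choice of \<open>G\<close> the total integral of \<open>q\<close> over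
    every line parallel to \<open>e\<close> is 0, so its primitive also vanishes to the right of the
    slab.\<close>
  define q where "q x = k x - G x * b x" for x
  have sq: "smooth_on UNIV q"
    unfolding q_def by (intro smooth_on_diff smooth_on_mult k sG sb open_UNIV)
  have suppb: "b x = 0" if "\<bar>l x - c\<bar> > r" for x
    using that r by (simp add: b_def bump_zero)
  have suppq: "q x = 0" if "\<bar>l x - c\<bar> > r" for x
    using supp[OF that] suppb[OF that] by (simp add: q_def)
  have cont: "(\<lambda>s. f (L x s)) integrable_on {0..1}" if "smooth_on UNIV f" for f :: "'a \<Rightarrow> real" and x
    by (intro integrable_continuous_real continuous_on_compose2[OF smooth_on_continuous_on[OF that]])
      (auto simp: L_def intro!: continuous_intros)
  have GL: "G (L x s) = G x" for x s by (simp add: L_def inv)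
  have Kq: "K q x = K k x - G x * K b x" for x
    unfolding K_def q_def GL
    by (subst integral_diff) (auto intro: cont[OF k] integrable_on_mult_right cont[OF sb] simp: algebra_simps)
  have "G (E x) = G x" for x by (simp add: E_def inv)
  then have "K q (E x) = K k (E x) - G x * \<beta>" for x
    by (simp only: Kq Kb)
  then have KqE: "K q (E x) = 0" for x
    using \<beta> by (simp add: G_def)
  show ?thesis
  proof (rule that[of "K q" G])
    show "K q x = 0" if "\<bar>l x - c\<bar> > r" for x
    proof (cases "l x < c - r")
      case False
      then have "l x > c + r" using that by linarith
      from K_right[OF sq suppq this] show ?thesis by (simp add: KqE)
    qed (rule K_left[OF suppq])
    have G0: "G x = 0" if "\<And>t. k (x + t *\<^sub>R e) = 0" for x
    proof -
      have "K k (E x) = 0"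
        by (rule K_line) (simp add: E_def add.assoc that flip: scaleR_add_left)
      then show ?thesis by (simp add: G_def)
    qed
    then show "G x = 0" if "\<And>t. k (x + t *\<^sub>R e) = 0" for x using that by blast
    show "K q x = 0" if "\<And>t. k (x + t *\<^sub>R e) = 0" for x
      using K_line[of k x] G0[of x] that by (simp add: Kq)
    show "k x = frechet_derivative (K q) (at x) e + G x * bump r (l x - c)" for x
      unfolding dK[OF sq] by (simp add: q_def b_def)
  qed (use sK[OF sq] sG inv in auto)
qed

text \<open>Two applications of the one-directional lemma, along the first axis of the plane and
  then on the real line, leave a multiple of one fixed bump. Integration over the plane later
  identifies this multiple, because the two derivative terms have integral 0.\<close>

lemma compact_primitive_plane:
  fixes k :: "real ^ 2 \<Rightarrow> real"
  assumes r: "r > 0" and k: "smooth_on UNIV k" and supp: "\<And>x i. \<bar>x $ i - p $ i\<bar> > r \<Longrightarrow> k x = 0"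
  obtains A B \<gamma> where "smooth_on UNIV A" "smooth_on UNIV B"
    "\<And>x i. \<bar>x $ i - p $ i\<bar> > r \<Longrightarrow> A x = 0" "\<And>x i. \<bar>x $ i - p $ i\<bar> > r \<Longrightarrow> B x = 0"
    "\<And>x. k x = frechet_derivative A (at x) (axis 1 1) + frechet_derivative B (at x) (axis 2 1)
      + \<gamma> * (bump r (x $ 1 - p $ 1) * bump r (x $ 2 - p $ 2))"
proof -
  let ?e1 = "axis 1 1 :: real ^ 2" and ?e2 = "axis 2 1 :: real ^ 2"
  have e: "?e1 $ 1 = 1" "?e1 $ 2 = 0" "?e2 $ 1 = 0" "?e2 $ 2 = 1"
    by (simp_all add: axis_def)
  obtain A G where A: "smooth_on UNIV A" "\<And>x. \<bar>x $ 1 - p $ 1\<bar> > r \<Longrightarrow> A x = 0"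
      "\<And>x. (\<And>t. k (x + t *\<^sub>R ?e1) = 0) \<Longrightarrow> A x = 0"
    and G: "smooth_on UNIV G" "\<And>x t. G (x + t *\<^sub>R ?e1) = G x" "\<And>x. (\<And>t. k (x + t *\<^sub>R ?e1) = 0) \<Longrightarrow> G x = 0"
    and kA: "\<And>x. k x = frechet_derivative A (at x) ?e1 + G x * bump r (x $ 1 - p $ 1)"
    by (rule compact_primitive_along[OF bounded_linear_vec_nth[of 1] e(1) r k supp]) blast+
  \<comment> \<open>\<open>G\<close> is invariant along the first axis, so it is a function of the
    second coordinate alone.\<close>
  define g where "g y = G (y *\<^sub>R ?e2)" for y
  have line: "k (x + t *\<^sub>R ?e1) = 0" if "\<bar>x $ 2 - p $ 2\<bar> > r" for x t
    by (rule supp[where i = 2]) (simp add: e that)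
  have Gg: "G x = g (x $ 2)" for x
  proof -
    have "x = (x $ 2) *\<^sub>R ?e2 + (x $ 1) *\<^sub>R ?e1"
      by (simp add: vec_eq_iff forall_2 e)
    then show ?thesis unfolding g_def by (metis G(2))
  qed
  have sg: "smooth_on UNIV g"
    unfolding g_def
    by (rule smooth_on_compose[OF open_UNIV open_UNIV G(1) smooth_on_linear[OF open_UNIV bounded_linear_scaleR_left] UNIV_I])
  have supg: "g y = 0" if "\<bar>y - p $ 2\<bar> > r" for y
    unfolding g_def by (rule G(3), rule line) (simp add: e that)
  \<comment> \<open>On the real line every point lies on the one line of direction 1, so the
    invariant remainder \<open>\<Gamma>\<close> is a constant.\<close>
  obtain h \<Gamma> where h: "smooth_on UNIV h" "\<And>y. \<bar>y - p $ 2\<bar> > r \<Longrightarrow> h y = 0"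
    and \<Gamma>: "\<And>x t. \<Gamma> (x + t *\<^sub>R 1) = \<Gamma> x"
    and gh: "\<And>y. g y = frechet_derivative h (at y) 1 + \<Gamma> y * bump r (y - p $ 2)"
    using compact_primitive_along[OF bounded_linear_ident refl r sg supg] by metis
  have \<Gamma>0: "\<Gamma> y = \<Gamma> 0" for y using \<Gamma>[of 0 y] by simp
  \<comment> \<open>The factor \<open>bump\<close> in the first coordinate is constant along the
    second axis; it makes the primitive \<open>h\<close> of \<open>g\<close> compactly supported in
    the plane.\<close>
  define B where "B x = h (x $ 2) * bump r (x $ 1 - p $ 1)" for x :: "real ^ 2"
  have s1: "smooth_on UNIV (\<lambda>x::real ^ 2. bump r (x $ 1 - p $ 1))"
    and s2: "smooth_on UNIV (\<lambda>x::real ^ 2. h (x $ 2))"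
    by (rule smooth_on_compose[OF open_UNIV open_UNIV smooth_on_bump] smooth_on_compose[OF open_UNIV open_UNIV h(1)]
        smooth_on_intros)+
  have sB: "smooth_on UNIV B"
    unfolding B_def by (intro smooth_on_mult s1 s2 open_UNIV)
  have "frechet_derivative B (at x) ?e2 = frechet_derivative h (at (x $ 2)) 1 * bump r (x $ 1 - p $ 1)" for x
  proof -
    have "((\<lambda>t. B (x + t *\<^sub>R ?e2)) has_real_derivative frechet_derivative B (at x) ?e2) (at 0)"
      by (rule has_real_derivative_along_line) (use smooth_on_has_derivative[OF sB, of x] in simp)
    moreover have "((\<lambda>t. h (x $ 2 + t *\<^sub>R 1)) has_real_derivative frechet_derivative h (at (x $ 2)) 1) (at 0)"
      by (rule has_real_derivative_along_line) (use smooth_on_has_derivative[OF h(1), of "x $ 2"] in simp)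
    then have "((\<lambda>t. B (x + t *\<^sub>R ?e2)) has_real_derivative
        frechet_derivative h (at (x $ 2)) 1 * bump r (x $ 1 - p $ 1)) (at 0)"
      by (simp add: B_def e DERIV_cmult_right)
    ultimately show ?thesis by (rule DERIV_unique)
  qed
  then have "k x = frechet_derivative A (at x) ?e1 + frechet_derivative B (at x) ?e2
      + \<Gamma> 0 * (bump r (x $ 1 - p $ 1) * bump r (x $ 2 - p $ 2))" for x
    by (subst kA) (simp add: Gg gh \<Gamma>0[of "x $ 2"] algebra_simps)
  moreover have "A x = 0" "B x = 0" if "\<bar>x $ i - p $ i\<bar> > r" for x i
    using that exhaust_2[of i] A(2,3)[of x] line[of x] h(2)[of "x $ 2"] bump_zero[of r "x $ 1 - p $ 1"] r
    by (auto simp: B_def)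
  ultimately show ?thesis using that A(1) sB by blast
qed

section \<open>Integrals of compactly supported functions\<close>

definition compactly_supported :: "('a::euclidean_space \<Rightarrow> real) \<Rightarrow> bool" where
  "compactly_supported f \<longleftrightarrow> continuous_on UNIV f \<and> (\<exists>K. compact K \<and> (\<forall>x. x \<notin> K \<longrightarrow> f x = 0))"

lemma integral_UNIV_eq:
  fixes f :: "'a::euclidean_space \<Rightarrow> real"
  assumes "\<And>x. x \<notin> S \<Longrightarrow> f x = 0"
  shows "integral UNIV f = integral S f"
proof -
  have "(\<lambda>x. if x \<in> S then f x else 0) = f" using assms by auto
  then show ?thesis using integral_restrict_UNIV[of S f] by simp
qed

lemma compactly_supported_cbox:
  assumes "compactly_supported f"
  obtains a b where "\<And>x. x \<notin> cbox a b \<Longrightarrow> f x = 0"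
proof -
  obtain K where "compact K" "\<And>x. x \<notin> K \<Longrightarrow> f x = 0"
    using assms by (auto simp: compactly_supported_def)
  then show ?thesis
    using bounded_subset_cbox_symmetric[of K] that by (metis compact_imp_bounded subset_iff)
qed

lemma compactly_supported_integrable:
  assumes "compactly_supported f"
  shows "f absolutely_integrable_on UNIV"
proof -
  obtain a b where ab: "\<And>x. x \<notin> cbox a b \<Longrightarrow> f x = 0"
    using compactly_supported_cbox[OF assms] by blast
  have "continuous_on (cbox a b) f"
    using assms by (auto simp: compactly_supported_def intro: continuous_on_subset)
  then have "f absolutely_integrable_on cbox a b" by (rule absolutely_integrable_continuous)
  moreover have "(\<lambda>x. if x \<in> cbox a b then f x else 0) = f" using ab by auto
  ultimately show ?thesis
    using absolutely_integrable_restrict_UNIV[of "cbox a b" f] by simp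
qed

lemma compactly_supported_integrable_on: "compactly_supported f \<Longrightarrow> f integrable_on UNIV"
  using compactly_supported_integrable set_lebesgue_integral_eq_integral(1) by blast

lemma compactly_supported_integral_pos:
  fixes f :: "'a::euclidean_space \<Rightarrow> real"
  assumes f: "compactly_supported f" and nonneg: "\<And>x. f x \<ge> 0" and pos: "f x0 > 0"
  shows "integral UNIV f > 0"
proof (rule ccontr)
  assume "\<not> ?thesis"
  moreover have "integral UNIV f \<ge> 0"
    using nonneg by (intro integral_nonneg compactly_supported_integrable_on[OF f]) auto
  ultimately have zero: "integral UNIV f = 0" by simp
  obtain a b where ab: "\<And>x. x \<notin> cbox a b \<Longrightarrow> f x = 0"
    using compactly_supported_cbox[OF f] by blast
  \<comment> \<open>A box around the support and \<open>x0\<close>; on it a nonnegative continuous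
    function with integral 0 vanishes at every point, in particular at \<open>x0\<close>.\<close>
  obtain c where c: "cbox a b \<union> {x0} \<subseteq> box (- c) c"
    by (rule bounded_subset_box_symmetric[of "cbox a b \<union> {x0}"]) simp_all
  have "f integrable_on cbox (- c) c"
    by (rule integrable_on_subcbox[OF compactly_supported_integrable_on[OF f]]) simp
  moreover have "integral (cbox (- c) c) f = 0"
  proof -
    have "f x = 0" if "x \<notin> cbox (- c) c" for x
      using that c box_subset_cbox[of "- c" c] by (intro ab) blast
    then have "integral UNIV f = integral (cbox (- c) c) f"
      by (rule integral_UNIV_eq)
    then show ?thesis using zero by simp
  qed
  ultimately have "(f has_integral 0) (cbox (- c) c)"
    by (metis integrable_integral)
  moreover have "continuous_on (cbox (- c) c) f"
    using f by (auto simp: compactly_supported_def intro: continuous_on_subset)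
  moreover have "x0 \<in> cbox (- c) c" "box (- c) c \<noteq> {}"
    using c box_subset_cbox[of "- c" c] by auto
  ultimately have "f x0 = 0"
    using has_integral_0_cbox_imp_0[of "- c" c f x0] nonneg by blast
  with pos show False by simp
qed

text \<open>Translating \<open>g\<close> along \<open>e\<close> does not change its integral.\<close>

lemma integral_directional_derivative:
  fixes g :: "'a::euclidean_space \<Rightarrow> real"
  assumes g': "\<And>x. (g has_derivative g' x) (at x)" and cont: "continuous_on UNIV (\<lambda>x. g' x e)"
    and K: "compact K" "\<And>x. x \<notin> K \<Longrightarrow> g x = 0"
  shows "integral UNIV (\<lambda>x. g' x e) = 0"
proof -
  \<comment> \<open>The union of the supports of all translates with |t| <= 1 is compact. One box
    then serves for all of them, and the Leibniz rule applies over a fixed domain.\<close>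
  have "compact ((\<lambda>(x, t). x - t *\<^sub>R e) ` (K \<times> {-1..1::real}))"
    by (intro compact_continuous_image compact_Times K)
      (auto simp: case_prod_unfold intro!: continuous_intros)
  then obtain a where a: "(\<lambda>(x, t). x - t *\<^sub>R e) ` (K \<times> {-1..1::real}) \<subseteq> cbox (- a) a"
    using bounded_subset_cbox_symmetric[OF compact_imp_bounded] by blast
  have out: "g (x + t *\<^sub>R e) = 0" if "x \<notin> cbox (- a) a" "t \<in> {-1..1}" for x t
  proof (rule K(2))
    show "x + t *\<^sub>R e \<notin> K"
    proof
      assume "x + t *\<^sub>R e \<in> K"
      then have "(\<lambda>(x, t). x - t *\<^sub>R e) (x + t *\<^sub>R e, t) \<in> cbox (- a) a"
        using a that(2) by blast
      then show False using that(1) by simp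
    qed
  qed
  have cg: "continuous_on S g" for S
    using g' by (meson continuous_at_imp_continuous_on has_derivative_continuous)
  have shift: "integral (cbox (- a) a) (\<lambda>x. g (x + t *\<^sub>R e)) = integral UNIV g" if "t \<in> {-1..1}" for t
  proof -
    obtain b where b: "K \<subseteq> cbox (- b) b"
      using bounded_subset_cbox_symmetric[OF compact_imp_bounded[OF K(1)]] by blast
    have "integral UNIV g = integral (cbox (- b) b) g"
      using b K(2) by (intro integral_UNIV_eq) blast
    also have "\<dots> = integral (cbox (- b - t *\<^sub>R e) (b - t *\<^sub>R e)) (\<lambda>x. g (x + t *\<^sub>R e))"
      by (rule integral_shift_cbox[symmetric])
    also have "\<dots> = integral UNIV (\<lambda>x. g (x + t *\<^sub>R e))"
    proof (rule integral_UNIV_eq[symmetric])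
      fix x assume "x \<notin> cbox (- b - t *\<^sub>R e) (b - t *\<^sub>R e)"
      then have "x + t *\<^sub>R e \<notin> cbox (- b) b"
        by (auto simp: mem_box inner_simps algebra_simps)
      then show "g (x + t *\<^sub>R e) = 0" using b K(2) by blast
    qed
    also have "\<dots> = integral (cbox (- a) a) (\<lambda>x. g (x + t *\<^sub>R e))"
      using out[OF _ that] by (intro integral_UNIV_eq)
    finally show ?thesis ..
  qed
  have "((\<lambda>t. integral (cbox (- a) a) (\<lambda>x. g (x + t *\<^sub>R e))) has_real_derivative
      integral (cbox (- a) a) (\<lambda>x. g' (x + 0 *\<^sub>R e) e)) (at 0 within {-1<..<1})"
  proof (rule leibniz_rule_field_derivative[where fx = "\<lambda>t x. g' (x + t *\<^sub>R e) e"])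
    show "((\<lambda>t. g (x + t *\<^sub>R e)) has_real_derivative g' (x + t *\<^sub>R e) e) (at t within {-1<..<1})" for x t
      by (rule has_field_derivative_at_within[OF has_real_derivative_along_line[OF g']])
    show "(\<lambda>x. g (x + t *\<^sub>R e)) integrable_on cbox (- a) a" for t
      by (intro integrable_continuous continuous_on_compose2[OF cg[of UNIV]]) (auto intro!: continuous_intros)
    show "continuous_on ({-1<..<1} \<times> cbox (- a) a) (\<lambda>(t, x). g' (x + t *\<^sub>R e) e)"
      unfolding case_prod_unfold
      by (intro continuous_on_compose2[OF cont]) (auto intro!: continuous_intros)
  qed auto
  then have "((\<lambda>t. integral (cbox (- a) a) (\<lambda>x. g (x + t *\<^sub>R e))) has_real_derivative
      integral (cbox (- a) a) (\<lambda>x. g' x e)) (at 0)"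
    by (simp add: at_within_open[of 0 "{-1<..<1}"])
  moreover have "((\<lambda>t. integral (cbox (- a) a) (\<lambda>x. g (x + t *\<^sub>R e))) has_real_derivative 0) (at 0)"
    by (rule has_field_derivative_transform_within_open[OF DERIV_const[of "integral UNIV g"], where S = "{-1<..<1}"])
      (auto simp: shift)
  ultimately have "integral (cbox (- a) a) (\<lambda>x. g' x e) = 0" by (rule DERIV_unique)
  moreover have "g' x e = 0" if "x \<notin> cbox (- a) a" for x
  proof -
    have "x \<notin> K"
    proof
      assume "x \<in> K"
      then have "(\<lambda>(x, t). x - t *\<^sub>R e) (x, 0::real) \<in> cbox (- a) a" using a by fastforce
      then show False using that by simp
    qed
    then have "(g has_derivative (\<lambda>_. 0)) (at x)"
      using K by (intro has_derivative_transform_within_open[OF has_derivative_const[of 0], where s = "- K"])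
        (auto intro: compact_imp_closed)
    then show ?thesis using g'[of x] has_derivative_unique by metis
  qed
  then have "integral UNIV (\<lambda>x. g' x e) = integral (cbox (- a) a) (\<lambda>x. g' x e)"
    by (rule integral_UNIV_eq)
  ultimately show ?thesis by simp
qed

lemma derivative_vanishes_off:
  fixes g :: "'a::real_normed_vector \<Rightarrow> real"
  assumes "compact K" "\<And>x. x \<notin> K \<Longrightarrow> g x = 0" "x \<notin> K"
  shows "frechet_derivative g (at x) e = 0"
proof -
  have "frechet_derivative g (at x) = frechet_derivative (\<lambda>_. 0) (at x)"
    by (rule frechet_derivative_cong_open[of "- K"])
      (use assms in \<open>auto intro: open_Compl compact_imp_closed\<close>)
  then show ?thesis by simp
qed

lemma directional_derivative_integral:
  fixes g :: "'a::euclidean_space \<Rightarrow> real"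
  assumes g: "smooth_on UNIV g" and K: "compact K" "\<And>x. x \<notin> K \<Longrightarrow> g x = 0"
  shows "(\<lambda>x. frechet_derivative g (at x) e) integrable_on UNIV"
    and "integral UNIV (\<lambda>x. frechet_derivative g (at x) e) = 0"
proof -
  have "compactly_supported (\<lambda>x. frechet_derivative g (at x) e)"
    unfolding compactly_supported_def
    using K(1) smooth_on_continuous_on[OF smooth_on_frechet_derivative[OF g]] derivative_vanishes_off[of K g, OF K] by blast
  then show "(\<lambda>x. frechet_derivative g (at x) e) integrable_on UNIV"
    by (rule compactly_supported_integrable_on)
  show "integral UNIV (\<lambda>x. frechet_derivative g (at x) e) = 0"
    by (rule integral_directional_derivative[OF smooth_on_has_derivative[OF g UNIV_I]
          smooth_on_continuous_on[OF smooth_on_frechet_derivative[OF g]] K])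
qed

section \<open>Functions and forms on a manifold\<close>

text \<open>\<open>O'\<close> and the complement of \<open>K\<close> are open and cover the space;
  on the second set the extended function is constantly 0.\<close>

lemma smooth_on_extend_zero:
  fixes f :: "'a::real_normed_vector \<Rightarrow> 'b::real_normed_vector"
  assumes O: "open O'" "smooth_on O' f" and K: "closed K" "K \<subseteq> O'" "\<And>x. x \<in> O' - K \<Longrightarrow> f x = 0"
  shows "smooth_on UNIV (\<lambda>x. if x \<in> O' then f x else 0)"
proof (rule smooth_on_local)
  fix x :: 'a
  show "\<exists>V. open V \<and> x \<in> V \<and> smooth_on V (\<lambda>x. if x \<in> O' then f x else 0)"
  proof (cases "x \<in> O'")
    case True
    have "smooth_on O' (\<lambda>x. if x \<in> O' then f x else 0)"
      by (rule smooth_on_cong[OF O(1) _ O(2)]) simp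
    with True O(1) show ?thesis by blast
  next
    case False
    have "smooth_on (- K) (\<lambda>x. if x \<in> O' then f x else 0)"
      by (rule smooth_on_cong[OF _ _ smooth_on_const[of _ 0]]) (use K in auto)
    with False K show ?thesis by (intro exI[of _ "- K"]) auto
  qed
qed

locale atlas_mfd =
  fixes M :: "'a topology" and A :: "('a, 'n::finite) chart set"
  assumes atlas: "smooth_atlas M A" and hausdorff: "Hausdorff_space M"
begin

lemma chart:
  assumes "c \<in> A"
  shows "openin M (fst c)" "open (chart_image c)" "fst c \<subseteq> topspace M"
    and chart_homeo: "homeomorphic_map (subtopology M (fst c)) (top_of_set (chart_image c)) (snd c)"
  using assms atlas by (auto simp: smooth_atlas_def chart_on_def openin_subset)

lemma chart_inj: "c \<in> A \<Longrightarrow> inj_on (snd c) (fst c)"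
  using homeomorphic_imp_injective_map[OF chart_homeo[of c]] chart(3)[of c] by (simp add: Int_absorb1)

lemma chart_inv_left [simp]: "c \<in> A \<Longrightarrow> q \<in> fst c \<Longrightarrow> chart_inv c (snd c q) = q"
  by (simp add: chart_inv_def chart_inj inv_into_f_f)

lemma chart_inv_right [simp]: "x \<in> chart_image c \<Longrightarrow> snd c (chart_inv c x) = x"
  by (simp add: chart_inv_def chart_image_def f_inv_into_f)

lemma chart_inv_mem: "x \<in> chart_image c \<Longrightarrow> chart_inv c x \<in> fst c"
  by (simp add: chart_inv_def chart_image_def inv_into_into)

lemma chart_mem: "q \<in> fst c \<Longrightarrow> snd c q \<in> chart_image c"
  by (simp add: chart_image_def)

lemma chart_inv_topspace: "c \<in> A \<Longrightarrow> x \<in> chart_image c \<Longrightarrow> chart_inv c x \<in> topspace M"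
  using chart(3) chart_inv_mem by blast

lemma chart_cover: "q \<in> topspace M \<Longrightarrow> \<exists>c\<in>A. q \<in> fst c"
  using atlas by (auto simp: smooth_atlas_def)

lemma mem_chart_inv_image:
  assumes "c \<in> A" "V \<subseteq> chart_image c"
  shows "q \<in> chart_inv c ` V \<longleftrightarrow> q \<in> fst c \<and> snd c q \<in> V"
  using assms chart_inv_mem[of _ c] by (auto intro!: image_eqI[of q _ "snd c q"])

lemma open_chart_image_Int:
  assumes "c \<in> A" "openin M W"
  shows "open (snd c ` (fst c \<inter> W))"
proof -
  have "openin (subtopology M (fst c)) (fst c \<inter> W)"
    using assms(2) by (auto simp: openin_subtopology)
  then have "openin (top_of_set (chart_image c)) (snd c ` (fst c \<inter> W))"
    using homeomorphic_imp_open_map[OF chart_homeo[OF assms(1)]] by (simp add: open_map_def)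
  then show ?thesis
    using chart(2)[OF assms(1)] openin_open_trans by blast
qed

lemma openin_chart_inv_image:
  assumes "c \<in> A" "open V" "V \<subseteq> chart_image c"
  shows "openin M (chart_inv c ` V)"
proof -
  have "continuous_map (subtopology M (fst c)) (top_of_set (chart_image c)) (snd c)"
    by (rule homeomorphic_imp_continuous_map[OF chart_homeo[OF assms(1)]])
  moreover have "openin (top_of_set (chart_image c)) V"
    using assms by (auto simp: openin_open)
  ultimately have "openin (subtopology M (fst c)) {q \<in> topspace (subtopology M (fst c)). snd c q \<in> V}"
    by (rule openin_continuous_map_preimage)
  moreover have "{q \<in> topspace (subtopology M (fst c)). snd c q \<in> V} = chart_inv c ` V"
    using chart(3)[OF assms(1)] mem_chart_inv_image[OF assms(1,3)] by auto
  ultimately show ?thesis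
    using openin_trans_full chart(1)[OF assms(1)] by fastforce
qed

text \<open>Here the Hausdorff property enters: a compact set in a chart is closed in the whole
  manifold. It is what makes extension by zero smooth.\<close>

lemma closedin_chart_inv_image:
  assumes "c \<in> A" "compact K" "K \<subseteq> chart_image c"
  shows "closedin M (chart_inv c ` K)"
proof -
  have sub: "chart_inv c ` K \<subseteq> fst c"
    using assms(3) chart_inv_mem by blast
  then have "chart_inv c ` K \<subseteq> topspace (subtopology M (fst c))"
    using chart(3)[OF assms(1)] by auto
  moreover have "snd c ` chart_inv c ` K = K"
    using assms(3) by (force simp: image_image)
  then have "compactin (top_of_set (chart_image c)) (snd c ` chart_inv c ` K)"
    using assms by (simp add: compactin_subtopology)
  ultimately have "compactin (subtopology M (fst c)) (chart_inv c ` K)"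
    using homeomorphic_map_compactness[OF chart_homeo[OF assms(1)]] by blast
  then show ?thesis
    using compactin_imp_closedin[OF hausdorff] by (simp add: compactin_subtopology)
qed

lemma mem_overlap: "c \<in> A \<Longrightarrow> x \<in> overlap c d \<longleftrightarrow> x \<in> chart_image c \<and> chart_inv c x \<in> fst d"
  using chart_inv_mem[of x c] by (auto simp: overlap_def chart_image_def intro!: image_eqI[of x _ "chart_inv c x"])

lemma open_overlap: "c \<in> A \<Longrightarrow> d \<in> A \<Longrightarrow> open (overlap c d)"
  unfolding overlap_def using open_chart_image_Int chart(1) by blast

lemma transition:
  assumes "c \<in> A" "d \<in> A" "x \<in> overlap c d"
  shows "transition c d x \<in> overlap d c" "transition c d x \<in> chart_image d"
    "chart_inv d (transition c d x) = chart_inv c x" "transition d c (transition c d x) = x"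
  using assms chart_inv_mem[of x c] by (auto simp: mem_overlap transition_def chart_mem)

lemma smooth_transition: "c \<in> A \<Longrightarrow> d \<in> A \<Longrightarrow> smooth_on (overlap c d) (transition c d)"
  using atlas by (auto simp: smooth_atlas_def)

lemma transition_has_derivative:
  "c \<in> A \<Longrightarrow> d \<in> A \<Longrightarrow> x \<in> overlap c d \<Longrightarrow>
    (transition c d has_derivative frechet_derivative (transition c d) (at x)) (at x)"
  by (rule smooth_on_has_derivative[OF smooth_transition])

lemma smooth_function_rep: "smooth_function A f \<Longrightarrow> c \<in> A \<Longrightarrow> smooth_on (chart_image c) (\<lambda>x. f (chart_inv c x))"
  by (auto simp: smooth_function_def comp_def)

lemma d0_has_derivative:
  "smooth_function A f \<Longrightarrow> c \<in> A \<Longrightarrow> x \<in> chart_image c \<Longrightarrow> ((\<lambda>x. f (chart_inv c x)) has_derivative d0 f c x) (at x)"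
  unfolding d0_def comp_def by (simp add: smooth_on_has_derivative[OF smooth_function_rep])

lemma d0_eqI: "((\<lambda>x. f (chart_inv c x)) has_derivative D) (at x) \<Longrightarrow> d0 f c x = D"
  unfolding d0_def comp_def by (metis frechet_derivative_at)

lemma d0_transition:
  assumes f: "smooth_function A f" and c: "c \<in> A" "d \<in> A" "x \<in> overlap c d"
  shows "d0 f c x u = d0 f d (transition c d x) (frechet_derivative (transition c d) (at x) u)"
proof -
  have "((\<lambda>x. f (chart_inv d (transition c d x))) has_derivative
      (\<lambda>u. d0 f d (transition c d x) (frechet_derivative (transition c d) (at x) u))) (at x)"
    by (rule has_derivative_compose[OF transition_has_derivative[OF c] d0_has_derivative[OF f c(2) transition(2)[OF c]]])
  then have "((\<lambda>x. f (chart_inv c x)) has_derivative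
      (\<lambda>u. d0 f d (transition c d x) (frechet_derivative (transition c d) (at x) u))) (at x)"
    by (rule has_derivative_transform_within_open[OF _ open_overlap[OF c(1,2)] c(3)])
      (simp add: transition[OF c(1,2)])
  from d0_eqI[OF this] show ?thesis by simp
qed

lemma smooth_d0: "smooth_function A f \<Longrightarrow> c \<in> A \<Longrightarrow> smooth_on (chart_image c) (\<lambda>x. d0 f c x u)"
  unfolding d0_def by (simp add: smooth_function_def smooth_on_frechet_derivative)

lemma d0_linear: "smooth_function A f \<Longrightarrow> c \<in> A \<Longrightarrow> x \<in> chart_image c \<Longrightarrow> linear (d0 f c x)"
  using has_derivative_linear[OF d0_has_derivative] .

lemma smooth_function_const: "smooth_function A (\<lambda>q. k)"
  by (simp add: smooth_function_def comp_def smooth_on_const)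

lemma smooth_function_diff: "smooth_function A f \<Longrightarrow> smooth_function A g \<Longrightarrow> smooth_function A (\<lambda>q. f q - g q)"
  by (auto simp: smooth_function_def comp_def smooth_on_diff chart(2))

lemma smooth_function_mult: "smooth_function A f \<Longrightarrow> smooth_function A g \<Longrightarrow> smooth_function A (\<lambda>q. f q * g q)"
  by (auto simp: smooth_function_def comp_def smooth_on_mult chart(2))

lemma smooth_function_sum: "(\<And>i. i \<in> I \<Longrightarrow> smooth_function A (f i)) \<Longrightarrow> smooth_function A (\<lambda>q. \<Sum>i\<in>I. f i q)"
  by (auto simp: smooth_function_def comp_def intro!: smooth_on_sum chart(2))

lemma smooth_function_divide:
  assumes "smooth_function A f" "smooth_function A g" "\<And>q. q \<in> topspace M \<Longrightarrow> g q \<noteq> 0"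
  shows "smooth_function A (\<lambda>q. f q / g q)"
  using assms chart_inv_topspace
  by (auto simp: smooth_function_def comp_def divide_inverse intro!: smooth_on_mult smooth_on_inverse chart(2))

lemma d0_sum: "finite I \<Longrightarrow> (\<And>i. i \<in> I \<Longrightarrow> smooth_function A (f i)) \<Longrightarrow> c \<in> A \<Longrightarrow> x \<in> chart_image c \<Longrightarrow>
    d0 (\<lambda>q. \<Sum>i\<in>I. f i q) c x u = (\<Sum>i\<in>I. d0 (f i) c x u)"
  by (rule fun_cong[OF d0_eqI]) (auto intro!: derivative_eq_intros d0_has_derivative)

lemma d0_cong_open:
  assumes "openin M W" "\<And>q. q \<in> W \<Longrightarrow> f q = g q" "c \<in> A" "x \<in> chart_image c" "chart_inv c x \<in> W"
  shows "d0 f c x = d0 g c x"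
  unfolding d0_def
proof (rule frechet_derivative_cong_open[OF open_chart_image_Int[OF assms(3,1)]])
  show "x \<in> snd c ` (fst c \<inter> W)"
    using assms(3-5) by (auto intro!: image_eqI[of x _ "chart_inv c x"] chart_inv_mem)
qed (use assms in auto)

lemma d0_const: "d0 (\<lambda>q. k) c x u = 0"
  by (simp add: d0_def comp_def)

definition extend :: "('a, 'n) chart \<Rightarrow> (real ^ 'n \<Rightarrow> real) \<Rightarrow> 'a \<Rightarrow> real" where
  "extend c \<phi> q = (if q \<in> fst c then \<phi> (snd c q) else 0)"

lemma extend_chart_inv [simp]: "x \<in> chart_image c \<Longrightarrow> extend c \<phi> (chart_inv c x) = \<phi> x"
  by (simp add: extend_def chart_inv_mem)

lemma smooth_function_extend:
  assumes c: "c \<in> A" and \<phi>: "smooth_on (chart_image c) \<phi>"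
    and K: "compact K" "K \<subseteq> chart_image c" "\<And>x. x \<in> chart_image c \<Longrightarrow> x \<notin> K \<Longrightarrow> \<phi> x = 0"
  shows "smooth_function A (extend c \<phi>)"
  unfolding smooth_function_def comp_def
proof (intro ballI smooth_on_local)
  fix d x assume d: "d \<in> A" and x: "x \<in> chart_image d"
  show "\<exists>V. open V \<and> x \<in> V \<and> smooth_on V (\<lambda>x. extend c \<phi> (chart_inv d x))"
  proof (cases "chart_inv d x \<in> fst c")
    case True
    have "smooth_on (overlap d c) (\<lambda>x. \<phi> (transition d c x))"
      by (rule smooth_on_compose[OF open_overlap[OF d c] chart(2)[OF c] \<phi> smooth_transition[OF d c] transition(2)[OF d c]])
    then have "smooth_on (overlap d c) (\<lambda>x. extend c \<phi> (chart_inv d x))"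
      by (rule smooth_on_cong[OF open_overlap[OF d c], rotated])
        (auto simp: extend_def mem_overlap[OF d] transition_def)
    then show ?thesis
      using open_overlap[OF d c] True x by (auto simp: mem_overlap[OF d])
  next
    case False
    \<comment> \<open>Outside the domain of \<open>c\<close> one is in the complement of the closed
      image of \<open>K\<close>, an open set on which the extension is 0.\<close>
    let ?W = "topspace M - chart_inv c ` K"
    have W: "openin M ?W"
      using closedin_chart_inv_image[OF c K(1,2)] by (simp add: closedin_def)
    let ?V = "snd d ` (fst d \<inter> ?W)"
    have "extend c \<phi> q = 0" if "q \<in> ?W" for q
      using that mem_chart_inv_image[OF c K(2), of q] K(3)[of "snd c q"] by (auto simp: extend_def chart_mem)
    then have "extend c \<phi> (chart_inv d y) = 0" if "y \<in> ?V" for y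
      using that d by auto
    then have "smooth_on ?V (\<lambda>x. extend c \<phi> (chart_inv d x))"
      by (intro smooth_on_cong[OF open_chart_image_Int[OF d W] _ smooth_on_const[of _ 0]]) simp
    moreover have "x \<in> ?V"
      using x d False mem_chart_inv_image[OF c K(2)] chart_inv_topspace[OF d x] chart_inv_mem[OF x]
      by (auto intro!: image_eqI[of x _ "chart_inv d x"])
    ultimately show ?thesis using open_chart_image_Int[OF d W] by blast
  qed
qed

subsection \<open>Products of functions and differentials\<close>

text \<open>The 1-form f dg. Global forms are built from such products, as their transformation law
  follows from that of functions and differentials.\<close>

definition fdg :: "('a \<Rightarrow> real) \<Rightarrow> ('a \<Rightarrow> real) \<Rightarrow> ('a, 'n) form1" where
  "fdg f g c x u = f (chart_inv c x) * d0 g c x u"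

lemma smooth_form1_fdg:
  assumes "smooth_function A f" "smooth_function A g"
  shows "smooth_form1 A (fdg f g)"
  unfolding smooth_form1_def fdg_def
proof (intro conjI ballI allI)
  show "linear (\<lambda>u. f (chart_inv c x) * d0 g c x u)" if "c \<in> A" "x \<in> chart_image c" for c x
    using linear_compose_scale_right[OF d0_linear[OF assms(2) that]] by simp
  show "smooth_on (chart_image c) (\<lambda>x. f (chart_inv c x) * d0 g c x u)" if "c \<in> A" for c u
    by (intro smooth_on_mult chart smooth_function_rep smooth_d0 assms that)
  show "f (chart_inv c x) * d0 g c x u = f (chart_inv d (transition c d x)) *
      d0 g d (transition c d x) (frechet_derivative (transition c d) (at x) u)"
    if "c \<in> A" "d \<in> A" "x \<in> overlap c d" for c d x u
    by (simp add: d0_transition[OF assms(2) that, of u] transition[OF that])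
qed

text \<open>The product rule yields the wedge product of df and dg plus second derivatives of
  \<open>g\<close>, which cancel by symmetry.\<close>

lemma d1_fdg:
  assumes f: "smooth_function A f" and g: "smooth_function A g" and c: "c \<in> A" "x \<in> chart_image c"
  shows "d1 (fdg f g) c x u v = d0 f c x u * d0 g c x v - d0 f c x v * d0 g c x u"
proof -
  let ?D = "\<lambda>u v. frechet_derivative (\<lambda>y. d0 g c y v) (at x) u"
  have "frechet_derivative (\<lambda>y. fdg f g c y v) (at x) u = f (chart_inv c x) * ?D u v + d0 f c x u * d0 g c x v" for u v
  proof -
    have "((\<lambda>y. fdg f g c y v) has_derivative
        (\<lambda>u. f (chart_inv c x) * ?D u v + d0 f c x u * d0 g c x v)) (at x)"
      unfolding fdg_def
      by (intro has_derivative_mult d0_has_derivative f c smooth_on_has_derivative[OF smooth_d0[OF g]])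
    from frechet_derivative_at[OF this] show ?thesis by metis
  qed
  moreover have "?D u v = ?D v u"
    unfolding d0_def comp_def
    by (rule second_derivative_symmetric[OF chart(2)[OF c(1)] c(2) smooth_function_rep[OF g c(1)]])
  ultimately show ?thesis by (simp add: d1_def)
qed

lemma d1_add:
  assumes "smooth_form1 A \<alpha>" "smooth_form1 A \<beta>" "c \<in> A" "x \<in> chart_image c"
  shows "d1 (form1_add \<alpha> (form1_scale k \<beta>)) c x u v = d1 \<alpha> c x u v + k * d1 \<beta> c x u v"
proof -
  have D: "((\<lambda>y. \<gamma> c y w) has_derivative frechet_derivative (\<lambda>y. \<gamma> c y w) (at x)) (at x)"
    if "smooth_form1 A \<gamma>" for \<gamma> w
    using smooth_on_has_derivative[OF smooth_form1D(2)[OF that assms(3)] assms(4)] .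
  have "frechet_derivative (\<lambda>y. form1_add \<alpha> (form1_scale k \<beta>) c y w) (at x) z =
      frechet_derivative (\<lambda>y. \<alpha> c y w) (at x) z + k * frechet_derivative (\<lambda>y. \<beta> c y w) (at x) z" for w z
    unfolding form1_add_def form1_scale_def
    using frechet_derivative_at[OF has_derivative_add[OF D[OF assms(1)] has_derivative_mult_right[OF D[OF assms(2)], of k]]]
    by (metis (no_types))
  then show ?thesis by (simp add: d1_def algebra_simps)
qed

lemma d1_transition_fdg:
  assumes f: "smooth_function A f" and g: "smooth_function A g" and c: "c \<in> A" "d \<in> A" "x \<in> overlap c d"
  shows "d1 (fdg f g) c x u v = d1 (fdg f g) d (transition c d x)
    (frechet_derivative (transition c d) (at x) u) (frechet_derivative (transition c d) (at x) v)"
proof -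
  have "x \<in> chart_image c" using c by (simp add: mem_overlap)
  then show ?thesis
    by (simp add: d1_fdg[OF f g] c transition[OF c] d0_transition[OF f c] d0_transition[OF g c])
qed

subsection \<open>Contraction with a vector field\<close>

text \<open>The function \<eta>(X) on the manifold itself. The chart is an arbitrary choice; the
  transformation laws of \<eta> and X cancel, so any chart around the point gives the same
  value.\<close>

definition contract :: "('a, 'n) form1 \<Rightarrow> ('a, 'n) vfield \<Rightarrow> 'a \<Rightarrow> real" where
  "contract \<eta> X q = (let c = SOME c. c \<in> A \<and> q \<in> fst c in \<eta> c (snd c q) (X c (snd c q)))"

lemma contract_eq:
  assumes \<eta>: "smooth_form1 A \<eta>" and X: "smooth_vector_field A X" and c: "c \<in> A" "x \<in> chart_image c"
  shows "contract \<eta> X (chart_inv c x) = \<eta> c x (X c x)"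
proof -
  define q where "q = chart_inv c x"
  define d where "d = (SOME d. d \<in> A \<and> q \<in> fst d)"
  have q: "q \<in> fst c" "snd c q = x" using c by (simp_all add: q_def chart_inv_mem)
  then have d: "d \<in> A" "q \<in> fst d"
    using someI[of "\<lambda>d. d \<in> A \<and> q \<in> fst d" c] c(1) by (auto simp: d_def)
  then have ov: "x \<in> overlap c d" "transition c d x = snd d q"
    using c q by (simp_all add: mem_overlap transition_def q_def)
  moreover have "contract \<eta> X q = \<eta> d (snd d q) (X d (snd d q))"
    by (simp add: contract_def d_def[symmetric] Let_def)
  moreover have "X d (transition c d x) = frechet_derivative (transition c d) (at x) (X c x)"
    using X c(1) d(1) ov(1) unfolding smooth_vector_field_def by blast
  ultimately show ?thesis
    using smooth_form1D(3)[OF \<eta> c(1) d(1)] by (simp add: q_def[symmetric])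
qed

lemma smooth_function_contract:
  assumes \<eta>: "smooth_form1 A \<eta>" and X: "smooth_vector_field A X"
  shows "smooth_function A (contract \<eta> X)"
  unfolding smooth_function_def comp_def
proof
  fix c assume c: "c \<in> A"
  have "smooth_on (chart_image c) (\<lambda>x. \<Sum>e\<in>Basis. (X c x \<bullet> e) * \<eta> c x e)"
    using X c smooth_form1D(2)[OF \<eta> c]
    by (intro smooth_on_sum smooth_on_mult chart smooth_on_linear_comp[OF _ bounded_linear_inner_left])
      (auto simp: smooth_vector_field_def)
  then show "smooth_on (chart_image c) (\<lambda>x. contract \<eta> X (chart_inv c x))"
  proof (rule smooth_on_cong[OF chart(2)[OF c], rotated])
    fix x assume x: "x \<in> chart_image c"
    have lin: "linear (\<eta> c x)" by (rule smooth_form1D(1)[OF \<eta> c x])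
    show "(\<Sum>e\<in>Basis. (X c x \<bullet> e) * \<eta> c x e) = contract \<eta> X (chart_inv c x)"
      unfolding contract_eq[OF \<eta> X c x]
      using linear_sum[OF lin, of "\<lambda>e. (X c x \<bullet> e) *\<^sub>R e" Basis]
      by (simp only: euclidean_representation linear_scale[OF lin] real_scaleR_def)
  qed
qed

lemma smooth_form1_d0:
  assumes "smooth_function A f"
  shows "smooth_form1 A (d0 f)"
proof -
  have "fdg (\<lambda>_. 1) f = d0 f" by (simp add: fdg_def fun_eq_iff)
  with smooth_form1_fdg[OF smooth_function_const[of 1] assms] show ?thesis by simp
qed

end

section \<open>Integration over a surface with an area form\<close>

text \<open>A continuous function without zeros has locally constant sign, so its absolute value is
  locally a constant multiple of it.\<close>

lemma smooth_on_abs: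
  fixes f :: "'a::real_normed_vector \<Rightarrow> real"
  assumes U: "open U" and f: "smooth_on U f" and nz: "\<And>x. x \<in> U \<Longrightarrow> f x \<noteq> 0"
  shows "smooth_on U (\<lambda>x. \<bar>f x\<bar>)"
    and has_derivative_abs_smooth: "x \<in> U \<Longrightarrow>
      ((\<lambda>x. \<bar>f x\<bar>) has_derivative (\<lambda>v. sgn (f x) * frechet_derivative f (at x) v)) (at x)"
proof -
  let ?V = "\<lambda>x. U \<inter> f -` {y. sgn y = sgn (f x)}"
  have op: "open {y::real. sgn y = sgn k}" if "k \<noteq> 0" for k
  proof -
    have "{y. sgn y = sgn k} = (if k > 0 then {0<..} else {..<0})"
      using that by (auto simp: sgn_if split: if_splits)
    then show ?thesis by simp
  qed
  have V: "open (?V x)" if "x \<in> U" for x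
    by (rule continuous_open_preimage[OF smooth_on_continuous_on[OF f] U op[OF nz[OF that]]])
  have eq: "sgn (f x) * f y = \<bar>f y\<bar>" if "y \<in> ?V x" for x y
    using that by (auto simp: abs_sgn mult.commute)
  show "smooth_on U (\<lambda>x. \<bar>f x\<bar>)"
  proof (rule smooth_on_local)
    fix x assume x: "x \<in> U"
    have "smooth_on (?V x) (\<lambda>y. sgn (f x) * f y)"
      by (intro smooth_on_mult smooth_on_const V[OF x] smooth_on_subset[OF f]) blast
    then have "smooth_on (?V x) (\<lambda>y. \<bar>f y\<bar>)"
      by (rule smooth_on_cong[OF V[OF x], rotated]) (rule eq)
    then show "\<exists>V. open V \<and> x \<in> V \<and> smooth_on V (\<lambda>x. \<bar>f x\<bar>)"
      using V[OF x] x by blast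
  qed
  assume x: "x \<in> U"
  have "((\<lambda>y. sgn (f x) * f y) has_derivative (\<lambda>v. sgn (f x) * frechet_derivative f (at x) v)) (at x)"
    by (rule has_derivative_mult_right[OF smooth_on_has_derivative[OF f x]])
  then show "((\<lambda>x. \<bar>f x\<bar>) has_derivative (\<lambda>v. sgn (f x) * frechet_derivative f (at x) v)) (at x)"
    by (rule has_derivative_transform_within_open[OF _ V[OF x]]) (use x in simp, rule eq)
qed

section \<open>Coordinate cubes with product bumps and cut-offs\<close>

definition cube :: "real ^ 'n \<Rightarrow> real \<Rightarrow> (real ^ 'n::finite) set" where
  "cube p r = {x. \<forall>i. \<bar>x $ i - p $ i\<bar> \<le> r}"

definition open_cube :: "real ^ 'n \<Rightarrow> real \<Rightarrow> (real ^ 'n::finite) set" where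
  "open_cube p r = {x. \<forall>i. \<bar>x $ i - p $ i\<bar> < r}"

lemma cube_cbox: "cube p r = cbox (\<chi> i. p $ i - r) (\<chi> i. p $ i + r)"
  and open_cube_box: "open_cube p r = box (\<chi> i. p $ i - r) (\<chi> i. p $ i + r)"
  by (auto simp: cube_def open_cube_def mem_box_cart abs_le_iff abs_less_iff algebra_simps)

lemma compact_cube: "compact (cube p r)" and convex_cube: "convex (cube p r)"
  by (simp_all add: cube_cbox convex_box)

lemma open_open_cube: "open (open_cube p r)" and convex_open_cube: "convex (open_cube p r)"
  by (simp_all add: open_cube_box convex_box open_box)

lemma open_cube_subset: "open_cube p r \<subseteq> cube p r"
  by (auto simp: cube_def open_cube_def less_imp_le)

lemma cube_mono: "r \<le> R \<Longrightarrow> cube p r \<subseteq> cube p R"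
  and open_cube_mono: "r \<le> R \<Longrightarrow> open_cube p r \<subseteq> open_cube p R"
  by (auto simp: cube_def open_cube_def intro: order_trans less_le_trans)

lemma cube_subset_open_cube: "r < R \<Longrightarrow> cube p r \<subseteq> open_cube p R"
  by (auto simp: cube_def open_cube_def intro: le_less_trans)

lemma centre_open_cube: "r > 0 \<Longrightarrow> p \<in> open_cube p r"
  by (simp add: open_cube_def)

lemma open_contains_cube:
  assumes "open U" "p \<in> U"
  obtains r where "r > 0" "cube p r \<subseteq> (U :: (real ^ 'n::finite) set)"
proof -
  obtain e where e: "e > 0" "ball p e \<subseteq> U"
    using assms open_contains_ball by blast
  \<comment> \<open>In a cube of this radius the sum of the coordinate differences is at most e/2,
    and it bounds the Euclidean norm.\<close>
  define r where "r = e / (2 * real CARD('n))"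
  have "x \<in> ball p e" if "x \<in> cube p r" for x
  proof -
    have "norm (x - p) \<le> (\<Sum>i\<in>UNIV. \<bar>(x - p) $ i\<bar>)" by (rule norm_le_l1_cart)
    also have "\<dots> \<le> (\<Sum>i\<in>(UNIV::'n set). r)"
      using that by (intro sum_mono) (simp add: cube_def)
    also have "\<dots> < e" using e(1) by (simp add: r_def)
    finally show ?thesis by (simp add: dist_norm norm_minus_commute)
  qed
  moreover have "r > 0" using e(1) by (simp add: r_def)
  ultimately show ?thesis using e(2) that[of r] by blast
qed

definition cube_bump :: "real ^ 2 \<Rightarrow> real \<Rightarrow> real ^ 2 \<Rightarrow> real" where
  "cube_bump p r x = bump r (x $ 1 - p $ 1) * bump r (x $ 2 - p $ 2)"

lemma smooth_cube_bump: "smooth_on UNIV (cube_bump p r)"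
  unfolding cube_bump_def
  by (rule smooth_on_compose[OF open_UNIV open_UNIV smooth_on_bump] smooth_on_intros)+

lemma cube_bump_nonneg: "cube_bump p r x \<ge> 0"
  and cube_bump_pos: "x \<in> open_cube p r \<Longrightarrow> cube_bump p r x > 0"
  and cube_bump_zero: "r \<ge> 0 \<Longrightarrow> x \<notin> cube p r \<Longrightarrow> cube_bump p r x = 0"
  by (auto simp: cube_bump_def bump_nonneg bump_pos bump_zero open_cube_def cube_def forall_2 not_le)

definition cube_plateau :: "real ^ 2 \<Rightarrow> real \<Rightarrow> real \<Rightarrow> real ^ 2 \<Rightarrow> real" where
  "cube_plateau p r R x = plateau r R (x $ 1 - p $ 1) * plateau r R (x $ 2 - p $ 2)"

lemma smooth_cube_plateau: "0 \<le> r \<Longrightarrow> r < R \<Longrightarrow> smooth_on UNIV (cube_plateau p r R)"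
  unfolding cube_plateau_def
  by (rule smooth_on_compose[OF open_UNIV open_UNIV smooth_on_plateau] smooth_on_intros | assumption)+

lemma cube_plateau_one: "r < R \<Longrightarrow> x \<in> cube p r \<Longrightarrow> cube_plateau p r R x = 1"
  and cube_plateau_zero: "R \<ge> 0 \<Longrightarrow> x \<notin> cube p R \<Longrightarrow> cube_plateau p r R x = 0"
  by (auto simp: cube_plateau_def cube_def forall_2 not_le plateau_one plateau_zero)

locale area_surface = atlas_mfd M A for M :: "'a topology" and A :: "('a, 2) chart set" +
  fixes \<omega> :: "('a, 2) form2"
  assumes compact: "compact_space M" and symplectic: "symplectic_form A \<omega>"
begin

text \<open>The coefficient of \<omega> against the standard area form of the chart; in dimension
  two it determines \<omega>.\<close>

definition density :: "('a, 2) chart \<Rightarrow> real ^ 2 \<Rightarrow> real" where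
  "density c x = \<omega> c x (axis 1 1) (axis 2 1)"

lemma axis_simps: "axis (1::2) (1::real) $ 1 = 1" "axis (1::2) (1::real) $ 2 = 0"
  "axis (2::2) (1::real) $ 1 = 0" "axis (2::2) (1::real) $ 2 = 1"
  by (simp_all add: axis_def)

lemma plane_repr: "u = (u $ 1) *\<^sub>R axis 1 1 + (u $ 2) *\<^sub>R axis 2 1" for u :: "real ^ 2"
  by (simp add: vec_eq_iff forall_2 axis_simps)

lemma linear_plane: "linear L \<Longrightarrow> L u = (u $ 1) *\<^sub>R L (axis 1 1) + (u $ 2) *\<^sub>R L (axis 2 1)" for u :: "real ^ 2"
  by (subst plane_repr[of u]) (simp add: linear_add linear_scale)

lemma omega_eq:
  assumes "c \<in> A" "x \<in> chart_image c"
  shows "\<omega> c x u v = density c x * (u $ 1 * v $ 2 - u $ 2 * v $ 1)"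
proof -
  have bil: "bilinear (\<omega> c x)" and alt: "\<And>u. \<omega> c x u u = 0"
    using symplectic assms by (auto simp: symplectic_form_def smooth_form2_def)
  have lin: "linear (\<omega> c x u)" "linear (\<lambda>u. \<omega> c x u v)" for u v
    using bil by (auto simp: bilinear_def)
  have eq: "\<omega> c x u v = u $ 1 * (v $ 1 * \<omega> c x (axis 1 1) (axis 1 1) + v $ 2 * \<omega> c x (axis 1 1) (axis 2 1))
    + u $ 2 * (v $ 1 * \<omega> c x (axis 2 1) (axis 1 1) + v $ 2 * \<omega> c x (axis 2 1) (axis 2 1))" for u v
    using linear_plane[OF lin(2)[of v], of u] linear_plane[OF lin(1)[of "axis 1 1"], of v]
      linear_plane[OF lin(1)[of "axis 2 1"], of v] by simp
  \<comment> \<open>Antisymmetry by polarization: \<omega> vanishes on the pair (e1 + e2, e1 +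
    e2).\<close>
  have "\<omega> c x (axis 2 1) (axis 1 1) = - \<omega> c x (axis 1 1) (axis 2 1)"
    using eq[of "axis 1 1 + axis 2 1" "axis 1 1 + axis 2 1"] by (simp add: alt axis_simps)
  then show ?thesis
    by (subst eq) (simp add: alt density_def algebra_simps)
qed

lemma density_nonzero: "c \<in> A \<Longrightarrow> x \<in> chart_image c \<Longrightarrow> density c x \<noteq> 0"
proof
  assume c: "c \<in> A" "x \<in> chart_image c" and "density c x = 0"
  then have "\<forall>v. \<omega> c x (axis 1 1) v = 0" by (simp add: omega_eq)
  then have "axis 1 1 = (0 :: real ^ 2)"
    using symplectic c unfolding symplectic_form_def by blast
  then show False by simp
qed

lemma smooth_density: "c \<in> A \<Longrightarrow> smooth_on (chart_image c) (density c)"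
  using symplectic by (auto simp: symplectic_form_def smooth_form2_def density_def[abs_def])

lemma smooth_abs_density: "c \<in> A \<Longrightarrow> smooth_on (chart_image c) (\<lambda>x. \<bar>density c x\<bar>)"
  by (rule smooth_on_abs[OF chart(2) smooth_density density_nonzero])

lemma density_transition:
  assumes "c \<in> A" "d \<in> A" "x \<in> overlap c d"
  shows "density c x = density d (transition c d x) * det (matrix (frechet_derivative (transition c d) (at x)))"
proof -
  have "density c x = \<omega> d (transition c d x) (frechet_derivative (transition c d) (at x) (axis 1 1))
      (frechet_derivative (transition c d) (at x) (axis 2 1))"
    using symplectic assms unfolding symplectic_form_def smooth_form2_def density_def by blast
  then show ?thesis
    by (simp add: omega_eq assms transition[OF assms] det_2 matrix_def mult.commute)
qed

text \<open>The absolute value of the density matches |det| in the change of variables, so charts of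
  either orientation give equal integrals.\<close>

definition integrand :: "('a, 2) chart \<Rightarrow> ('a \<Rightarrow> real) \<Rightarrow> real ^ 2 \<Rightarrow> real" where
  "integrand c h x = (if x \<in> chart_image c then h (chart_inv c x) * \<bar>density c x\<bar> else 0)"

definition chart_integral :: "('a, 2) chart \<Rightarrow> ('a \<Rightarrow> real) \<Rightarrow> real" where
  "chart_integral c h = integral UNIV (integrand c h)"

definition vanishes_off :: "'a set \<Rightarrow> ('a \<Rightarrow> real) \<Rightarrow> bool" where
  "vanishes_off S h \<longleftrightarrow> (\<forall>q\<in>topspace M. q \<notin> S \<longrightarrow> h q = 0)"

text \<open>A compact set in the chart, rather than the closed support of \<open>h\<close>, is all
  that extension by zero and integration require.\<close>

definition supp_in :: "('a, 2) chart \<Rightarrow> ('a \<Rightarrow> real) \<Rightarrow> bool" where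
  "supp_in c h \<longleftrightarrow> (\<exists>K. compact K \<and> K \<subseteq> chart_image c \<and> vanishes_off (chart_inv c ` K) h)"

lemma supp_inI: "compact K \<Longrightarrow> K \<subseteq> chart_image c \<Longrightarrow> vanishes_off (chart_inv c ` K) h \<Longrightarrow> supp_in c h"
  by (auto simp: supp_in_def)

lemma supp_in_mult: "supp_in c h \<Longrightarrow> supp_in c (\<lambda>q. h q * g q)" "supp_in c h \<Longrightarrow> supp_in c (\<lambda>q. g q * h q)"
  by (auto simp: supp_in_def vanishes_off_def)

lemma vanishes_off_chart:
  assumes "c \<in> A" "K \<subseteq> chart_image c" "vanishes_off (chart_inv c ` K) h" "x \<in> chart_image c" "x \<notin> K"
  shows "h (chart_inv c x) = 0"
  using assms chart_inv_topspace[of c x] mem_chart_inv_image[of c K] by (auto simp: vanishes_off_def)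

lemma smooth_on_extension:
  assumes c: "c \<in> A" and h: "smooth_function A h" "supp_in c h" and g: "smooth_on (chart_image c) g"
  shows "smooth_on UNIV (\<lambda>x. if x \<in> chart_image c then h (chart_inv c x) * g x else 0)" (is "smooth_on UNIV ?f")
    and "compactly_supported (\<lambda>x. if x \<in> chart_image c then h (chart_inv c x) * g x else 0)"
proof -
  obtain K where K: "compact K" "K \<subseteq> chart_image c" "vanishes_off (chart_inv c ` K) h"
    using h(2) by (auto simp: supp_in_def)
  show sm: "smooth_on UNIV ?f"
    by (rule smooth_on_extend_zero[OF chart(2)[OF c] _ compact_imp_closed[OF K(1)] K(2)])
      (auto intro!: smooth_on_mult chart smooth_function_rep c h g vanishes_off_chart[OF c K(2,3)])
  have "?f x = 0" if "x \<notin> K" for x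
    using vanishes_off_chart[OF c K(2,3) _ that] by simp
  then show "compactly_supported ?f"
    unfolding compactly_supported_def using K(1) smooth_on_continuous_on[OF sm] by blast
qed

lemma compactly_supported_integrand:
  "c \<in> A \<Longrightarrow> smooth_function A h \<Longrightarrow> supp_in c h \<Longrightarrow> compactly_supported (integrand c h)"
  using smooth_on_extension(2)[OF _ _ _ smooth_abs_density] by (simp add: integrand_def[abs_def])

lemma chart_integral_cong:
  assumes "c \<in> A" "\<And>q. q \<in> topspace M \<Longrightarrow> h q = g q"
  shows "chart_integral c h = chart_integral c g"
proof -
  have "integrand c h = integrand c g"
    using assms by (auto simp: integrand_def fun_eq_iff chart_inv_topspace)
  then show ?thesis by (simp add: chart_integral_def)
qed

lemma chart_integral_sum:
  assumes "c \<in> A" "finite N" "\<And>k. k \<in> N \<Longrightarrow> smooth_function A (h k)" "\<And>k. k \<in> N \<Longrightarrow> supp_in c (h k)"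
  shows "chart_integral c (\<lambda>q. \<Sum>k\<in>N. h k q) = (\<Sum>k\<in>N. chart_integral c (h k))"
proof -
  have "integrand c (\<lambda>q. \<Sum>k\<in>N. h k q) = (\<lambda>x. \<Sum>k\<in>N. integrand c (h k) x)"
    by (auto simp: integrand_def fun_eq_iff sum_distrib_right)
  moreover have "integral UNIV (\<lambda>x. \<Sum>k\<in>N. integrand c (h k) x) = (\<Sum>k\<in>N. integral UNIV (integrand c (h k)))"
    by (rule integral_sum[OF assms(2) compactly_supported_integrable_on[OF compactly_supported_integrand]])
      (use assms in auto)
  ultimately show ?thesis by (simp add: chart_integral_def)
qed

lemma chart_integral_lincomb:
  assumes "c \<in> A" "smooth_function A h" "smooth_function A g" "supp_in c h" "supp_in c g"
  shows "chart_integral c (\<lambda>q. h q + k * g q) = chart_integral c h + k * chart_integral c g"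
proof -
  note int = compactly_supported_integrable_on[OF compactly_supported_integrand[OF assms(1)]]
  have "integrand c (\<lambda>q. h q + k * g q) = (\<lambda>x. integrand c h x + k * integrand c g x)"
    by (auto simp: integrand_def fun_eq_iff algebra_simps)
  then show ?thesis
    using integral_add[OF int integrable_on_mult_right[OF int], of h g k] assms by (simp add: chart_integral_def)
qed

text \<open>\<open>h\<close> is 0 at points of one chart outside the other, so both integrals live
  on the overlap. There the densities differ by the Jacobian determinant of the transition
  map.\<close>

lemma chart_integral_change_chart:
  assumes c: "c \<in> A" "d \<in> A" and h: "smooth_function A h" "supp_in c h" "supp_in d h"
  shows "chart_integral c h = chart_integral d h"
proof -
  let ?T = "transition c d" and ?S = "overlap c d"
  \<comment> \<open>Real values are embedded in \<open>real ^ 1\<close>, as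
    \<open>integral_change_of_variables\<close> speaks of vector-valued integrands;
    \<open>lift\<close> undoes this.\<close>
  let ?g = "\<lambda>x. integrand d h x *\<^sub>R (1 :: real ^ 1)"
  have zero: "integrand c h x = 0" if "x \<notin> overlap c d" "c \<in> A" "d \<in> A" "supp_in d h" for x c d
  proof (cases "x \<in> chart_image c")
    case True
    obtain K where K: "K \<subseteq> chart_image d" "vanishes_off (chart_inv d ` K) h"
      using \<open>supp_in d h\<close> by (auto simp: supp_in_def)
    have "chart_inv c x \<notin> fst d"
      using that(1,2) True by (simp add: mem_overlap)
    then have "chart_inv c x \<notin> chart_inv d ` K"
      using mem_chart_inv_image[OF that(3) K(1)] by blast
    then have "h (chart_inv c x) = 0"
      using K(2) chart_inv_topspace[OF that(2) True] by (simp add: vanishes_off_def)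
    then show ?thesis by (simp add: integrand_def)
  qed (simp add: integrand_def)
  have im: "?T ` ?S = overlap d c"
  proof
    show "?T ` ?S \<subseteq> overlap d c" using transition(1)[OF c] by blast
    show "overlap d c \<subseteq> ?T ` ?S"
      using transition(1,4)[OF c(2,1)] by (metis image_eqI subsetI)
  qed
  have inj: "inj_on ?T ?S"
    by (rule inj_on_inverseI[of _ "transition d c"]) (use transition(4)[OF c] in auto)
  have eq: "\<bar>det (matrix (frechet_derivative ?T (at x)))\<bar> *\<^sub>R ?g (?T x) = integrand c h x *\<^sub>R 1" if x: "x \<in> ?S" for x
    using transition[OF c x] x density_transition[OF c x] c
    by (simp add: integrand_def mem_overlap abs_mult)
  have lift: "integral S (\<lambda>x. f x *\<^sub>R (1 :: real ^ 1)) = integral S f *\<^sub>R 1" if "f integrable_on S" for f S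
    using integral_linear[OF that bounded_linear_scaleR_left[of "1 :: real ^ 1"]] by (simp add: o_def)
  note cs = compactly_supported_integrable[OF compactly_supported_integrand]
  have S: "open ?S" "open (overlap d c)" using open_overlap c by auto
  have sub: "integrand c h absolutely_integrable_on ?S" "integrand d h absolutely_integrable_on overlap d c"
  proof -
    have "(\<lambda>x. if x \<in> ?S then integrand c h x else 0) = integrand c h"
        "(\<lambda>x. if x \<in> overlap d c then integrand d h x else 0) = integrand d h"
      using zero[OF _ c h(3)] zero[OF _ c(2,1) h(2)] by auto
    then show "integrand c h absolutely_integrable_on ?S" "integrand d h absolutely_integrable_on overlap d c"
      using cs[OF c(1) h(1,2)] cs[OF c(2) h(1,3)]
        absolutely_integrable_restrict_UNIV[of ?S "integrand c h"]
        absolutely_integrable_restrict_UNIV[of "overlap d c" "integrand d h"] by simp_all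
  qed
  then have int: "integrand c h integrable_on ?S" "integrand d h integrable_on overlap d c"
    using set_lebesgue_integral_eq_integral(1) by blast+
  have ai: "?g absolutely_integrable_on ?T ` ?S"
    unfolding im using absolutely_integrable_linear[OF sub(2) bounded_linear_scaleR_left[of "1 :: real ^ 1"]]
    by (simp add: o_def)
  have "integral (?T ` ?S) ?g = integral ?S (\<lambda>x. \<bar>det (matrix (frechet_derivative ?T (at x)))\<bar> *\<^sub>R ?g (?T x))"
    by (rule integral_change_of_variables)
      (use S inj ai transition_has_derivative[OF c] in \<open>auto intro: has_derivative_at_withinI\<close>)
  also have "\<dots> = integral ?S (\<lambda>x. integrand c h x *\<^sub>R 1)"
    by (rule integral_cong) (rule eq)
  finally have "integral (overlap d c) (integrand d h) *\<^sub>R (1 :: real ^ 1) = integral ?S (integrand c h) *\<^sub>R 1"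
    unfolding im lift[OF int(1)] lift[OF int(2)] .
  then have "integral (overlap d c) (integrand d h) = integral ?S (integrand c h)"
    by simp
  moreover have "integral UNIV (integrand c h) = integral ?S (integrand c h)"
    by (rule integral_UNIV_eq) (rule zero[OF _ c h(3)])
  moreover have "integral UNIV (integrand d h) = integral (overlap d c) (integrand d h)"
    by (rule integral_UNIV_eq) (rule zero[OF _ c(2,1) h(2)])
  ultimately show ?thesis by (simp add: chart_integral_def)
qed

lemma bump_on_surface:
  assumes c: "c \<in> A" and r: "r > 0" and p: "cube p r \<subseteq> chart_image c"
  shows "smooth_function A (extend c (cube_bump p r))"
    and "vanishes_off (chart_inv c ` cube p r) (extend c (cube_bump p r))"
    and "extend c (cube_bump p r) q \<ge> 0"
    and "q \<in> chart_inv c ` open_cube p r \<Longrightarrow> extend c (cube_bump p r) q > 0"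
proof -
  show "smooth_function A (extend c (cube_bump p r))"
    using r by (intro smooth_function_extend[OF c smooth_on_subset[OF smooth_cube_bump] compact_cube p] cube_bump_zero) auto
  show "vanishes_off (chart_inv c ` cube p r) (extend c (cube_bump p r))"
    using r by (auto simp: vanishes_off_def extend_def mem_chart_inv_image[OF c p] cube_bump_zero)
  show "extend c (cube_bump p r) q \<ge> 0" by (simp add: extend_def cube_bump_nonneg)
  assume "q \<in> chart_inv c ` open_cube p r"
  then have "q \<in> fst c" "snd c q \<in> open_cube p r"
    using mem_chart_inv_image[OF c, of "open_cube p r"] p open_cube_subset by blast+
  then show "extend c (cube_bump p r) q > 0" by (simp add: extend_def cube_bump_pos)
qed

section \<open>Partition of unity and the global integral\<close>

definition partition_of_unity ::
  "'a set \<times> ('a \<Rightarrow> ('a, 2) chart) \<times> ('a \<Rightarrow> 'a \<Rightarrow> real) \<Rightarrow> bool" where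
  "partition_of_unity = (\<lambda>(N, ch, \<rho>). finite N \<and>
    (\<forall>k\<in>N. ch k \<in> A \<and> smooth_function A (\<rho> k) \<and> supp_in (ch k) (\<rho> k)) \<and>
    (\<forall>q\<in>topspace M. (\<Sum>k\<in>N. \<rho> k q) = 1))"

text \<open>By compactness finitely many open coordinate cubes cover the surface. The sum of their
  bumps is positive everywhere, and each bump is divided by it.\<close>

lemma partition_of_unity_exists: "\<exists>P. partition_of_unity P"
proof -
  have "\<exists>c r. c \<in> A \<and> m \<in> fst c \<and> r > 0 \<and> cube (snd c m) r \<subseteq> chart_image c" if m: "m \<in> topspace M" for m
  proof -
    obtain c where c: "c \<in> A" "m \<in> fst c" using chart_cover[OF m] by blast
    from open_contains_cube[OF chart(2)[OF c(1)] chart_mem[OF c(2)]] c show ?thesis by metis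
  qed
  then obtain ch r where ch: "\<And>m. m \<in> topspace M \<Longrightarrow> ch m \<in> A" "\<And>m. m \<in> topspace M \<Longrightarrow> m \<in> fst (ch m)"
      "\<And>m. m \<in> topspace M \<Longrightarrow> r m > 0" "\<And>m. m \<in> topspace M \<Longrightarrow> cube (snd (ch m) m) (r m) \<subseteq> chart_image (ch m)"
    by metis
  let ?p = "\<lambda>m. snd (ch m) m"
  let ?U = "\<lambda>m. chart_inv (ch m) ` open_cube (?p m) (r m)"
  define b where "b m = extend (ch m) (cube_bump (?p m) (r m))" for m
  note bump = bump_on_surface[OF ch(1) ch(3) ch(4), folded b_def]
  have U: "openin M (?U m)" if "m \<in> topspace M" for m
    by (rule openin_chart_inv_image[OF ch(1)[OF that] open_open_cube order_trans[OF open_cube_subset ch(4)[OF that]]])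
  have "m \<in> ?U m" if "m \<in> topspace M" for m
    by (rule image_eqI[where x = "?p m"]) (simp add: ch that, rule centre_open_cube[OF ch(3)[OF that]])
  then have cover: "topspace M \<subseteq> \<Union>(?U ` topspace M)" by blast
  have "\<exists>F. finite F \<and> F \<subseteq> ?U ` topspace M \<and> topspace M \<subseteq> \<Union>F"
    by (rule compactinD[OF compact[unfolded compact_space_def] _ cover]) (use U in blast)
  then obtain F where F: "finite F" "F \<subseteq> ?U ` topspace M" "topspace M \<subseteq> \<Union>F" by blast
  from finite_subset_image[OF F(1,2)] obtain N where "N \<subseteq> topspace M" "finite N" "F = ?U ` N" by blast
  with F(3) have N: "finite N" "N \<subseteq> topspace M" "topspace M \<subseteq> \<Union>(?U ` N)" by auto
  define s where "s q = (\<Sum>m\<in>N. b m q)" for q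
  have spos: "s q > 0" if "q \<in> topspace M" for q
  proof -
    from subsetD[OF N(3) that] obtain m where m: "m \<in> N" "q \<in> ?U m" by (rule UN_E)
    then have mt: "m \<in> topspace M" using N(2) by blast
    show ?thesis
      unfolding s_def
    proof (rule sum_pos2[OF N(1) m(1)])
      show "0 < b m q" by (rule bump(4)) (fact mt m(2))+
      show "0 \<le> b k q" if "k \<in> N" for k
        by (rule bump(3)) (use that N(2) in blast)+
    qed
  qed
  have ss: "smooth_function A s"
    unfolding s_def using N(2) bump(1) by (intro smooth_function_sum) blast
  have "partition_of_unity (N, ch, \<lambda>m q. b m q / s q)"
    unfolding partition_of_unity_def case_prod_conv
  proof (intro conjI ballI)
    fix m assume "m \<in> N"
    then have m: "m \<in> topspace M" using N(2) by blast
    show "ch m \<in> A" by (rule ch(1)[OF m])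
    show "smooth_function A (\<lambda>q. b m q / s q)"
      using spos by (intro smooth_function_divide bump(1) m ss) force
    have "vanishes_off (chart_inv (ch m) ` cube (?p m) (r m)) (b m)"
      by (rule bump(2)) (fact m)+
    then show "supp_in (ch m) (\<lambda>q. b m q / s q)"
      by (intro supp_inI[OF compact_cube ch(4)[OF m]]) (simp add: vanishes_off_def)
  next
    fix q assume "q \<in> topspace M"
    then show "(\<Sum>m\<in>N. b m q / s q) = 1"
      using spos[of q] by (simp add: s_def flip: sum_divide_distrib)
  qed (rule N(1))
  then show ?thesis ..
qed

definition pou :: "'a set \<times> ('a \<Rightarrow> ('a, 2) chart) \<times> ('a \<Rightarrow> 'a \<Rightarrow> real)" where
  "pou = (SOME P. partition_of_unity P)"

abbreviation "pou_index \<equiv> fst pou"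
abbreviation "pou_chart \<equiv> fst (snd pou)"
abbreviation "pou_fun \<equiv> snd (snd pou)"

lemma pou:
  shows "finite pou_index" "k \<in> pou_index \<Longrightarrow> pou_chart k \<in> A"
    "k \<in> pou_index \<Longrightarrow> smooth_function A (pou_fun k)" "k \<in> pou_index \<Longrightarrow> supp_in (pou_chart k) (pou_fun k)"
    "q \<in> topspace M \<Longrightarrow> (\<Sum>k\<in>pou_index. pou_fun k q) = 1"
  using someI_ex[OF partition_of_unity_exists, folded pou_def]
  by (auto simp: partition_of_unity_def case_prod_unfold)

definition surface_integral :: "('a \<Rightarrow> real) \<Rightarrow> real" where
  "surface_integral h = (\<Sum>k\<in>pou_index. chart_integral (pou_chart k) (\<lambda>q. pou_fun k q * h q))"

lemma surface_integral_lincomb: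
  assumes "smooth_function A h" "smooth_function A g"
  shows "surface_integral (\<lambda>q. h q + k * g q) = surface_integral h + k * surface_integral g"
proof -
  have "chart_integral (pou_chart i) (\<lambda>q. pou_fun i q * (h q + k * g q)) =
      chart_integral (pou_chart i) (\<lambda>q. pou_fun i q * h q) + k * chart_integral (pou_chart i) (\<lambda>q. pou_fun i q * g q)"
    if i: "i \<in> pou_index" for i
    using chart_integral_lincomb[OF pou(2)[OF i] smooth_function_mult[OF pou(3)[OF i] assms(1)]
        smooth_function_mult[OF pou(3)[OF i] assms(2)] supp_in_mult(1)[OF pou(4)[OF i]] supp_in_mult(1)[OF pou(4)[OF i]], of k]
    by (simp add: algebra_simps)
  then show ?thesis
    unfolding surface_integral_def by (simp add: sum.distrib sum_distrib_left)
qed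

lemma surface_integral_cong:
  assumes "\<And>q. q \<in> topspace M \<Longrightarrow> h q = g q"
  shows "surface_integral h = surface_integral g"
  unfolding surface_integral_def by (intro sum.cong refl chart_integral_cong pou(2)) (simp_all add: assms)

text \<open>Every summand may be computed in the chart \<open>c\<close>, since \<open>h\<close> is
  supported there as well; then the weights add up to 1 under the integral.\<close>

lemma surface_integral_local:
  assumes c: "c \<in> A" and h: "smooth_function A h" "supp_in c h"
  shows "surface_integral h = chart_integral c h"
proof -
  have "surface_integral h = (\<Sum>k\<in>pou_index. chart_integral c (\<lambda>q. pou_fun k q * h q))"
    unfolding surface_integral_def by (intro sum.cong refl chart_integral_change_chart pou(2) c
        smooth_function_mult pou(3) h(1) supp_in_mult(1)[OF pou(4)] supp_in_mult(2)[OF h(2)])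
  also have "\<dots> = chart_integral c (\<lambda>q. \<Sum>k\<in>pou_index. pou_fun k q * h q)"
    by (rule chart_integral_sum[symmetric]) (auto intro: c pou smooth_function_mult h supp_in_mult)
  also have "\<dots> = chart_integral c h"
    by (rule chart_integral_cong[OF c]) (simp add: pou(5) flip: sum_distrib_right)
  finally show ?thesis .
qed

subsection \<open>Stokes' theorem for symplectic vector fields\<close>

lemma d0_vanishes:
  assumes "closedin M S" "vanishes_off S f" "c \<in> A" "x \<in> chart_image c" "chart_inv c x \<notin> S"
  shows "d0 f c x u = 0"
proof -
  have "openin M (topspace M - S)" using assms(1) by (simp add: closedin_def)
  from d0_cong_open[OF this, of f "\<lambda>_. 0" c x] assms show ?thesis
    by (simp add: vanishes_off_def chart_inv_topspace d0_const)
qed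

lemma supp_in_contract_d0:
  assumes c: "c \<in> A" and f: "smooth_function A f" "supp_in c f" and X: "smooth_vector_field A X"
  shows "supp_in c (contract (d0 f) X)"
proof -
  obtain K where K: "compact K" "K \<subseteq> chart_image c" "vanishes_off (chart_inv c ` K) f"
    using f(2) by (auto simp: supp_in_def)
  have "contract (d0 f) X q = 0" if q: "q \<in> topspace M" "q \<notin> chart_inv c ` K" for q
  proof -
    obtain d where d: "d \<in> A" "q \<in> fst d" using chart_cover[OF q(1)] by blast
    then have "contract (d0 f) X q = d0 f d (snd d q) (X d (snd d q))"
      using contract_eq[OF smooth_form1_d0[OF f(1)] X d(1) chart_mem[OF d(2)]] by simp
    also have "\<dots> = 0"
      using d q by (intro d0_vanishes[OF closedin_chart_inv_image[OF c K(1,2)] K(3)]) (auto simp: chart_mem)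
    finally show ?thesis .
  qed
  then show ?thesis
    by (intro supp_inI[OF K(1,2)]) (simp add: vanishes_off_def)
qed

text \<open>On the coordinate vectors e1, e2 the Lie derivative of \<omega> is the divergence of the
  field X multiplied by the density.\<close>

lemma divergence_free:
  assumes c: "c \<in> A" "x \<in> chart_image c" and L: "form2_zero A (lie_derivative X \<omega>)"
  shows "frechet_derivative (density c) (at x) (X c x) +
    density c x * (frechet_derivative (X c) (at x) (axis 1 1) $ 1 + frechet_derivative (X c) (at x) (axis 2 1) $ 2) = 0"
proof -
  have "lie_derivative X \<omega> c x (axis 1 1) (axis 2 1) = 0"
    using L c by (simp add: form2_zero_def)
  then show ?thesis
    unfolding lie_derivative_def omega_eq[OF c] density_def[symmetric] by (simp add: axis_simps algebra_simps)
qed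

lemma chart_integral_contract_d0:
  assumes c: "c \<in> A" and f: "smooth_function A f" "supp_in c f"
    and X: "smooth_vector_field A X" and L: "form2_zero A (lie_derivative X \<omega>)"
  shows "chart_integral c (contract (d0 f) X) = 0"
proof -
  \<comment> \<open>The components of the field f |density| X, extended by zero. Its divergence is
    the integrand, as the field |density| X has divergence 0.\<close>
  define g where "g i x = (if x \<in> chart_image c then f (chart_inv c x) * (X c x $ i * \<bar>density c x\<bar>) else 0)" for i x
  have sX: "smooth_on (chart_image c) (X c)" using X c by (simp add: smooth_vector_field_def)
  have sX': "smooth_on (chart_image c) (\<lambda>x. X c x $ i * \<bar>density c x\<bar>)" for i
    by (intro smooth_on_mult smooth_on_vec_nth sX smooth_abs_density chart c)
  have sg: "smooth_on UNIV (g i)" and cg: "compactly_supported (g i)" for i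
    unfolding g_def using smooth_on_extension[OF c f sX'] by auto
  obtain K where K: "\<And>i. compact (K i)" "\<And>i x. x \<notin> K i \<Longrightarrow> g i x = 0"
    using cg unfolding compactly_supported_def by metis
  let ?D = "\<lambda>i x. frechet_derivative (g i) (at x)"
  note zero = directional_derivative_integral[OF sg K(1) K(2)]
  have "integrand c (contract (d0 f) X) x = ?D 1 x (axis 1 1) + ?D 2 x (axis 2 1)" for x
  proof (cases "x \<in> chart_image c")
    case True
    note df = d0_has_derivative[OF f(1) c True]
    let ?X' = "frechet_derivative (X c) (at x)" and ?w' = "frechet_derivative (density c) (at x)"
    let ?E = "\<lambda>i v. f (chart_inv c x) * (X c x $ i * (sgn (density c x) * ?w' v) + ?X' v $ i * \<bar>density c x\<bar>) +
        d0 f c x v * (X c x $ i * \<bar>density c x\<bar>)"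
    have D: "?D i x v = ?E i v" for i v
    proof -
      have "((\<lambda>x. f (chart_inv c x) * (X c x $ i * \<bar>density c x\<bar>)) has_derivative ?E i) (at x)"
        by (intro has_derivative_mult df bounded_linear.has_derivative[OF bounded_linear_vec_nth]
            smooth_on_has_derivative[OF sX True]
            has_derivative_abs_smooth[OF chart(2)[OF c] smooth_density[OF c] density_nonzero[OF c] True])
      then have "(g i has_derivative ?E i) (at x)"
        by (rule has_derivative_transform_within_open[OF _ chart(2)[OF c] True]) (simp add: g_def)
      from fun_cong[OF frechet_derivative_at[OF this], of v] show ?thesis by (rule sym)
    qed
    let ?w1 = "?w' (axis 1 1)" and ?w2 = "?w' (axis 2 1)"
      and ?f1 = "d0 f c x (axis 1 1)" and ?f2 = "d0 f c x (axis 2 1)"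
      and ?d = "?X' (axis 1 1) $ 1 + ?X' (axis 2 1) $ 2"
    have lw: "?w' (X c x) = X c x $ 1 * ?w1 + X c x $ 2 * ?w2"
      using linear_plane[OF has_derivative_linear[OF smooth_on_has_derivative[OF smooth_density[OF c] True]], of "X c x"] by simp
    have lf: "d0 f c x (X c x) = X c x $ 1 * ?f1 + X c x $ 2 * ?f2"
      using linear_plane[OF d0_linear[OF f(1) c True], of "X c x"] by simp
    \<comment> \<open>The product rule, sorted into f times the divergence of the weighted field and
      the derivative of f along it.\<close>
    have "?D 1 x (axis 1 1) + ?D 2 x (axis 2 1) =
        f (chart_inv c x) * sgn (density c x) * ((X c x $ 1 * ?w1 + X c x $ 2 * ?w2) + density c x * ?d)
        + (X c x $ 1 * ?f1 + X c x $ 2 * ?f2) * \<bar>density c x\<bar>"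
      unfolding D abs_sgn by (simp add: algebra_simps)
    also have "\<dots> = d0 f c x (X c x) * \<bar>density c x\<bar>"
      using divergence_free[OF c True L] unfolding lw lf by simp
    finally show ?thesis
      using True contract_eq[OF smooth_form1_d0[OF f(1)] X c True] by (simp add: integrand_def)
  next
    case False
    obtain K where K: "compact K" "K \<subseteq> chart_image c" "vanishes_off (chart_inv c ` K) f"
      using f(2) by (auto simp: supp_in_def)
    have "g i y = 0" if "y \<notin> K" for i y
      using vanishes_off_chart[OF c K(2,3) _ that] by (simp add: g_def)
    then have "?D i x e = 0" for i e
      using False K(2) by (intro derivative_vanishes_off[OF K(1)]) auto
    with False show ?thesis by (simp add: integrand_def)
  qed
  then have "integrand c (contract (d0 f) X) = (\<lambda>x. ?D 1 x (axis 1 1) + ?D 2 x (axis 2 1))" ..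
  then show ?thesis
    by (simp add: chart_integral_def integral_add[OF zero(1) zero(1)] zero(2))
qed

lemma surface_integral_sum:
  assumes "finite N" "\<And>k. k \<in> N \<Longrightarrow> smooth_function A (h k)"
  shows "surface_integral (\<lambda>q. \<Sum>k\<in>N. h k q) = (\<Sum>k\<in>N. surface_integral (h k))"
  using assms
proof (induction N)
  case empty
  show ?case using surface_integral_lincomb[OF smooth_function_const[of 0] smooth_function_const[of 0], of "1"] by simp
next
  case (insert i N)
  then show ?case
    using surface_integral_lincomb[of "h i" "\<lambda>q. \<Sum>k\<in>N. h k q" 1] smooth_function_sum[of N h] by simp
qed

text \<open>The function is cut into pieces supported in charts before, not after, differentiating:
  each piece then has integral 0 on its own, and the differentials of the pieces add up to
  df.\<close>

lemma surface_integral_contract_d0: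
  assumes f: "smooth_function A f" and X: "smooth_vector_field A X" and L: "form2_zero A (lie_derivative X \<omega>)"
  shows "surface_integral (contract (d0 f) X) = 0"
proof -
  define f' where "f' k q = pou_fun k q * f q" for k q
  have f': "smooth_function A (f' k)" "supp_in (pou_chart k) (f' k)" if "k \<in> pou_index" for k
    unfolding f'_def using smooth_function_mult[OF pou(3)[OF that] f] supp_in_mult(1)[OF pou(4)[OF that]] by auto
  have "surface_integral (contract (d0 f) X) = surface_integral (\<lambda>q. \<Sum>k\<in>pou_index. contract (d0 (f' k)) X q)"
  proof (rule surface_integral_cong)
    fix q assume q: "q \<in> topspace M"
    then obtain c where c: "c \<in> A" "q \<in> fst c" using chart_cover by blast
    let ?x = "snd c q"
    have x: "?x \<in> chart_image c" "chart_inv c ?x = q" using c by (simp_all add: chart_mem)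
    have ev: "contract (d0 g) X q = d0 g c ?x (X c ?x)" if "smooth_function A g" for g
      using contract_eq[OF smooth_form1_d0[OF that] X c(1) x(1)] by (simp add: x(2))
    have "d0 f c ?x = d0 (\<lambda>q. \<Sum>k\<in>pou_index. f' k q) c ?x"
      by (rule d0_cong_open[OF openin_topspace]) (use x c pou(5) in \<open>auto simp: f'_def q simp flip: sum_distrib_right\<close>)
    then show "contract (d0 f) X q = (\<Sum>k\<in>pou_index. contract (d0 (f' k)) X q)"
      by (simp add: ev f f' d0_sum[OF pou(1) f'(1) c(1) x(1)])
  qed
  also have "\<dots> = (\<Sum>k\<in>pou_index. surface_integral (contract (d0 (f' k)) X))"
    by (rule surface_integral_sum[OF pou(1)]) (intro smooth_function_contract smooth_form1_d0 f' X)
  also have "\<dots> = (\<Sum>k\<in>pou_index. 0)"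
  proof (rule sum.cong[OF refl])
    fix k assume k: "k \<in> pou_index"
    show "surface_integral (contract (d0 (f' k)) X) = 0"
      using surface_integral_local[OF pou(2)[OF k] smooth_function_contract[OF smooth_form1_d0[OF f'(1)[OF k]] X]
          supp_in_contract_d0[OF pou(2)[OF k] f'[OF k] X]] chart_integral_contract_d0[OF pou(2)[OF k] f'[OF k] X L] by simp
  qed
  finally show ?thesis by simp
qed

end

context atlas_mfd
begin

sublocale open_charts A
  by unfold_locales (rule chart(2))

lemma smooth_form1_add_scale:
  "smooth_form1 A \<alpha> \<Longrightarrow> smooth_form1 A \<beta> \<Longrightarrow> smooth_form1 A (form1_add \<alpha> (form1_scale k \<beta>))"
  using smooth_form1_lincomb[of \<alpha> \<beta> 1 k] by (simp add: form1_scale_def[of 1, abs_def])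

lemma contract_add_scale:
  assumes \<alpha>: "smooth_form1 A \<alpha>" and \<beta>: "smooth_form1 A \<beta>" and X: "smooth_vector_field A X" and q: "q \<in> topspace M"
  shows "contract (form1_add \<alpha> (form1_scale k \<beta>)) X q = contract \<alpha> X q + k * contract \<beta> X q"
proof -
  obtain c where c: "c \<in> A" "q \<in> fst c" using chart_cover[OF q] by blast
  note eq = contract_eq[OF _ X c(1) chart_mem[OF c(2)]]
  show ?thesis
    using eq[OF \<alpha>] eq[OF \<beta>] eq[OF smooth_form1_add_scale[OF \<alpha> \<beta>, of k]] c
    by (simp add: form1_add_def form1_scale_def)
qed

end

section \<open>Primitives of 2-forms\<close>

context area_surface
begin

lemma surface_integral_zero: "surface_integral (\<lambda>q. 0) = 0"
  using surface_integral_lincomb[OF smooth_function_const[of 0] smooth_function_const[of 0], of 1] by simp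

lemma surface_integral_scale: "smooth_function A g \<Longrightarrow> surface_integral (\<lambda>q. k * g q) = k * surface_integral g"
  using surface_integral_lincomb[OF smooth_function_const[of 0], of g k] by (simp add: surface_integral_zero)

lemma surface_integral_diff: "smooth_function A h \<Longrightarrow> smooth_function A g \<Longrightarrow> surface_integral (\<lambda>q. h q - g q) = surface_integral h - surface_integral g"
  using surface_integral_lincomb[of h g "-1"] by simp

lemma normalized_bump:
  assumes c: "c \<in> A" and r: "r > 0" and p: "cube p r \<subseteq> chart_image c"
  obtains u where "smooth_function A u" "vanishes_off (chart_inv c ` cube p r) u" "surface_integral u = 1"
proof -
  let ?b = "extend c (cube_bump p r)"
  note b = bump_on_surface[OF assms]
  have supp: "supp_in c ?b" by (rule supp_inI[OF compact_cube p b(2)])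
  have "p \<in> chart_image c" using p centre_open_cube[OF r] open_cube_subset by blast
  then have "integrand c ?b p > 0"
    using density_nonzero[OF c] cube_bump_pos[OF centre_open_cube[OF r]] by (simp add: integrand_def)
  moreover have "integrand c ?b x \<ge> 0" for x
    by (simp add: integrand_def cube_bump_nonneg)
  ultimately have "chart_integral c ?b > 0"
    unfolding chart_integral_def using compactly_supported_integral_pos[OF compactly_supported_integrand[OF c b(1) supp]] by blast
  then have surface_integral: "surface_integral ?b > 0" using surface_integral_local[OF c b(1) supp] by simp
  show ?thesis
  proof (rule that[of "\<lambda>q. inverse (surface_integral ?b) * ?b q"])
    show "surface_integral (\<lambda>q. inverse (surface_integral ?b) * ?b q) = 1"
      using surface_integral by (subst surface_integral_scale[OF b(1)]) simp
  qed (use b(2) in \<open>auto simp: vanishes_off_def intro!: smooth_function_mult smooth_function_const b(1)\<close>)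
qed

text \<open>The equation d\<eta> = u \<omega>; \<open>u\<close> is the curl of \<eta> relative to
  the area form.\<close>

definition curl :: "('a, 2) form1 \<Rightarrow> ('a \<Rightarrow> real) \<Rightarrow> bool" where
  "curl \<eta> u \<longleftrightarrow> (\<forall>c\<in>A. \<forall>x\<in>chart_image c. \<forall>a b. d1 \<eta> c x a b = u (chart_inv c x) * \<omega> c x a b)"

lemma curl_add_scale:
  assumes "smooth_form1 A \<alpha>" "smooth_form1 A \<beta>" "curl \<alpha> u" "curl \<beta> v"
  shows "curl (form1_add \<alpha> (form1_scale k \<beta>)) (\<lambda>q. u q + k * v q)"
  using assms by (simp add: curl_def d1_add algebra_simps)

text \<open>A cube is connected and the density has no zeros, so its sign is constant.\<close>

lemma abs_density_sign:
  assumes c: "c \<in> A" and p: "cube p r \<subseteq> chart_image c"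
  obtains \<sigma> where "\<And>x. x \<in> cube p r \<Longrightarrow> \<bar>density c x\<bar> = \<sigma> * density c x" "\<sigma> \<noteq> 0"
proof (cases "\<exists>x\<in>cube p r. density c x > 0")
  case True
  then obtain x where x: "x \<in> cube p r" "density c x > 0" by blast
  have conn: "connected (density c ` cube p r)"
    by (intro connected_continuous_image convex_connected convex_cube
        continuous_on_subset[OF smooth_on_continuous_on[OF smooth_density[OF c]] p])
  have "density c y > 0" if y: "y \<in> cube p r" for y
  proof (rule ccontr)
    assume "\<not> density c y > 0"
    then have "0 \<in> density c ` cube p r"
      using connectedD_interval[OF conn, of "density c y" "density c x" 0] x y by auto
    then show False using density_nonzero[OF c] p by auto
  qed
  then show ?thesis by (intro that[of 1]) (simp_all add: abs_of_pos)
next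
  case False
  then show ?thesis by (intro that[of "-1"]) (auto simp: not_less)
qed

lemma vanishes_off_extend:
  assumes "c \<in> A" "K \<subseteq> chart_image c" "\<And>x. x \<notin> K \<Longrightarrow> f x = 0"
  shows "vanishes_off (chart_inv c ` K) (extend c f)"
  using assms by (auto simp: vanishes_off_def extend_def mem_chart_inv_image)

text \<open>The compactly supported Poincare lemma; integration by parts against a primitive \<open>F\<close> of the
  contraction of \<open>\<omega>\<close> with \<open>X\<close> evaluates the integral of \<open>\<eta>(X)\<close>.\<close>

lemma compactly_supported_primitive:
  assumes c: "c \<in> A" and r: "0 < r" "r < R" and p: "cube p R \<subseteq> chart_image c"
    and u: "smooth_function A u" "vanishes_off (chart_inv c ` cube p r) u" "surface_integral u = 0"
  obtains \<eta> where "smooth_form1 A \<eta>" "curl \<eta> u"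
    "\<And>X F. smooth_vector_field A X \<Longrightarrow> smooth_function A F \<Longrightarrow>
      (\<And>x v. x \<in> cube p r \<Longrightarrow> d0 F c x v = \<omega> c x (X c x) v) \<Longrightarrow> surface_integral (contract \<eta> X) = surface_integral (\<lambda>q. F q * u q)"
proof -
  let ?e1 = "axis 1 1 :: real ^ 2" and ?e2 = "axis 2 1 :: real ^ 2"
  let ?D = "\<lambda>g x. frechet_derivative g (at x)"
  let ?S = "chart_inv c ` cube p r"
  have sub: "cube p r \<subseteq> open_cube p R" "cube p r \<subseteq> chart_image c"
    using cube_subset_open_cube[OF r(2), of p] open_cube_subset[of p R] p by blast+
  have closed: "closedin M ?S" by (rule closedin_chart_inv_image[OF c compact_cube sub(2)])
  have supp: "supp_in c h" if "vanishes_off ?S h" for h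
    by (rule supp_inI[OF compact_cube sub(2) that])
  obtain \<sigma> where \<sigma>: "\<And>x. x \<in> cube p r \<Longrightarrow> \<bar>density c x\<bar> = \<sigma> * density c x" "\<sigma> \<noteq> 0"
    using abs_density_sign[OF c sub(2)] by blast
  \<comment> \<open>In the chart the form u \<omega> is k times the standard area form; the signed
    density is used here, and \<open>\<sigma>\<close> translates to the measure.\<close>
  define k where "k x = (if x \<in> chart_image c then u (chart_inv c x) * density c x else 0)" for x
  have sk: "smooth_on UNIV k"
    unfolding k_def by (rule smooth_on_extension(1)[OF c u(1) supp[OF u(2)] smooth_density[OF c]])
  have k0: "k x = 0" if "x \<notin> cube p r" for x
    using vanishes_off_chart[OF c sub(2) u(2) _ that] by (simp add: k_def)
  have ku: "integrand c (\<lambda>q. g q * u q) x = \<sigma> * (g (chart_inv c x) * k x)" for g x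
    using k0[of x] vanishes_off_chart[OF c sub(2) u(2), of x] \<sigma>(1)[of x]
    by (cases "x \<in> cube p r") (auto simp: integrand_def k_def)
  have "integral UNIV k = 0"
  proof -
    have "integrand c u = (\<lambda>x. \<sigma> * k x)" using ku[of "\<lambda>_. 1"] by auto
    then have "\<sigma> * integral UNIV k = 0"
      using u(3) surface_integral_local[OF c u(1) supp[OF u(2)]] by (simp add: chart_integral_def)
    then show ?thesis using \<sigma>(2) by simp
  qed
  have k0': "k x = 0" if "\<bar>x $ i - p $ i\<bar> > r" for x i
    using that by (intro k0) (auto simp: cube_def not_le)
  obtain f2 f1' \<gamma> where f2: "smooth_on UNIV f2" "\<And>x i. \<bar>x $ i - p $ i\<bar> > r \<Longrightarrow> f2 x = 0"
    and f1': "smooth_on UNIV f1'" "\<And>x i. \<bar>x $ i - p $ i\<bar> > r \<Longrightarrow> f1' x = 0"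
    and kf': "\<And>x. k x = ?D f2 x ?e1 + ?D f1' x ?e2 + \<gamma> * (bump r (x $ 1 - p $ 1) * bump r (x $ 2 - p $ 2))"
    by (rule compact_primitive_plane[OF r(1) sk k0']) blast+
  have f2_0: "f2 x = 0" and f1'_0: "f1' x = 0" if "x \<notin> cube p r" for x
    using that f2(2)[of x] f1'(2)[of x] by (auto simp: cube_def not_le)
  note int = directional_derivative_integral[OF _ compact_cube]
  \<comment> \<open>Integrating the decomposition over the plane, \<open>k\<close> and the two
    derivatives contribute 0, whereas the bump has positive integral.\<close>
  have "\<gamma> = 0"
  proof -
    have bump: "compactly_supported (cube_bump p r)"
      unfolding compactly_supported_def
      using smooth_on_continuous_on[OF smooth_cube_bump] compact_cube[of p r] cube_bump_zero[of r _ p] r(1) by force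
    have "integral UNIV (\<lambda>x. ?D f2 x ?e1 + ?D f1' x ?e2 + \<gamma> * cube_bump p r x) = \<gamma> * integral UNIV (cube_bump p r)"
      using int[OF f2(1) f2_0] int[OF f1'(1) f1'_0] compactly_supported_integrable_on[OF bump]
      by (simp add: integral_add integrable_add integrable_on_mult_right)
    moreover have "k = (\<lambda>x. ?D f2 x ?e1 + ?D f1' x ?e2 + \<gamma> * cube_bump p r x)"
      using kf' by (auto simp: cube_bump_def)
    ultimately have "\<gamma> * integral UNIV (cube_bump p r) = 0"
      using \<open>integral UNIV k = 0\<close> by simp
    moreover have "integral UNIV (cube_bump p r) > 0"
      by (rule compactly_supported_integral_pos[OF bump cube_bump_nonneg cube_bump_pos[OF centre_open_cube[OF r(1)]]])
    ultimately show ?thesis by simp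
  qed
  \<comment> \<open>The sign turns the divergence into the curl of f1 dx1 + f2 dx2.\<close>
  define f1 where "f1 x = - f1' x" for x
  have f1: "smooth_on UNIV f1" unfolding f1_def by (intro smooth_on_uminus f1' open_UNIV)
  have f1_0: "f1 x = 0" if "x \<notin> cube p r" for x using f1'_0[OF that] by (simp add: f1_def)
  have "?D f1 x v = - ?D f1' x v" for x v
    using frechet_derivative_at[OF has_derivative_minus[OF smooth_on_has_derivative[OF f1'(1) UNIV_I]], of x]
    unfolding f1_def by metis
  with kf' \<open>\<gamma> = 0\<close> have kf: "k x = ?D f2 x ?e1 - ?D f1 x ?e2" for x by simp
  \<comment> \<open>A radius strictly between, so that the cut-off is 1 on a neighbourhood of the
    small cube and 0 outside the large one.\<close>
  define r' where "r' = (r + R) / 2"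
  have r': "r < r'" "r' < R" "0 \<le> r'" using r by (simp_all add: r'_def)
  let ?cut = "cube_plateau p r' R"
  note scut = smooth_cube_plateau[OF r'(3,2), of p]
  \<comment> \<open>Global functions that agree with the coordinates near the cube; their
    differentials replace dx1 and dx2.\<close>
  define \<xi> where "\<xi> i = extend c (\<lambda>x. x $ i * ?cut x)" for i
  have s\<xi>: "smooth_function A (\<xi> i)" for i
    unfolding \<xi>_def
    by (rule smooth_function_extend[OF c _ compact_cube p])
      (use r in \<open>auto simp: cube_plateau_zero intro: smooth_on_subset[OF smooth_on_mult[OF open_UNIV
          smooth_on_linear[OF open_UNIV bounded_linear_vec_nth] scut]]\<close>)
  define E1 E2 where "E1 = extend c f1" and "E2 = extend c f2"
  have sE: "smooth_function A E1" "smooth_function A E2"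
    unfolding E1_def E2_def using f1_0 f2_0
    by (auto intro!: smooth_function_extend[OF c _ compact_cube sub(2)] smooth_on_subset[OF f1] smooth_on_subset[OF f2(1)])
  have vE: "vanishes_off ?S E1" "vanishes_off ?S E2"
    unfolding E1_def E2_def by (auto intro!: vanishes_off_extend[OF c sub(2)] f1_0 f2_0)
  have dE: "d0 E1 c x v = ?D f1 x v" "d0 E2 c x v = ?D f2 x v" if x: "x \<in> chart_image c" for x v
    unfolding d0_def comp_def E1_def E2_def
    by (rule fun_cong[OF frechet_derivative_cong_open[OF chart(2)[OF c] x]], simp)+
  have d\<xi>: "d0 (\<xi> i) c x v = v $ i" if x: "x \<in> cube p r" for i x v
  proof -
    have x': "x \<in> open_cube p r'" using x cube_subset_open_cube[OF r'(1), of p] by blast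
    have "((\<lambda>x. x $ i) has_derivative (\<lambda>v. v $ i)) (at x)"
      by (rule bounded_linear_imp_has_derivative[OF bounded_linear_vec_nth])
    then have "((\<lambda>x. \<xi> i (chart_inv c x)) has_derivative (\<lambda>v. v $ i)) (at x)"
    proof (rule has_derivative_transform_within_open[OF _ open_open_cube x'])
      fix y assume y: "y \<in> open_cube p r'"
      then have "y \<in> chart_image c"
        using p r'(2) cube_subset_open_cube[OF r'(2), of p] open_cube_subset by blast
      then show "y $ i = \<xi> i (chart_inv c y)" using cube_plateau_one[OF r'(2), of y p] y open_cube_subset by (auto simp: \<xi>_def)
    qed
    from fun_cong[OF d0_eqI[OF this]] show ?thesis .
  qed
  define \<eta> where "\<eta> = form1_add (fdg E1 (\<xi> 1)) (form1_scale 1 (fdg E2 (\<xi> 2)))"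
  have s\<eta>: "smooth_form1 A \<eta>"
    unfolding \<eta>_def by (intro smooth_form1_add_scale smooth_form1_fdg sE s\<xi>)
  have d\<eta>: "d1 \<eta> d y a b = d1 (fdg E1 (\<xi> 1)) d y a b + d1 (fdg E2 (\<xi> 2)) d y a b"
    if "d \<in> A" "y \<in> chart_image d" for d y a b
    unfolding \<eta>_def by (simp add: d1_add smooth_form1_fdg sE s\<xi> that)
  have curl_c: "d1 \<eta> c x a b = u (chart_inv c x) * \<omega> c x a b" if x: "x \<in> cube p r" for x a b
  proof -
    have xc: "x \<in> chart_image c" using x sub(2) by blast
    have lin: "?D f x v = v $ 1 * ?D f x ?e1 + v $ 2 * ?D f x ?e2" if "smooth_on UNIV f" for f :: "real ^ 2 \<Rightarrow> real" and v
      using linear_plane[OF has_derivative_linear[OF smooth_on_has_derivative[OF that UNIV_I, of x]], of v] by simp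
    have "d1 \<eta> c x a b = (?D f1 x a * b $ 1 - ?D f1 x b * a $ 1) + (?D f2 x a * b $ 2 - ?D f2 x b * a $ 2)"
      by (simp add: d\<eta>[OF c xc] d1_fdg sE s\<xi> c xc dE[OF xc] d\<xi>[OF x])
    also have "\<dots> = k x * (a $ 1 * b $ 2 - a $ 2 * b $ 1)"
      unfolding kf lin[OF f1, of a] lin[OF f1, of b] lin[OF f2(1), of a] lin[OF f2(1), of b]
      by (simp add: algebra_simps)
    finally show ?thesis by (simp add: k_def xc omega_eq[OF c xc])
  qed
  \<comment> \<open>Outside the image of the cube \<open>E1\<close>, \<open>E2\<close> and
    \<open>u\<close> vanish together with the differentials of \<open>E1\<close> and
    \<open>E2\<close>; inside, the equation is transported from \<open>c\<close>.\<close>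
  have curl: "curl \<eta> u"
    unfolding curl_def
  proof (intro ballI allI)
    fix d y a b assume d: "d \<in> A" and y: "y \<in> chart_image d"
    let ?q = "chart_inv d y"
    show "d1 \<eta> d y a b = u ?q * \<omega> d y a b"
    proof (cases "?q \<in> ?S")
      case False
      have "u ?q = 0" using u(2) False chart_inv_topspace[OF d y] by (simp add: vanishes_off_def)
      then show ?thesis
        by (simp add: d\<eta>[OF d y] d1_fdg sE s\<xi> d y d0_vanishes[OF closed vE(1) d y False] d0_vanishes[OF closed vE(2) d y False])
    next
      case True
      then have q: "?q \<in> fst c" "snd c ?q \<in> cube p r"
        using mem_chart_inv_image[OF c sub(2)] by blast+
      let ?T = "transition d c" and ?D' = "frechet_derivative (transition d c) (at y)"
      have ov: "y \<in> overlap d c" using q y by (simp add: mem_overlap[OF d])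
      have T: "?T y \<in> cube p r" using q by (simp add: transition_def)
      have "d1 \<eta> d y a b = d1 \<eta> c (?T y) (?D' a) (?D' b)"
        by (simp add: d\<eta>[OF d y] d\<eta>[OF c transition(2)[OF d c ov]] d1_transition_fdg[OF _ _ d c ov] sE s\<xi>)
      also have "\<dots> = u ?q * \<omega> c (?T y) (?D' a) (?D' b)"
        by (simp add: curl_c[OF T] transition(3)[OF d c ov])
      also have "\<omega> c (?T y) (?D' a) (?D' b) = \<omega> d y a b"
        using symplectic d c ov unfolding symplectic_form_def smooth_form2_def by metis
      finally show ?thesis .
    qed
  qed
  have "surface_integral (contract \<eta> X) = surface_integral (\<lambda>q. F q * u q)"
    if X: "smooth_vector_field A X" and F: "smooth_function A F"
      and dF: "\<And>x v. x \<in> cube p r \<Longrightarrow> d0 F c x v = \<omega> c x (X c x) v" for X F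
  proof -
    have eval: "contract \<eta> X (chart_inv d y) = E1 (chart_inv d y) * d0 (\<xi> 1) d y (X d y) + E2 (chart_inv d y) * d0 (\<xi> 2) d y (X d y)"
      if "d \<in> A" "y \<in> chart_image d" for d y
      unfolding contract_eq[OF s\<eta> X that] by (simp add: \<eta>_def form1_add_def form1_scale_def fdg_def)
    have van: "vanishes_off ?S (contract \<eta> X)"
      unfolding vanishes_off_def
    proof (intro ballI impI)
      fix q assume q: "q \<in> topspace M" "q \<notin> ?S"
      obtain d where d: "d \<in> A" "q \<in> fst d" using chart_cover[OF q(1)] by blast
      have "E1 q = 0" "E2 q = 0" using vE q by (auto simp: vanishes_off_def)
      then show "contract \<eta> X q = 0"
        using eval[OF d(1) chart_mem[OF d(2)]] d by simp
    qed
    \<comment> \<open>The products f1 F and f2 F, extended by zero: the boundary terms of the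
      integration by parts.\<close>
    define g where "g f x = (if x \<in> chart_image c then extend c f (chart_inv c x) * F (chart_inv c x) else 0)" for f x
    have sg: "smooth_on UNIV (g f1)" "smooth_on UNIV (g f2)"
      unfolding g_def using smooth_on_extension(1)[OF c _ supp smooth_function_rep[OF F c]] sE vE
      by (auto simp: E1_def E2_def)
    have g0: "g f1 x = 0" "g f2 x = 0" if "x \<notin> cube p r" for x
      using f1_0[OF that] f2_0[OF that] by (auto simp: g_def)
    have Dg: "?D (g f) x v = f x * d0 F c x v + ?D f x v * F (chart_inv c x)"
      if x: "x \<in> chart_image c" and f: "smooth_on UNIV f" for f x v
    proof -
      have "((\<lambda>x. f x * F (chart_inv c x)) has_derivative (\<lambda>v. f x * d0 F c x v + ?D f x v * F (chart_inv c x))) (at x)"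
        by (rule has_derivative_mult[OF smooth_on_has_derivative[OF f UNIV_I] d0_has_derivative[OF F c x]])
      then have "(g f has_derivative (\<lambda>v. f x * d0 F c x v + ?D f x v * F (chart_inv c x))) (at x)"
        by (rule has_derivative_transform_within_open[OF _ chart(2)[OF c] x]) (simp add: g_def)
      from fun_cong[OF frechet_derivative_at[OF this], of v] show ?thesis by (rule sym)
    qed
    \<comment> \<open>With dF = \<omega>(X, .) the density times X is (d2 F, - d1 F). Hence the left
      side is f1 d2 F - f2 d1 F up to \<open>\<sigma>\<close>, and moving the derivatives off F
      leaves F times the curl \<open>k\<close>.\<close>
    have eq: "integrand c (contract \<eta> X) x =
        \<sigma> * ?D (g f1) x ?e2 - \<sigma> * ?D (g f2) x ?e1 + integrand c (\<lambda>q. F q * u q) x" for x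
    proof (cases "x \<in> cube p r")
      case False
      have "?D (g f1) x ?e2 = 0" "?D (g f2) x ?e1 = 0"
        by (rule derivative_vanishes_off[OF compact_cube _ False], erule g0)+
      then show ?thesis
        using vanishes_off_chart[OF c sub(2) van _ False] k0[OF False] by (simp add: ku) (simp add: integrand_def)
    next
      case True
      then have xc: "x \<in> chart_image c" using sub(2) by blast
      have "integrand c (contract \<eta> X) x = \<sigma> * (density c x * (f1 x * X c x $ 1 + f2 x * X c x $ 2))"
        using eval[OF c xc] by (simp add: integrand_def xc \<sigma>(1)[OF True] d\<xi>[OF True] E1_def E2_def)
      also have "\<dots> = \<sigma> * (f1 x * d0 F c x ?e2 - f2 x * d0 F c x ?e1)"
        unfolding dF[OF True] omega_eq[OF c xc] by (simp add: axis_simps algebra_simps)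
      also have "\<dots> = \<sigma> * ?D (g f1) x ?e2 - \<sigma> * ?D (g f2) x ?e1 + \<sigma> * (F (chart_inv c x) * k x)"
        unfolding Dg[OF xc f1] Dg[OF xc f2(1)] kf by (simp add: algebra_simps)
      finally show ?thesis by (simp only: ku)
    qed
    have vFu: "vanishes_off ?S (\<lambda>q. F q * u q)" using u(2) by (simp add: vanishes_off_def)
    have sFu: "smooth_function A (\<lambda>q. F q * u q)" by (intro smooth_function_mult F u)
    have "surface_integral (contract \<eta> X) = chart_integral c (contract \<eta> X)"
      by (rule surface_integral_local[OF c smooth_function_contract[OF s\<eta> X] supp[OF van]])
    also have "\<dots> = integral UNIV (\<lambda>x. \<sigma> * ?D (g f1) x ?e2 - \<sigma> * ?D (g f2) x ?e1 + integrand c (\<lambda>q. F q * u q) x)"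
      unfolding chart_integral_def by (rule arg_cong[of _ _ "integral UNIV"]) (rule ext, rule eq)
    also have "\<dots> = chart_integral c (\<lambda>q. F q * u q)"
      using int[OF sg(1) g0(1)] int[OF sg(2) g0(2)]
        compactly_supported_integrable_on[OF compactly_supported_integrand[OF c sFu supp[OF vFu]]]
      by (simp add: integral_add integral_diff integrable_diff integrable_on_mult_right chart_integral_def)
    also have "\<dots> = surface_integral (\<lambda>q. F q * u q)" by (rule surface_integral_local[OF c sFu supp[OF vFu], symmetric])
    finally show ?thesis .
  qed
  then show ?thesis using that s\<eta> curl by blast
qed

end

section \<open>Poincare duality for a symplectic vector field\<close>

context area_surface
begin

lemma vanishes_off_mono: "vanishes_off S h \<Longrightarrow> S \<subseteq> T \<Longrightarrow> vanishes_off T h"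
  by (auto simp: vanishes_off_def)

text \<open>The larger radius \<open>R\<close> leaves room for the cut-off used in the compactly
  supported Poincare lemma. Positivity is not part of the notion, only total integral 1.\<close>

definition bump_on :: "('a, 2) chart \<Rightarrow> real ^ 2 \<Rightarrow> real \<Rightarrow> ('a \<Rightarrow> real) \<Rightarrow> bool" where
  "bump_on c p r u \<longleftrightarrow> c \<in> A \<and> 0 < r \<and> (\<exists>R>r. cube p R \<subseteq> chart_image c) \<and>
     smooth_function A u \<and> vanishes_off (chart_inv c ` cube p r) u \<and> surface_integral u = 1"

lemma bump_onD:
  assumes "bump_on c p r u"
  shows "c \<in> A" "0 < r" "cube p r \<subseteq> chart_image c" "smooth_function A u"
    "vanishes_off (chart_inv c ` cube p r) u" "surface_integral u = 1"
    and openin_bump_on: "openin M (chart_inv c ` open_cube p r)"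
    and bump_on_interior: "chart_inv c ` open_cube p r \<subseteq> chart_inv c ` cube p r"
proof -
  obtain R where R: "R > r" "cube p R \<subseteq> chart_image c" using assms by (auto simp: bump_on_def)
  have "cube p r \<subseteq> cube p R" using R(1) by (intro cube_mono) simp
  then show sub: "cube p r \<subseteq> chart_image c" using R(2) by blast
  show c: "c \<in> A" using assms by (simp add: bump_on_def)
  show "openin M (chart_inv c ` open_cube p r)"
    using sub open_cube_subset by (intro openin_chart_inv_image[OF c open_open_cube]) blast
  show "chart_inv c ` open_cube p r \<subseteq> chart_inv c ` cube p r" by (intro image_mono open_cube_subset)
qed (use assms in \<open>auto simp: bump_on_def\<close>)

lemma small_bump:
  assumes W: "openin M W" and m: "m \<in> W"
  obtains c p r u where "bump_on c p r u" "m \<in> chart_inv c ` open_cube p r" "chart_inv c ` cube p r \<subseteq> W"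
proof -
  obtain c where c: "c \<in> A" "m \<in> fst c"
    using chart_cover openin_subset[OF W] m by blast
  let ?p = "snd c m"
  obtain R where R: "R > 0" "cube ?p R \<subseteq> snd c ` (fst c \<inter> W)"
    by (rule open_contains_cube[OF open_chart_image_Int[OF c(1) W], of ?p]) (use c m in auto)
  have im: "snd c ` (fst c \<inter> W) \<subseteq> chart_image c" by (auto simp: chart_mem)
  \<comment> \<open>Half of the radius is kept in reserve, as \<open>bump_on\<close> demands a
    larger cube inside the chart.\<close>
  have "cube ?p (R / 2) \<subseteq> cube ?p R" using R(1) by (intro cube_mono) simp
  with R(2) have half: "cube ?p (R / 2) \<subseteq> snd c ` (fst c \<inter> W)" by blast
  then have half': "cube ?p (R / 2) \<subseteq> chart_image c" using im by blast
  obtain u where u: "smooth_function A u" "vanishes_off (chart_inv c ` cube ?p (R / 2)) u" "surface_integral u = 1"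
    by (rule normalized_bump[OF c(1) _ half']) (use R(1) in auto)
  show ?thesis
  proof (rule that)
    show "bump_on c ?p (R / 2) u"
      unfolding bump_on_def using c u R im by (auto intro!: exI[of _ R])
    show "m \<in> chart_inv c ` open_cube ?p (R / 2)"
      using c R(1) by (intro image_eqI[where x = ?p]) (simp_all add: centre_open_cube)
    show "chart_inv c ` cube ?p (R / 2) \<subseteq> W"
    proof
      fix q assume "q \<in> chart_inv c ` cube ?p (R / 2)"
      then obtain q' where "q' \<in> fst c \<inter> W" "q = chart_inv c (snd c q')" using half by blast
      then show "q \<in> W" using c(1) by simp
    qed
  qed
qed

abbreviation form1_diff :: "('a, 2) form1 \<Rightarrow> ('a, 2) form1 \<Rightarrow> ('a, 2) form1" where
  "form1_diff \<alpha> \<beta> \<equiv> form1_add \<alpha> (form1_scale (-1) \<beta>)"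

lemma curl_diff:
  "smooth_form1 A \<alpha> \<Longrightarrow> smooth_form1 A \<beta> \<Longrightarrow> curl \<alpha> u \<Longrightarrow> curl \<beta> v \<Longrightarrow> curl (form1_diff \<alpha> \<beta>) (\<lambda>q. u q - v q)"
  using curl_add_scale[of \<alpha> \<beta> u v "-1"] by simp

lemma surface_integral_contract_diff:
  assumes "smooth_form1 A \<alpha>" "smooth_form1 A \<beta>" "smooth_vector_field A X"
  shows "surface_integral (contract (form1_diff \<alpha> \<beta>) X) = surface_integral (contract \<alpha> X) - surface_integral (contract \<beta> X)"
proof -
  have "surface_integral (contract (form1_diff \<alpha> \<beta>) X) = surface_integral (\<lambda>q. contract \<alpha> X q - contract \<beta> X q)"
    by (rule surface_integral_cong) (simp add: contract_add_scale[OF assms])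
  then show ?thesis
    using surface_integral_diff[OF smooth_function_contract[OF assms(1,3)] smooth_function_contract[OF assms(2,3)]] by simp
qed

lemma bump_diff_primitive:
  assumes u: "bump_on c p r u" and v: "smooth_function A v" "vanishes_off (chart_inv c ` cube p r) v" "surface_integral v = 1"
  obtains \<eta> where "smooth_form1 A \<eta>" "curl \<eta> (\<lambda>q. u q - v q)"
    "\<And>X F. smooth_vector_field A X \<Longrightarrow> smooth_function A F \<Longrightarrow>
      (\<And>x v. x \<in> cube p r \<Longrightarrow> d0 F c x v = \<omega> c x (X c x) v) \<Longrightarrow>
      surface_integral (contract \<eta> X) = surface_integral (\<lambda>q. F q * u q) - surface_integral (\<lambda>q. F q * v q)"
proof -
  note U = bump_onD[OF u]
  obtain R where R: "r < R" "cube p R \<subseteq> chart_image c" using u by (auto simp: bump_on_def)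
  have d: "smooth_function A (\<lambda>q. u q - v q)" "vanishes_off (chart_inv c ` cube p r) (\<lambda>q. u q - v q)"
    "surface_integral (\<lambda>q. u q - v q) = 0"
    using U v by (auto simp: smooth_function_diff vanishes_off_def surface_integral_diff)
  obtain \<eta> where \<eta>: "smooth_form1 A \<eta>" "curl \<eta> (\<lambda>q. u q - v q)"
    "\<And>X F. smooth_vector_field A X \<Longrightarrow> smooth_function A F \<Longrightarrow>
      (\<And>x v. x \<in> cube p r \<Longrightarrow> d0 F c x v = \<omega> c x (X c x) v) \<Longrightarrow>
      surface_integral (contract \<eta> X) = surface_integral (\<lambda>q. F q * (u q - v q))"
    by (rule compactly_supported_primitive[OF U(1,2) R d]) blast
  have "surface_integral (\<lambda>q. F q * (u q - v q)) = surface_integral (\<lambda>q. F q * u q) - surface_integral (\<lambda>q. F q * v q)" if "smooth_function A F" for F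
    unfolding right_diff_distrib by (intro surface_integral_diff smooth_function_mult that U(4) v(1))
  with \<eta> that show ?thesis by simp
qed

text \<open>Call a bump good if it differs from \<open>h\<close> by the curl of a form. The open
  cubes carrying good bumps and those carrying bad ones cover the surface. Where they met, a small
  common bump would link a bad one to a good one; so connectedness rules out bad bumps.\<close>

lemma bumps_cohomologous:
  assumes conn: "connected_space M" and h: "bump_on c0 p0 r0 h" and u: "bump_on c p r u"
  shows "\<exists>\<eta>. smooth_form1 A \<eta> \<and> curl \<eta> (\<lambda>q. u q - h q)"
proof (rule ccontr)
  define E where "E u \<longleftrightarrow> (\<exists>\<eta>. smooth_form1 A \<eta> \<and> curl \<eta> (\<lambda>q. u q - h q))" for u
  define U where "U b = \<Union>{chart_inv c ` open_cube p r |c p r. \<exists>u. bump_on c p r u \<and> E u = b}" for b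
  assume "\<not> ?thesis"
  then have notE: "\<not> E u" by (simp add: E_def)
  have memU: "m \<in> U b \<longleftrightarrow> (\<exists>c p r u. bump_on c p r u \<and> m \<in> chart_inv c ` open_cube p r \<and> E u = b)" for m b
    unfolding U_def by blast
  have op: "openin M (U b)" for b
    unfolding U_def by (rule openin_Union) (use openin_bump_on in blast)
  have "E h"
  proof -
    have "smooth_form1 A (\<lambda>c x u. 0)" using closed_form1_zero by (simp add: closed_form1_def)
    moreover have "curl (\<lambda>c x u. 0) (\<lambda>q. h q - h q)" by (simp add: curl_def d1_def)
    ultimately show ?thesis unfolding E_def by blast
  qed
  have "topspace M \<subseteq> U True \<union> U False"
  proof
    fix m assume m: "m \<in> topspace M"
    obtain c p r u where "bump_on c p r u" "m \<in> chart_inv c ` open_cube p r"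
      by (rule small_bump[OF openin_topspace m]) blast
    then have "m \<in> U (E u)" unfolding memU by blast
    then show "m \<in> U True \<union> U False" by (cases "E u") auto
  qed
  moreover have "U True \<inter> U False = {}"
  proof (rule ccontr)
    assume "\<not> ?thesis"
    then obtain m where m: "m \<in> U True" "m \<in> U False" by blast
    from m(1) obtain c1 p1 r1 u1 where
      1: "bump_on c1 p1 r1 u1" "m \<in> chart_inv c1 ` open_cube p1 r1" "E u1"
      unfolding memU by blast
    from m(2) obtain c2 p2 r2 u2 where
      2: "bump_on c2 p2 r2 u2" "m \<in> chart_inv c2 ` open_cube p2 r2" "\<not> E u2"
      unfolding memU by blast
    let ?W = "chart_inv c1 ` open_cube p1 r1 \<inter> chart_inv c2 ` open_cube p2 r2"
    have W: "openin M ?W" "m \<in> ?W"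
      using openin_Int[OF openin_bump_on[OF 1(1)] openin_bump_on[OF 2(1)]] 1(2) 2(2) by blast+
    obtain c p r v where v: "bump_on c p r v" "chart_inv c ` cube p r \<subseteq> ?W"
      by (rule small_bump[OF W]) blast
    \<comment> \<open>\<open>v\<close> is supported in both cubes, so it differs from each of
      \<open>u1\<close> and \<open>u2\<close> by the curl of some form.\<close>
    note V = bump_onD[OF v(1)]
    have v1: "vanishes_off (chart_inv c1 ` cube p1 r1) v"
      by (rule vanishes_off_mono[OF V(5) order_trans[OF v(2) le_infI1[OF bump_on_interior[OF 1(1)]]]])
    have v2: "vanishes_off (chart_inv c2 ` cube p2 r2) v"
      by (rule vanishes_off_mono[OF V(5) order_trans[OF v(2) le_infI2[OF bump_on_interior[OF 2(1)]]]])
    obtain \<eta>1 where \<eta>1: "smooth_form1 A \<eta>1" "curl \<eta>1 (\<lambda>q. u1 q - v q)"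
      by (rule bump_diff_primitive[OF 1(1) V(4) v1 V(6)]) blast
    obtain \<eta>2 where \<eta>2: "smooth_form1 A \<eta>2" "curl \<eta>2 (\<lambda>q. u2 q - v q)"
      by (rule bump_diff_primitive[OF 2(1) V(4) v2 V(6)]) blast
    obtain \<eta> where \<eta>: "smooth_form1 A \<eta>" "curl \<eta> (\<lambda>q. u1 q - h q)" using 1(3) unfolding E_def by blast
    let ?\<zeta> = "form1_diff \<eta>1 \<eta>"
    have \<zeta>: "smooth_form1 A ?\<zeta>" "curl ?\<zeta> (\<lambda>q. (u1 q - v q) - (u1 q - h q))"
      by (intro smooth_form1_add_scale curl_diff \<eta> \<eta>1)+
    \<comment> \<open>The functions telescope to u2 - h.\<close>
    have "smooth_form1 A (form1_diff \<eta>2 ?\<zeta>)"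
      "curl (form1_diff \<eta>2 ?\<zeta>) (\<lambda>q. (u2 q - v q) - ((u1 q - v q) - (u1 q - h q)))"
      by (rule smooth_form1_add_scale[OF \<eta>2(1) \<zeta>(1)], rule curl_diff[OF \<eta>2(1) \<zeta>(1) \<eta>2(2) \<zeta>(2)])
    then have "E u2" unfolding E_def by auto
    with 2(3) show False by blast
  qed
  moreover have "chart_inv c0 p0 \<in> U True" "chart_inv c p \<in> U False"
    unfolding memU using h u \<open>E h\<close> notE centre_open_cube[OF bump_onD(2)[OF h]] centre_open_cube[OF bump_onD(2)[OF u]]
    by blast+
  then have "U True \<noteq> {}" "U False \<noteq> {}" by auto
  ultimately show False
    using conn op[of True] op[of False] unfolding connected_space_def by blast
qed

lemma local_primitive:
  assumes \<alpha>: "closed_form1 A \<alpha>" and m: "m \<in> topspace M"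
  obtains c p r u F where "bump_on c p r u" "m \<in> chart_inv c ` open_cube p r" "smooth_function A F"
    "\<And>x v. x \<in> cube p r \<Longrightarrow> d0 F c x v = \<alpha> c x v"
proof -
  obtain c where c: "c \<in> A" "m \<in> fst c" using chart_cover[OF m] by blast
  let ?p = "snd c m"
  obtain R where R: "R > 0" "cube ?p R \<subseteq> chart_image c"
    by (rule open_contains_cube[OF chart(2)[OF c(1)] chart_mem[OF c(2)]]) blast
  have sub: "open_cube ?p R \<subseteq> chart_image c" using R(2) open_cube_subset by blast
  have s\<alpha>: "smooth_form1 A \<alpha>" using \<alpha> by (simp add: closed_form1_def)
  have sm: "smooth_on (open_cube ?p R) (\<lambda>x. \<alpha> c x v)" for v
    by (rule smooth_on_subset[OF smooth_form1D(2)[OF s\<alpha> c(1)] sub])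
  obtain F0 where F0: "\<And>x. x \<in> open_cube ?p R \<Longrightarrow> (F0 has_derivative \<alpha> c x) (at x)"
  proof (rule closed_form_has_primitive[OF open_open_cube convex_open_cube, of ?p R "\<alpha> c"])
    show "linear (\<alpha> c x)" if "x \<in> open_cube ?p R" for x
      using smooth_form1D(1)[OF s\<alpha> c(1)] sub that by blast
    show "frechet_derivative (\<lambda>y. \<alpha> c y v) (at x) u = frechet_derivative (\<lambda>y. \<alpha> c y u) (at x) v"
      if "x \<in> open_cube ?p R" for x u v
    proof -
      have "d1 \<alpha> c x u v = 0" using \<alpha> c(1) sub that by (auto simp: closed_form1_def form2_zero_def)
      then show ?thesis by (simp add: d1_def)
    qed
  qed (use sm in auto)
  \<comment> \<open>The cut-off is 1 on the cube of radius R/2 and 0 outside that of radius 3R/4,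
    which lies inside the domain of \<open>F0\<close>.\<close>
  let ?cut = "cube_plateau ?p (R / 2) (3 * R / 4)"
  define \<phi> where "\<phi> x = (if x \<in> open_cube ?p R then F0 x * ?cut x else 0)" for x
  have cut0: "?cut x = 0" if "x \<notin> cube ?p (3 * R / 4)" for x
    using R(1) that by (intro cube_plateau_zero) auto
  have sub34: "cube ?p (3 * R / 4) \<subseteq> open_cube ?p R" using R(1) by (intro cube_subset_open_cube) simp
  have "smooth_on UNIV \<phi>"
    unfolding \<phi>_def
  proof (rule smooth_on_extend_zero[OF open_open_cube _ compact_imp_closed[OF compact_cube] sub34])
    show "smooth_on (open_cube ?p R) (\<lambda>x. F0 x * ?cut x)"
      by (intro smooth_on_mult open_open_cube smooth_on_primitive[OF open_open_cube F0 sm]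
          smooth_on_subset[OF smooth_cube_plateau]) (use R(1) in auto)
  qed (use cut0 in auto)
  then have sF: "smooth_function A (extend c \<phi>)"
    using sub34 sub by (intro smooth_function_extend[OF c(1) _ compact_cube, of _ ?p "3 * R / 4"])
      (auto simp: \<phi>_def cut0 intro: smooth_on_subset)
  have dF: "d0 (extend c \<phi>) c x v = \<alpha> c x v" if x: "x \<in> open_cube ?p (R / 2)" for x v
  proof -
    have sub2: "open_cube ?p (R / 2) \<subseteq> open_cube ?p R" using R(1) by (intro open_cube_mono) simp
    have "(F0 has_derivative \<alpha> c x) (at x)" using F0 x sub2 by blast
    then have "((\<lambda>x. extend c \<phi> (chart_inv c x)) has_derivative \<alpha> c x) (at x)"
    proof (rule has_derivative_transform_within_open[OF _ open_open_cube x])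
      fix y assume y: "y \<in> open_cube ?p (R / 2)"
      then have "y \<in> open_cube ?p R" "y \<in> cube ?p (R / 2)" "y \<in> chart_image c"
        using sub2 sub open_cube_subset by blast+
      then show "F0 y = extend c \<phi> (chart_inv c y)"
        using R(1) by (simp add: \<phi>_def cube_plateau_one)
    qed
    from fun_cong[OF d0_eqI[OF this]] show ?thesis .
  qed
  have "m \<in> chart_inv c ` open_cube ?p (R / 2)"
    using c R(1) by (intro image_eqI[where x = ?p]) (simp_all add: centre_open_cube)
  \<comment> \<open>The closed cube of the bump has to lie in the open cube where the cut-off does
    not alter the primitive; hence a quarter of \<open>R\<close>.\<close>
  have sub4: "cube ?p (R / 4) \<subseteq> open_cube ?p (R / 2)" using R(1) by (intro cube_subset_open_cube) simp
  then have sub4': "cube ?p (R / 4) \<subseteq> chart_image c"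
    using sub R(1) open_cube_mono[of "R / 2" R ?p] by auto
  obtain u where u: "smooth_function A u" "vanishes_off (chart_inv c ` cube ?p (R / 4)) u" "surface_integral u = 1"
    by (rule normalized_bump[OF c(1) _ sub4']) (use R(1) in auto)
  show ?thesis
  proof (rule that[OF _ _ sF])
    show "bump_on c ?p (R / 4) u"
      unfolding bump_on_def using c u R by (auto intro!: exI[of _ R])
    show "m \<in> chart_inv c ` open_cube ?p (R / 4)"
      using c R(1) by (intro image_eqI[where x = ?p]) (simp_all add: centre_open_cube)
    show "d0 (extend c \<phi>) c x v = \<alpha> c x v" if "x \<in> cube ?p (R / 4)" for x v
      using dF sub4 that by blast
  qed
qed

lemma primitive_in_other_chart:
  assumes \<alpha>: "smooth_form1 A \<alpha>" and F: "smooth_function A F" and c: "c \<in> A" "d \<in> A" "K \<subseteq> chart_image c"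
    and dF: "\<And>x v. x \<in> K \<Longrightarrow> d0 F c x v = \<alpha> c x v"
    and y: "y \<in> chart_image d" "chart_inv d y \<in> chart_inv c ` K"
  shows "d0 F d y v = \<alpha> d y v"
proof -
  have q: "chart_inv d y \<in> fst c" "snd c (chart_inv d y) \<in> K"
    using y(2) mem_chart_inv_image[OF c(1,3)] by blast+
  then have ov: "y \<in> overlap d c" and T: "transition d c y \<in> K"
    using y(1) c by (simp_all add: mem_overlap transition_def)
  show ?thesis
    using d0_transition[OF F c(2,1) ov, of v] smooth_form1D(3)[OF \<alpha> c(2,1) ov, of v] dF[OF T] by simp
qed

text \<open>If \<open>dF\<close> is the contraction of \<open>\<omega>\<close> with \<open>X\<close> near \<open>q\<close>, \<open>u\<close> is a bump near \<open>q\<close> and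
  \<open>d\<eta> = (u - h) \<omega>\<close>, then the integral of \<open>\<eta>(X) - F u\<close> plus \<open>F q\<close> does not depend on these
  choices, so it defines a global primitive.\<close>

theorem contraction_exact:
  assumes conn: "connected_space M" and X: "smooth_vector_field A X"
    and \<alpha>: "closed_form1 A (interior_product X \<omega>)"
    and annihilates: "\<And>\<beta>. closed_form1 A \<beta> \<Longrightarrow> surface_integral (contract \<beta> X) = 0"
  shows "exact_form1 A (interior_product X \<omega>)"
proof (cases "topspace M = {}")
  case True
  then have "chart_image c = {}" if "c \<in> A" for c
    using chart_inv_topspace[OF that] by blast
  then show ?thesis
    unfolding exact_form1_def by (intro exI[of _ "\<lambda>_. 0"]) (auto simp: smooth_function_const)
next
  case False
  let ?\<alpha> = "interior_product X \<omega>"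
  have s\<alpha>: "smooth_form1 A ?\<alpha>" using \<alpha> by (simp add: closed_form1_def)
  obtain m where m: "m \<in> topspace M" using False by blast
  obtain c0 p0 r0 h where h: "bump_on c0 p0 r0 h"
    by (rule small_bump[OF openin_topspace m]) blast
  \<comment> \<open>\<open>z\<close> is the candidate for the value of the primitive at
    \<open>q\<close>. The first two terms normalize the local primitive \<open>F\<close> by a
    constant that depends on \<open>u\<close>, \<eta> and \<open>F\<close> but not on
    \<open>q\<close>.\<close>
  define datum where "datum c p r u F \<eta> q z \<longleftrightarrow> bump_on c p r u \<and> q \<in> chart_inv c ` open_cube p r \<and>
      smooth_function A F \<and> (\<forall>x\<in>cube p r. \<forall>v. d0 F c x v = ?\<alpha> c x v) \<and>
      smooth_form1 A \<eta> \<and> curl \<eta> (\<lambda>q. u q - h q) \<and> z = surface_integral (contract \<eta> X) - surface_integral (\<lambda>q. F q * u q) + F q"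
    for c p r u F \<eta> q z
  have unique: "z = z'" if D: "datum c p r u F \<eta> q z" and D': "datum c' p' r' u' F' \<eta>' q z'"
    for c p r u F \<eta> q z c' p' r' u' F' \<eta>' z'
  proof -
    have u: "bump_on c p r u" and F: "smooth_function A F" and dF: "\<And>x v. x \<in> cube p r \<Longrightarrow> d0 F c x v = ?\<alpha> c x v"
      and \<eta>: "smooth_form1 A \<eta>" "curl \<eta> (\<lambda>q. u q - h q)" and z: "z = surface_integral (contract \<eta> X) - surface_integral (\<lambda>q. F q * u q) + F q"
      using D by (auto simp: datum_def)
    have u': "bump_on c' p' r' u'" and F': "smooth_function A F'" and dF': "\<And>x v. x \<in> cube p' r' \<Longrightarrow> d0 F' c' x v = ?\<alpha> c' x v"
      and \<eta>': "smooth_form1 A \<eta>'" "curl \<eta>' (\<lambda>q. u' q - h q)" and z': "z' = surface_integral (contract \<eta>' X) - surface_integral (\<lambda>q. F' q * u' q) + F' q"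
      using D' by (auto simp: datum_def)
    note U = bump_onD[OF u] and U' = bump_onD[OF u']
    let ?W = "chart_inv c ` open_cube p r \<inter> chart_inv c' ` open_cube p' r'"
    have W: "openin M ?W" "q \<in> ?W"
      using openin_Int[OF U(7) U'(7)] D D' unfolding datum_def by blast+
    obtain c1 p1 r1 u1 where 1: "bump_on c1 p1 r1 u1" "q \<in> chart_inv c1 ` open_cube p1 r1" "chart_inv c1 ` cube p1 r1 \<subseteq> ?W"
      by (rule small_bump[OF W])
    note V = bump_onD[OF 1(1)]
    \<comment> \<open>The second shrinking puts the support of \<open>v\<close> into an open cube of
      the chart \<open>c1\<close>, on which F - F' is constant.\<close>
    obtain c2 p2 r2 v where 2: "bump_on c2 p2 r2 v" "chart_inv c2 ` cube p2 r2 \<subseteq> chart_inv c1 ` open_cube p1 r1"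
      by (rule small_bump[OF V(7) 1(2)])
    note v = bump_onD[OF 2(1)]
    \<comment> \<open>Both functions are primitives of the same form on a convex set.\<close>
    have "\<exists>\<kappa>. \<forall>x\<in>open_cube p1 r1. F (chart_inv c1 x) - F' (chart_inv c1 x) = \<kappa>"
    proof (rule has_derivative_zero_constant[OF convex_open_cube])
      fix x assume x: "x \<in> open_cube p1 r1"
      then have xc: "x \<in> chart_image c1" using V(3) open_cube_subset by blast
      have "chart_inv c1 x \<in> ?W" using x 1(3) V(8) by blast
      then have q: "chart_inv c1 x \<in> chart_inv c ` cube p r" "chart_inv c1 x \<in> chart_inv c' ` cube p' r'"
        using U(8) U'(8) by blast+
      have "d0 F c1 x w = d0 F' c1 x w" for w
        using primitive_in_other_chart[OF s\<alpha> F U(1) V(1) U(3) dF xc q(1), of w]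
          primitive_in_other_chart[OF s\<alpha> F' U'(1) V(1) U'(3) dF' xc q(2), of w] by simp
      then show "((\<lambda>x. F (chart_inv c1 x) - F' (chart_inv c1 x)) has_derivative (\<lambda>h. 0)) (at x within open_cube p1 r1)"
        using has_derivative_diff[OF d0_has_derivative[OF F V(1) xc] d0_has_derivative[OF F' V(1) xc]]
        by (simp add: has_derivative_at_withinI)
    qed
    then obtain \<kappa> where \<kappa>: "\<And>q. q \<in> chart_inv c1 ` open_cube p1 r1 \<Longrightarrow> F q - F' q = \<kappa>" by auto
    \<comment> \<open>\<open>v\<close> has total integral 1, so averaging the constant F - F' with
      weight \<open>v\<close> returns its value at \<open>q\<close>.\<close>
    have "surface_integral (\<lambda>q. F q * v q) - surface_integral (\<lambda>q. F' q * v q) = surface_integral (\<lambda>q. F q * v q - F' q * v q)"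
      by (intro surface_integral_diff[symmetric] smooth_function_mult F F' v(4))
    also have "\<dots> = surface_integral (\<lambda>q. \<kappa> * v q)"
    proof (rule surface_integral_cong)
      fix q assume q: "q \<in> topspace M"
      show "F q * v q - F' q * v q = \<kappa> * v q"
      proof (cases "q \<in> chart_inv c2 ` cube p2 r2")
        case True
        then show ?thesis using \<kappa>[of q] 2(2) by (auto simp flip: left_diff_distrib)
      next
        case False
        then show ?thesis using v(5) q by (simp add: vanishes_off_def)
      qed
    qed
    also have "\<dots> = F q - F' q" using surface_integral_scale[OF v(4)] v(6) \<kappa>[OF 1(2)] by simp
    finally have Jv: "surface_integral (\<lambda>q. F q * v q) - surface_integral (\<lambda>q. F' q * v q) = F q - F' q" .
    have "chart_inv c2 ` cube p2 r2 \<subseteq> ?W" using 2(2) 1(3) V(8) by blast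
    then have sub: "chart_inv c2 ` cube p2 r2 \<subseteq> chart_inv c ` cube p r" "chart_inv c2 ` cube p2 r2 \<subseteq> chart_inv c' ` cube p' r'"
      using U(8) U'(8) by blast+
    have van: "vanishes_off (chart_inv c ` cube p r) v" "vanishes_off (chart_inv c' ` cube p' r') v"
      by (rule vanishes_off_mono[OF v(5) sub(1)], rule vanishes_off_mono[OF v(5) sub(2)])
    obtain \<zeta> where \<zeta>: "smooth_form1 A \<zeta>" "curl \<zeta> (\<lambda>q. u q - v q)"
      "surface_integral (contract \<zeta> X) = surface_integral (\<lambda>q. F q * u q) - surface_integral (\<lambda>q. F q * v q)"
      by (rule bump_diff_primitive[OF u v(4) van(1) v(6)]) (use X F dF in \<open>simp add: interior_product_def\<close>)
    obtain \<zeta>' where \<zeta>': "smooth_form1 A \<zeta>'" "curl \<zeta>' (\<lambda>q. u' q - v q)"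
      "surface_integral (contract \<zeta>' X) = surface_integral (\<lambda>q. F' q * u' q) - surface_integral (\<lambda>q. F' q * v q)"
      by (rule bump_diff_primitive[OF u' v(4) van(2) v(6)]) (use X F' dF' in \<open>simp add: interior_product_def\<close>)
    \<comment> \<open>The curls of the four forms cancel: \<open>h\<close> and \<open>v\<close>
      occur in both halves, \<open>u\<close> and \<open>u'\<close> within one. The combination is
      closed, and the hypothesis applies to it.\<close>
    let ?\<theta> = "form1_diff (form1_diff \<eta> \<zeta>) (form1_diff \<eta>' \<zeta>')"
    have "smooth_form1 A ?\<theta>"
      by (intro smooth_form1_add_scale \<eta> \<eta>' \<zeta> \<zeta>')
    moreover have "curl ?\<theta> (\<lambda>q. ((u q - h q) - (u q - v q)) - ((u' q - h q) - (u' q - v q)))"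
      by (intro curl_diff smooth_form1_add_scale \<eta> \<eta>' \<zeta> \<zeta>')
    ultimately have "closed_form1 A ?\<theta>"
      by (simp add: closed_form1_def form2_zero_def curl_def)
    from annihilates[OF this]
    have "surface_integral (contract \<eta> X) - surface_integral (contract \<zeta> X) - (surface_integral (contract \<eta>' X) - surface_integral (contract \<zeta>' X)) = 0"
      by (simp add: surface_integral_contract_diff smooth_form1_add_scale \<eta> \<eta>' \<zeta> \<zeta>' X)
    then show ?thesis
      using \<zeta>(3) \<zeta>'(3) Jv z z' by linarith
  qed
  define f where "f q = (THE z. \<exists>c p r u F \<eta>. datum c p r u F \<eta> q z)" for q
  have f: "f q = z" if "datum c p r u F \<eta> q z" for c p r u F \<eta> q z
    unfolding f_def using that unique by blast
  \<comment> \<open>One fixed choice of \<open>u\<close>, \<open>F\<close> and \<eta> is a datum for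
    all points of an open cube, so there \<open>f\<close> is \<open>F\<close> plus a constant;
    smoothness and the differential are inherited from \<open>F\<close>.\<close>
  have glue: "\<exists>W F. openin M W \<and> m \<in> W \<and> smooth_function A F \<and> (\<exists>\<kappa>. \<forall>q\<in>W. f q = F q + \<kappa>) \<and>
      (\<forall>d\<in>A. \<forall>y\<in>chart_image d. chart_inv d y \<in> W \<longrightarrow> (\<forall>v. d0 F d y v = ?\<alpha> d y v))" if m: "m \<in> topspace M" for m
  proof -
    obtain c p r u F where u: "bump_on c p r u" "m \<in> chart_inv c ` open_cube p r" and F: "smooth_function A F"
      and dF: "\<And>x v. x \<in> cube p r \<Longrightarrow> d0 F c x v = ?\<alpha> c x v"
      by (rule local_primitive[OF \<alpha> m]) blast
    note U = bump_onD[OF u(1)]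
    obtain \<eta> where \<eta>: "smooth_form1 A \<eta>" "curl \<eta> (\<lambda>q. u q - h q)"
      using bumps_cohomologous[OF conn h u(1)] by blast
    have "f q = F q + (surface_integral (contract \<eta> X) - surface_integral (\<lambda>q. F q * u q))" if "q \<in> chart_inv c ` open_cube p r" for q
      by (rule f[where c = c and p = p and r = r and u = u and F = F and \<eta> = \<eta>])
        (simp add: datum_def u F dF \<eta> that)
    moreover have "d0 F d y v = ?\<alpha> d y v"
      if "d \<in> A" "y \<in> chart_image d" "chart_inv d y \<in> chart_inv c ` open_cube p r" for d y v
      by (rule primitive_in_other_chart[OF s\<alpha> F U(1) that(1) U(3) dF that(2)]) (use that(3) U(8) in blast)+
    ultimately show ?thesis
      using U(7) u(2) F by (intro exI[of _ "chart_inv c ` open_cube p r"] exI[of _ F]) blast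
  qed
  have loc: "\<exists>V F \<kappa>. open V \<and> y \<in> V \<and> V \<subseteq> chart_image d \<and> smooth_function A F \<and>
      (\<forall>x\<in>V. f (chart_inv d x) = F (chart_inv d x) + \<kappa>) \<and> (\<forall>v. d0 F d y v = ?\<alpha> d y v)"
    if d: "d \<in> A" and y: "y \<in> chart_image d" for d y
  proof -
    obtain W F \<kappa> where W: "openin M W" "chart_inv d y \<in> W" "smooth_function A F" "\<And>q. q \<in> W \<Longrightarrow> f q = F q + \<kappa>"
      "\<And>v. d0 F d y v = ?\<alpha> d y v"
      using glue[OF chart_inv_topspace[OF d y]] d y by blast
    have "y \<in> snd d ` (fst d \<inter> W)"
      using W(2) y chart_inv_mem[OF y] by (intro image_eqI[where x = "chart_inv d y"]) auto
    moreover have "f (chart_inv d x) = F (chart_inv d x) + \<kappa>" if "x \<in> snd d ` (fst d \<inter> W)" for x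
      using that d by (auto intro: W(4))
    ultimately show ?thesis
      using open_chart_image_Int[OF d W(1)] W(3,5)
      by (intro exI[of _ "snd d ` (fst d \<inter> W)"] exI[of _ F] exI[of _ \<kappa>]) (auto simp: chart_mem)
  qed
  have "smooth_function A f"
    unfolding smooth_function_def comp_def
  proof (intro ballI smooth_on_local)
    fix d y assume d: "d \<in> A" and y: "y \<in> chart_image d"
    obtain V F \<kappa> where V: "open V" "y \<in> V" "V \<subseteq> chart_image d" "smooth_function A F"
      "\<forall>x\<in>V. f (chart_inv d x) = F (chart_inv d x) + \<kappa>" using loc[OF d y] by blast
    have "smooth_on V (\<lambda>x. F (chart_inv d x) + \<kappa>)"
      by (intro smooth_on_add smooth_on_const V smooth_on_subset[OF smooth_function_rep[OF V(4) d]])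
    then have "smooth_on V (\<lambda>x. f (chart_inv d x))"
      by (rule smooth_on_cong[OF V(1), rotated]) (use V(5) in simp)
    then show "\<exists>V. open V \<and> y \<in> V \<and> smooth_on V (\<lambda>x. f (chart_inv d x))" using V by blast
  qed
  moreover have "?\<alpha> d y v = d0 f d y v" if d: "d \<in> A" and y: "y \<in> chart_image d" for d y v
  proof -
    obtain V F \<kappa> where V: "open V" "y \<in> V" "V \<subseteq> chart_image d" "smooth_function A F"
      "\<forall>x\<in>V. f (chart_inv d x) = F (chart_inv d x) + \<kappa>" "\<forall>v. d0 F d y v = ?\<alpha> d y v" using loc[OF d y] by blast
    have "((\<lambda>x. F (chart_inv d x) + \<kappa>) has_derivative d0 F d y) (at y)"
      using has_derivative_add[OF d0_has_derivative[OF V(4) d y] has_derivative_const[of \<kappa>]] by simp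
    then have "((\<lambda>x. f (chart_inv d x)) has_derivative d0 F d y) (at y)"
      by (rule has_derivative_transform_within_open[OF _ V(1,2)]) (use V(5) in simp)
    from d0_eqI[OF this] V(6) show ?thesis by simp
  qed
  ultimately show ?thesis unfolding exact_form1_def by blast
qed

end

section \<open>Bases of the first cohomology\<close>

definition form1_comb :: "'i set \<Rightarrow> ('i \<Rightarrow> real) \<Rightarrow> ('i \<Rightarrow> ('a, 'n::finite) form1) \<Rightarrow> ('a, 'n) form1" where
  "form1_comb I r \<alpha> c x u = (\<Sum>i\<in>I. r i * \<alpha> i c x u)"

context atlas_mfd
begin

text \<open>The class of a form that is not closed is empty, as \<open>cohomologous\<close> relates
  closed forms only, and no element of a quotient is empty. Closedness of the contractions can thus
  be read off from \<open>is_basis\<close>.\<close>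

lemma de_rham_class_mem_iff:
  "de_rham_class A \<alpha> \<in> carrier (de_rham_H1 A) \<longleftrightarrow> closed_form1 A \<alpha>"
proof
  assume "de_rham_class A \<alpha> \<in> carrier (de_rham_H1 A)"
  then obtain \<beta> where \<beta>: "closed_form1 A \<beta>" "de_rham_class A \<alpha> = de_rham_class A \<beta>"
    unfolding carrier_H1 by blast
  then have "\<beta> \<in> de_rham_class A \<alpha>"
    using equiv_class_self[OF equiv_cohomologous] by (simp add: de_rham_class_def)
  then show "closed_form1 A \<alpha>" by (auto simp: de_rham_class_def cohomologous_def)
qed (auto simp: carrier_H1)

lemma de_rham_class_eqD:
  assumes "closed_form1 A \<beta>" "de_rham_class A \<alpha> = de_rham_class A \<beta>"
  shows "exact_form1 A (form1_add \<beta> (form1_scale (-1) \<alpha>))"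
proof -
  have "\<beta> \<in> de_rham_class A \<alpha>"
    using equiv_class_self[OF equiv_cohomologous] assms by (simp add: de_rham_class_def)
  then show ?thesis by (auto simp: de_rham_class_def cohomologous_def)
qed

lemma finsum_de_rham_class:
  assumes "finite I" "\<And>i. i \<in> I \<Longrightarrow> closed_form1 A (\<alpha> i)"
  shows "closed_form1 A (form1_comb I r \<alpha>) \<and>
    (\<Oplus>\<^bsub>de_rham_H1 A\<^esub>i\<in>I. r i \<odot>\<^bsub>de_rham_H1 A\<^esub> de_rham_class A (\<alpha> i)) = de_rham_class A (form1_comb I r \<alpha>)"
  using assms
proof (induction I)
  case empty
  interpret H: abelian_group "de_rham_H1 A" by (rule abelian_group_H1)
  have "form1_comb {} r \<alpha> = (\<lambda>c x u. 0)" by (simp add: form1_comb_def fun_eq_iff)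
  then show ?case by (simp add: H1_simps)
next
  case (insert i I)
  interpret H: abelian_group "de_rham_H1 A" by (rule abelian_group_H1)
  have cl: "closed_form1 A (\<alpha> j)" if "j \<in> insert i I" for j by (rule insert.prems[OF that])
  have IH: "closed_form1 A (form1_comb I r \<alpha>)"
    "(\<Oplus>\<^bsub>de_rham_H1 A\<^esub>i\<in>I. r i \<odot>\<^bsub>de_rham_H1 A\<^esub> de_rham_class A (\<alpha> i)) = de_rham_class A (form1_comb I r \<alpha>)"
    using insert.IH cl by auto
  have eq: "form1_comb (insert i I) r \<alpha> = form1_add (form1_scale (r i) (\<alpha> i)) (form1_comb I r \<alpha>)"
    using insert.hyps by (simp add: form1_comb_def form1_add_def form1_scale_def fun_eq_iff)
  have car: "r j \<odot>\<^bsub>de_rham_H1 A\<^esub> de_rham_class A (\<alpha> j) \<in> carrier (de_rham_H1 A)" if "j \<in> insert i I" for j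
    by (simp add: smult_H1 cl[OF that] de_rham_class_mem_iff closed_form1_scale)
  have "(\<Oplus>\<^bsub>de_rham_H1 A\<^esub>j\<in>insert i I. r j \<odot>\<^bsub>de_rham_H1 A\<^esub> de_rham_class A (\<alpha> j)) =
      (r i \<odot>\<^bsub>de_rham_H1 A\<^esub> de_rham_class A (\<alpha> i)) \<oplus>\<^bsub>de_rham_H1 A\<^esub> de_rham_class A (form1_comb I r \<alpha>)"
    using H.finsum_insert[OF insert.hyps] car by (simp add: IH(2) Pi_iff)
  also have "\<dots> = de_rham_class A (form1_comb (insert i I) r \<alpha>)"
    unfolding eq by (simp add: smult_H1 add_H1 cl closed_form1_scale IH(1))
  finally show ?case
    unfolding eq by (simp add: closed_form1_add closed_form1_scale cl IH(1))
qed

text \<open>The statements about sums in the quotient are translated into exactness of actual linear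
  combinations of forms, the only shape used below.\<close>

lemma
  assumes "is_basis (de_rham_H1 A) I (\<lambda>i. de_rham_class A (\<alpha> i))"
  shows basis_closed: "i \<in> I \<Longrightarrow> closed_form1 A (\<alpha> i)"
    and basis_independent: "exact_form1 A (form1_comb I r \<alpha>) \<Longrightarrow> i \<in> I \<Longrightarrow> r i = 0"
    and basis_spans: "closed_form1 A \<beta> \<Longrightarrow> \<exists>r. exact_form1 A (form1_add \<beta> (form1_scale (-1) (form1_comb I r \<alpha>)))"
proof -
  have fin: "finite I" and car: "\<And>i. i \<in> I \<Longrightarrow> de_rham_class A (\<alpha> i) \<in> carrier (de_rham_H1 A)"
    using assms by (auto simp: is_basis_def)
  show cl: "i \<in> I \<Longrightarrow> closed_form1 A (\<alpha> i)" for i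
    using car by (simp add: de_rham_class_mem_iff)
  have sum: "closed_form1 A (form1_comb I r \<alpha>)"
    "(\<Oplus>\<^bsub>de_rham_H1 A\<^esub>i\<in>I. r i \<odot>\<^bsub>de_rham_H1 A\<^esub> de_rham_class A (\<alpha> i)) = de_rham_class A (form1_comb I r \<alpha>)" for r
    using finsum_de_rham_class[of I \<alpha> r] fin cl by blast+
  show "r i = 0" if ex: "exact_form1 A (form1_comb I r \<alpha>)" and i: "i \<in> I"
  proof -
    have "form1_add (form1_comb I r \<alpha>) (form1_scale (-1) (\<lambda>c x u. 0)) = form1_comb I r \<alpha>"
      by (simp add: form1_add_def form1_scale_def fun_eq_iff)
    then have "((\<lambda>c x u. 0), form1_comb I r \<alpha>) \<in> cohomologous A"
      using ex sum(1)[of r] by (simp add: cohomologous_def closed_form1_zero)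
    then have "de_rham_class A (form1_comb I r \<alpha>) = \<zero>\<^bsub>de_rham_H1 A\<^esub>"
      unfolding zero_H1 de_rham_class_def by (rule equiv_class_eq[OF equiv_cohomologous, symmetric])
    then show ?thesis
      using assms sum(2)[of r] i unfolding is_basis_def by simp
  qed
  show "\<exists>r. exact_form1 A (form1_add \<beta> (form1_scale (-1) (form1_comb I r \<alpha>)))" if "closed_form1 A \<beta>"
  proof -
    have "de_rham_class A \<beta> \<in> carrier (de_rham_H1 A)" using that by (simp add: de_rham_class_mem_iff)
    then obtain r where "de_rham_class A \<beta> = (\<Oplus>\<^bsub>de_rham_H1 A\<^esub>i\<in>I. r i \<odot>\<^bsub>de_rham_H1 A\<^esub> de_rham_class A (\<alpha> i))"
      using assms unfolding is_basis_def by blast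
    then have "de_rham_class A (form1_comb I r \<alpha>) = de_rham_class A \<beta>" using sum(2)[of r] by simp
    from de_rham_class_eqD[OF that this] show ?thesis by blast
  qed
qed

lemma constant_if_d0_zero:
  assumes conn: "connected_space M" and f: "smooth_function A f"
    and d0: "\<And>c x v. c \<in> A \<Longrightarrow> x \<in> chart_image c \<Longrightarrow> d0 f c x v = 0"
  obtains \<kappa> where "\<And>q. q \<in> topspace M \<Longrightarrow> f q = \<kappa>"
proof (cases "topspace M = {}")
  case False
  then obtain m where m: "m \<in> topspace M" by blast
  have loc: "\<exists>T. openin M T \<and> q \<in> T \<and> (\<forall>q'\<in>T. f q' = f q)" if q: "q \<in> topspace M" for q
  proof -
    obtain c where c: "c \<in> A" "q \<in> fst c" using chart_cover[OF q] by blast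
    obtain e where e: "e > 0" "ball (snd c q) e \<subseteq> chart_image c"
      using open_contains_ball chart(2)[OF c(1)] chart_mem[OF c(2)] by blast
    have "\<exists>\<kappa>. \<forall>x\<in>ball (snd c q) e. f (chart_inv c x) = \<kappa>"
    proof (rule has_derivative_zero_constant[OF convex_ball])
      fix x assume "x \<in> ball (snd c q) e"
      then have x: "x \<in> chart_image c" using e(2) by blast
      have "d0 f c x = (\<lambda>h. 0)" using d0[OF c(1) x] by auto
      then show "((\<lambda>x. f (chart_inv c x)) has_derivative (\<lambda>h. 0)) (at x within ball (snd c q) e)"
        using d0_has_derivative[OF f c(1) x] by (simp add: has_derivative_at_withinI)
    qed
    then obtain \<kappa> where \<kappa>: "\<And>x. x \<in> ball (snd c q) e \<Longrightarrow> f (chart_inv c x) = \<kappa>" by blast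
    show ?thesis
    proof (intro exI conjI ballI)
      show "openin M (chart_inv c ` ball (snd c q) e)"
        by (rule openin_chart_inv_image[OF c(1) open_ball e(2)])
      show "q \<in> chart_inv c ` ball (snd c q) e"
        using c e(1) by (intro image_eqI[where x = "snd c q"]) simp_all
      show "f q' = f q" if "q' \<in> chart_inv c ` ball (snd c q) e" for q'
        using that \<kappa> \<kappa>[of "snd c q"] c e(1) by auto
    qed
  qed
  \<comment> \<open>Taking \<open>P\<close> arbitrary covers a level set and its complement at
    once.\<close>
  have op: "openin M {q \<in> topspace M. P (f q)}" for P
    unfolding openin_subopen[of M "{q \<in> topspace M. P (f q)}"]
  proof
    fix q assume "q \<in> {q \<in> topspace M. P (f q)}"
    then obtain T where T: "openin M T" "q \<in> T" "\<forall>q'\<in>T. f q' = f q" "P (f q)" using loc by blast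
    have "T \<subseteq> {q \<in> topspace M. P (f q)}"
    proof
      fix q' assume q': "q' \<in> T"
      then have "f q' = f q" using T(3) by blast
      with q' T(4) openin_subset[OF T(1)] show "q' \<in> {q \<in> topspace M. P (f q)}" by auto
    qed
    with T(1,2) show "\<exists>T. openin M T \<and> q \<in> T \<and> T \<subseteq> {q \<in> topspace M. P (f q)}" by blast
  qed
  have "topspace M \<subseteq> {q \<in> topspace M. f q = f m} \<union> {q \<in> topspace M. f q \<noteq> f m}"
    "{q \<in> topspace M. f q = f m} \<inter> {q \<in> topspace M. f q \<noteq> f m} = {}" "{q \<in> topspace M. f q = f m} \<noteq> {}"
    using m by auto
  then have "{q \<in> topspace M. f q \<noteq> f m} = {}"
    using conn op[of "\<lambda>z. z = f m"] op[of "\<lambda>z. z \<noteq> f m"] unfolding connected_space_def by metis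
  then show ?thesis using that by blast
qed (use that in blast)

end

section \<open>Pairings of commuting symplectic fields\<close>

context area_surface
begin

text \<open>The identity d(\<omega>(X, Y)) = - \<omega>([X, Y], .) for symplectic fields, checked in
  coordinates: each partial derivative is a combination of the two divergence identities and one
  component of the bracket.\<close>

lemma omega_commuting_fields_constant:
  assumes conn: "connected_space M"
    and X: "smooth_vector_field A X" "form2_zero A (lie_derivative X \<omega>)"
    and Y: "smooth_vector_field A Y" "form2_zero A (lie_derivative Y \<omega>)"
    and \<alpha>: "closed_form1 A (interior_product X \<omega>)" and br: "vfield_zero A (lie_bracket X Y)"
  obtains \<kappa> where "\<And>c x. c \<in> A \<Longrightarrow> x \<in> chart_image c \<Longrightarrow> \<omega> c x (X c x) (Y c x) = \<kappa>"
proof -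
  let ?\<alpha> = "interior_product X \<omega>"
  let ?h = "contract ?\<alpha> Y"
  have s\<alpha>: "smooth_form1 A ?\<alpha>" using \<alpha> by (simp add: closed_form1_def)
  have h: "?h (chart_inv c x) = \<omega> c x (X c x) (Y c x)" if "c \<in> A" "x \<in> chart_image c" for c x
    using contract_eq[OF s\<alpha> Y(1) that] by (simp add: interior_product_def)
  have "d0 ?h c x v = 0" if c: "c \<in> A" and x: "x \<in> chart_image c" for c x v
  proof -
    have sX: "smooth_on (chart_image c) (X c)" and sY: "smooth_on (chart_image c) (Y c)"
      using X(1) Y(1) c by (auto simp: smooth_vector_field_def)
    let ?X' = "frechet_derivative (X c) (at x)" and ?Y' = "frechet_derivative (Y c) (at x)"
      and ?w' = "frechet_derivative (density c) (at x)"
    note DX = smooth_on_has_derivative[OF sX x] and DY = smooth_on_has_derivative[OF sY x]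
      and Dw = smooth_on_has_derivative[OF smooth_density[OF c] x]
    note nth = bounded_linear.has_derivative[OF bounded_linear_vec_nth]
    let ?D = "\<lambda>v. density c x * ((X c x $ 1 * ?Y' v $ 2 + ?X' v $ 1 * Y c x $ 2) -
          (X c x $ 2 * ?Y' v $ 1 + ?X' v $ 2 * Y c x $ 1)) +
          ?w' v * (X c x $ 1 * Y c x $ 2 - X c x $ 2 * Y c x $ 1)"
    have "((\<lambda>x. density c x * (X c x $ 1 * Y c x $ 2 - X c x $ 2 * Y c x $ 1)) has_derivative ?D) (at x)"
      by (intro has_derivative_mult has_derivative_diff nth DX DY Dw)
    then have "((\<lambda>x. ?h (chart_inv c x)) has_derivative ?D) (at x)"
      by (rule has_derivative_transform_within_open[OF _ chart(2)[OF c] x]) (simp add: h c omega_eq)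
    then have d0: "d0 ?h c x = ?D" by (rule d0_eqI)
    have dp: "?X' u $ i = u $ 1 * ?X' (axis 1 1) $ i + u $ 2 * ?X' (axis 2 1) $ i"
      "?Y' u $ i = u $ 1 * ?Y' (axis 1 1) $ i + u $ 2 * ?Y' (axis 2 1) $ i"
      "?w' u = u $ 1 * ?w' (axis 1 1) + u $ 2 * ?w' (axis 2 1)" for u i
      using linear_plane[OF has_derivative_linear[OF DX], of u] linear_plane[OF has_derivative_linear[OF DY], of u]
        linear_plane[OF has_derivative_linear[OF Dw], of u] by simp_all
    \<comment> \<open>(a, b) are the components of X and (p, q) those of Y; an index 1 or 2 marks
      the partial derivative, and w0 is the density.\<close>
    define a b p q where abpq: "a = X c x $ 1" "b = X c x $ 2" "p = Y c x $ 1" "q = Y c x $ 2"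
    define a1 a2 b1 b2 where X'_def: "a1 = ?X' (axis 1 1) $ 1" "a2 = ?X' (axis 2 1) $ 1"
      "b1 = ?X' (axis 1 1) $ 2" "b2 = ?X' (axis 2 1) $ 2"
    define p1 p2 q1 q2 where Y'_def: "p1 = ?Y' (axis 1 1) $ 1" "p2 = ?Y' (axis 2 1) $ 1"
      "q1 = ?Y' (axis 1 1) $ 2" "q2 = ?Y' (axis 2 1) $ 2"
    define w0 w1 w2 where w_def': "w0 = density c x" "w1 = ?w' (axis 1 1)" "w2 = ?w' (axis 2 1)"
    note defs = abpq X'_def Y'_def w_def'
    have div: "a * w1 + b * w2 + w0 * (a1 + b2) = 0" "p * w1 + q * w2 + w0 * (p1 + q2) = 0"
      using divergence_free[OF c x X(2)] divergence_free[OF c x Y(2)] dp(3)[of "X c x"] dp(3)[of "Y c x"]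
      unfolding defs by simp_all
    have "?Y' (X c x) - ?X' (Y c x) = 0"
      using br c x by (simp add: vfield_zero_def lie_bracket_def)
    then have "?Y' (X c x) $ i = ?X' (Y c x) $ i" for i by simp
    from this[of 1] this[of 2]
    have bracket: "a * p1 + b * p2 = p * a1 + q * a2" "a * q1 + b * q2 = p * b1 + q * b2"
      unfolding dp(1)[of "Y c x"] dp(2)[of "X c x"] defs by simp_all
    \<comment> \<open>The first partial derivative of \<omega>(X, Y): q div(w X) - b div(w Y) plus w
      times the second component of the bracket. For \<open>e2\<close> the combination uses a, - p
      and minus the first component.\<close>
    have e1: "w0 * ((a * q1 + a1 * q) - (b * p1 + b1 * p)) + w1 * (a * q - b * p) = 0"
    proof -
      have "w0 * ((a * q1 + a1 * q) - (b * p1 + b1 * p)) + w1 * (a * q - b * p) =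
          q * (a * w1 + b * w2 + w0 * (a1 + b2)) - b * (p * w1 + q * w2 + w0 * (p1 + q2))
          + w0 * ((a * q1 + b * q2) - (p * b1 + q * b2))"
        by (simp add: algebra_simps)
      then show ?thesis by (simp add: div bracket)
    qed
    have e2: "w0 * ((a * q2 + a2 * q) - (b * p2 + b2 * p)) + w2 * (a * q - b * p) = 0"
    proof -
      have "w0 * ((a * q2 + a2 * q) - (b * p2 + b2 * p)) + w2 * (a * q - b * p) =
          a * (p * w1 + q * w2 + w0 * (p1 + q2)) - p * (a * w1 + b * w2 + w0 * (a1 + b2))
          - w0 * ((a * p1 + b * p2) - (p * a1 + q * a2))"
        by (simp add: algebra_simps)
      then show ?thesis by (simp add: div bracket)
    qed
    have "?D v = v $ 1 * (w0 * ((a * q1 + a1 * q) - (b * p1 + b1 * p)) + w1 * (a * q - b * p))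
        + v $ 2 * (w0 * ((a * q2 + a2 * q) - (b * p2 + b2 * p)) + w2 * (a * q - b * p))"
      unfolding dp(1)[of v] dp(2)[of v] dp(3)[of v] defs[symmetric] by (simp add: algebra_simps)
    then show ?thesis by (simp add: d0 e1 e2)
  qed
  then obtain \<kappa> where "\<And>q. q \<in> topspace M \<Longrightarrow> ?h q = \<kappa>"
    using constant_if_d0_zero[OF conn smooth_function_contract[OF s\<alpha> Y(1)]] by metis
  then show ?thesis using that h chart_inv_topspace by metis
qed

end

section \<open>Contradiction with linear independence in two cases\<close>

theorem corollary1p11:
  fixes M :: "'a topology" and A :: "('a, 2) chart set" and \<omega> :: "('a, 2) form2" and g :: nat
  assumes "closed_orientable_surface M A"
    and "genus M = enat g" and "g > 1"
    and "symplectic_form A \<omega>"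
  shows "\<not> (\<exists>X :: nat \<Rightarrow> ('a, 2) vfield.
    (\<forall>i\<in>{1..2*g}. smooth_vector_field A (X i)) \<and>
    (\<forall>i\<in>{1..2*g}. form2_zero A (lie_derivative (X i) \<omega>)) \<and>
    is_basis (de_rham_H1 A) {1..2*g} (\<lambda>i. de_rham_class A (interior_product (X i) \<omega>)) \<and>
    (\<forall>i\<in>{1..2*g}. \<forall>j\<in>{1..2*g}. vfield_zero A (lie_bracket (X i) (X j))))"
proof (intro notI, elim exE conjE)
  fix X :: "nat \<Rightarrow> ('a, 2) vfield"
  assume basis: "is_basis (de_rham_H1 A) {1..2*g} (\<lambda>i. de_rham_class A (interior_product (X i) \<omega>))"
    and all: "\<forall>i\<in>{1..2*g}. smooth_vector_field A (X i)"
      "\<forall>i\<in>{1..2*g}. form2_zero A (lie_derivative (X i) \<omega>)"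
      "\<forall>i\<in>{1..2*g}. \<forall>j\<in>{1..2*g}. vfield_zero A (lie_bracket (X i) (X j))"
  note X = bspec[OF all(1)] and L = bspec[OF all(2)] and br = bspec[OF bspec[OF all(3)]]
  have conn: "connected_space M" using assms(1) by (simp add: closed_orientable_surface_def)
  interpret area_surface M A \<omega>
  proof (intro area_surface.intro atlas_mfd.intro area_surface_axioms.intro)
    show "smooth_atlas M A" "Hausdorff_space M" "compact_space M"
      using assms(1) by (simp_all only: closed_orientable_surface_def smooth_manifold_def)
  qed (rule assms(4))
  let ?I = "{1..2*g}"
  let ?\<alpha> = "\<lambda>i. interior_product (X i) \<omega>"
  note cl = basis_closed[OF basis] and indep = basis_independent[OF basis] and spans = basis_spans[OF basis]
  have "\<forall>i\<in>?I. \<forall>j\<in>?I. \<exists>\<kappa>. \<forall>c\<in>A. \<forall>x\<in>chart_image c. \<omega> c x (X i c x) (X j c x) = \<kappa>"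
  proof (intro ballI)
    fix i j assume i: "i \<in> ?I" and j: "j \<in> ?I"
    show "\<exists>\<kappa>. \<forall>c\<in>A. \<forall>x\<in>chart_image c. \<omega> c x (X i c x) (X j c x) = \<kappa>"
    proof (rule omega_commuting_fields_constant[OF conn X[OF i] L[OF i] X[OF j] L[OF j] cl[OF i] br[OF i j]])
      fix \<kappa>
      assume "\<And>c x. c \<in> A \<Longrightarrow> x \<in> chart_image c \<Longrightarrow> \<omega> c x (X i c x) (X j c x) = \<kappa>"
      then show ?thesis by (intro exI ballI)
    qed
  qed
  then have "\<exists>k. \<forall>i\<in>?I. \<forall>j\<in>?I. \<forall>c\<in>A. \<forall>x\<in>chart_image c. \<omega> c x (X i c x) (X j c x) = k i j"
    unfolding bchoice_iff .
  then obtain k where k: "\<And>i j c x. i \<in> ?I \<Longrightarrow> j \<in> ?I \<Longrightarrow> c \<in> A \<Longrightarrow> x \<in> chart_image c \<Longrightarrow>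
      \<omega> c x (X i c x) (X j c x) = k i j"
    by blast
  show False
  \<comment> \<open>The split is on the values and not on \<open>k\<close>, which would be arbitrary
    if there were no chart points; a nonzero value comes with the point that ties it to
    \<open>k\<close>.\<close>
  proof (cases "\<forall>i\<in>?I. \<forall>j\<in>?I. \<forall>c\<in>A. \<forall>x\<in>chart_image c. \<omega> c x (X i c x) (X j c x) = 0")
    case False
    then obtain i j c0 x0 where ij: "i \<in> ?I" "j \<in> ?I" and c0: "c0 \<in> A" "x0 \<in> chart_image c0"
      and nz: "\<omega> c0 x0 (X i c0 x0) (X j c0 x0) \<noteq> 0" by blast
    have kij: "k i j \<noteq> 0" using nz k[OF ij c0] by simp
    have ne: "i \<noteq> j" using nz by (auto simp: omega_eq[OF c0] mult.commute)
    \<comment> \<open>Here g > 1 is used: the index set has more than two elements.\<close>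
    obtain l where l: "l \<in> ?I" "l \<noteq> i" "l \<noteq> j"
    proof -
      have "card {i, j} < card ?I" using assms(3) card_insert_le_m1[of 2 "{j}" i] by simp
      then have "\<not> ?I \<subseteq> {i, j}" using card_mono[of "{i, j}" ?I] by auto
      then show ?thesis using that by blast
    qed
    \<comment> \<open>The coefficients of the Pluecker relation with all terms on one side; the one
      at \<open>l\<close> is nonzero.\<close>
    define r where "r m = (if m = l then k i j else if m = i then - k l j else if m = j then k l i else 0)" for m
    have comb: "form1_comb ?I r ?\<alpha> c x u = 0" if c: "c \<in> A" "x \<in> chart_image c" for c x u
    proof -
      have "form1_comb ?I r ?\<alpha> c x u = (\<Sum>m\<in>{l, i, j}. r m * ?\<alpha> m c x u)"
        unfolding form1_comb_def using ij l by (intro sum.mono_neutral_right) (auto simp: r_def)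
      also have "\<dots> = k i j * \<omega> c x (X l c x) u - k l j * \<omega> c x (X i c x) u + k l i * \<omega> c x (X j c x) u"
        using l ne by (simp add: r_def interior_product_def)
      also have "\<dots> = 0"
        unfolding k[OF ij c, symmetric] k[OF l(1) ij(2) c, symmetric] k[OF l(1) ij(1) c, symmetric] omega_eq[OF c]
        by (simp add: algebra_simps)
      finally show ?thesis .
    qed
    have "exact_form1 A (form1_comb ?I r ?\<alpha>)"
      unfolding exact_form1_def
      by (intro exI[of _ "\<lambda>_. 0"] conjI ballI allI smooth_function_const) (simp only: comb d0_const)
    from indep[OF this l(1)] kij show False by (simp add: r_def)
  next
    case True
    have 1: "1 \<in> ?I" using assms(3) by simp
    have "exact_form1 A (?\<alpha> 1)"
    proof (rule contraction_exact[OF conn X[OF 1] cl[OF 1]])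
      fix \<beta> assume \<beta>: "closed_form1 A \<beta>"
      then have s\<beta>: "smooth_form1 A \<beta>" by (simp add: closed_form1_def)
      obtain r f where f: "smooth_function A f"
        "\<And>c x u. c \<in> A \<Longrightarrow> x \<in> chart_image c \<Longrightarrow> form1_add \<beta> (form1_scale (-1) (form1_comb ?I r ?\<alpha>)) c x u = d0 f c x u"
        using spans[OF \<beta>] unfolding exact_form1_def by blast
      have eq: "\<beta> c x (X 1 c x) = d0 f c x (X 1 c x)" if c: "c \<in> A" "x \<in> chart_image c" for c x
      proof -
        \<comment> \<open>All pairings with \<open>X 1\<close> vanish in this case, so only df
          remains of \<beta> when evaluated on \<open>X 1\<close>.\<close>
        have "form1_comb ?I r ?\<alpha> c x (X 1 c x) = 0"
          unfolding form1_comb_def interior_product_def using True 1 c by (intro sum.neutral) auto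
        then show ?thesis using f(2)[OF c, of "X 1 c x"] by (simp add: form1_add_def form1_scale_def)
      qed
      have "contract \<beta> (X 1) q = contract (d0 f) (X 1) q" if q: "q \<in> topspace M" for q
      proof -
        obtain c where c: "c \<in> A" "q \<in> fst c" using chart_cover[OF q] by blast
        then show ?thesis
          using contract_eq[OF s\<beta> X[OF 1] c(1) chart_mem[OF c(2)]] eq[OF c(1) chart_mem[OF c(2)]]
            contract_eq[OF smooth_form1_d0[OF f(1)] X[OF 1] c(1) chart_mem[OF c(2)]] by simp
      qed
      then have "surface_integral (contract \<beta> (X 1)) = surface_integral (contract (d0 f) (X 1))" by (rule surface_integral_cong)
      then show "surface_integral (contract \<beta> (X 1)) = 0" using surface_integral_contract_d0[OF f(1) X[OF 1] L[OF 1]] by simp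
    qed
    \<comment> \<open>The first contraction, written as a combination of all of them so that linear
      independence applies.\<close>
    moreover have "form1_comb ?I (\<lambda>m. if m = 1 then 1 else 0) ?\<alpha> = ?\<alpha> 1"
    proof (intro ext)
      fix c x u
      have "form1_comb ?I (\<lambda>m. if m = 1 then 1 else 0) ?\<alpha> c x u = (\<Sum>m\<in>?I. if m = 1 then ?\<alpha> m c x u else 0)"
        unfolding form1_comb_def by (intro sum.cong) auto
      then show "form1_comb ?I (\<lambda>m. if m = 1 then 1 else 0) ?\<alpha> c x u = ?\<alpha> 1 c x u"
        using 1 by (simp add: sum.delta)
    qed
    ultimately have "exact_form1 A (form1_comb ?I (\<lambda>m. if m = 1 then 1 else 0) ?\<alpha>)" by simp
    from indep[OF this 1] show False by simp
  qed
qed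

end
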